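(* Let $G$ be a subquartic graph (i.e. $\Delta(G)\le 4$). \begin{enumerate} \item If $G$ has girth at least $7$ and $\mathrm{mad}(G) < 2 + \frac{2}{13}$, then $\chi_s'(G) \leq 7$. \item If $G$ is planar and has girth at least $28$, then $\chi_s'(G) \leq 7$. \end{enumerate}
   Context: All graphs are simple and finite. A strong edge-coloring of $G$ is an assignment of colors to the edges such that any two edges at distance at most two (i.e. two distinct edges that share an endpoint or are joined by an edge) receive distinct colors; $\chi_s'(G)$ is the minimum number of colors in a strong edge-coloring of $G$. The maximum average degree $\mathrm{mad}(G)$ is the maximum of the average degree $2|E(H)|/|V(H)|$ over all (nonempty) subgraphs $H$ of $G$. The girth is the length of a shortest cycle. *)

theory Defs
  imports "HOL-Analysis.Analysis" "HOL-Library.Extended_Nat"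
begin

definition simple_graph :: "'a set \<Rightarrow> 'a set set \<Rightarrow> bool" where
  "simple_graph V E \<longleftrightarrow> finite V \<and> (\<forall>e\<in>E. e \<subseteq> V \<and> card e = 2)"

definition subgraph :: "'a set \<Rightarrow> 'a set set \<Rightarrow> 'a set \<Rightarrow> 'a set set \<Rightarrow> bool" where
  "subgraph W F V E \<longleftrightarrow> simple_graph W F \<and> W \<subseteq> V \<and> F \<subseteq> E"

definition vertex_degree :: "'a set set \<Rightarrow> 'a \<Rightarrow> nat" where
  "vertex_degree E v = card {e \<in> E. v \<in> e}"

(* Inserting 0 only matters for the graph without vertices. *)
definition max_degree :: "'a set \<Rightarrow> 'a set set \<Rightarrow> nat" where
  "max_degree V E = Max (insert 0 (vertex_degree E ` V))"

(* Unspecified (Max of the empty set) for the graph without vertices. *)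
definition mad :: "'a set \<Rightarrow> 'a set set \<Rightarrow> real" where
  "mad V E = Max {2 * real (card F) / real (card W) | W F. subgraph W F V E \<and> W \<noteq> {}}"

(* A cycle is given by the list of its vertices in cyclic order, so its length
   is the length of the list. *)
definition is_cycle :: "'a set set \<Rightarrow> 'a list \<Rightarrow> bool" where
  "is_cycle E vs \<longleftrightarrow> length vs \<ge> 3 \<and> distinct vs \<and>
     (\<forall>i. Suc i < length vs \<longrightarrow> {vs ! i, vs ! Suc i} \<in> E) \<and> {last vs, hd vs} \<in> E"

(* An acyclic graph has girth \<infinity>, the infimum of the empty set in enat. *)
definition girth :: "'a set set \<Rightarrow> enat" where
  "girth E = (INF vs \<in> {vs. is_cycle E vs}. enat (length vs))"

definition strong_edge_coloring :: "'a set set \<Rightarrow> ('a set \<Rightarrow> nat) \<Rightarrow> bool" where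
  "strong_edge_coloring E c \<longleftrightarrow>
     (\<forall>e\<in>E. \<forall>f\<in>E. e \<noteq> f \<and> (e \<inter> f \<noteq> {} \<or> (\<exists>u\<in>e. \<exists>v\<in>f. {u, v} \<in> E)) \<longrightarrow> c e \<noteq> c f)"

definition strong_chromatic_index :: "'a set set \<Rightarrow> nat" where
  "strong_chromatic_index E = (LEAST k. \<exists>c. strong_edge_coloring E c \<and> c ` E \<subseteq> {..<k})"

(* Drawing in the plane: vertices are distinct points, every edge is an arc between
   its end vertices that contains no other vertex, and two different edges meet at
   most in common end vertices. *)
definition plane_drawing ::
    "'a set \<Rightarrow> 'a set set \<Rightarrow> ('a \<Rightarrow> complex) \<Rightarrow> ('a set \<Rightarrow> real \<Rightarrow> complex) \<Rightarrow> bool" where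
  "plane_drawing V E p \<gamma> \<longleftrightarrow> inj_on p V \<and>
     (\<forall>e\<in>E. arc (\<gamma> e) \<and> {pathstart (\<gamma> e), pathfinish (\<gamma> e)} = p ` e \<and>
        path_image (\<gamma> e) \<inter> p ` V \<subseteq> p ` e) \<and>
     (\<forall>e\<in>E. \<forall>f\<in>E. e \<noteq> f \<longrightarrow> path_image (\<gamma> e) \<inter> path_image (\<gamma> f) \<subseteq> p ` (e \<inter> f))"

definition planar :: "'a set \<Rightarrow> 'a set set \<Rightarrow> bool" where
  "planar V E \<longleftrightarrow> (\<exists>p \<gamma>. plane_drawing V E p \<gamma>)"

end

(*
  A strong 7-edge-colouring of a graph of maximum degree at most 4 is obtained from a locally
  injective homomorphism phi into the odd graph O_4 = K(7,3): the vertices go to 3-subsets of a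
  7-element set, adjacent vertices to disjoint triples, and distinct neighbours of a vertex to
  distinct triples. The colour of an edge uv is the point outside phi(u) and phi(v).

  In a vertex-minimal graph without such a homomorphism every degree is 2, 3 or 4. A path of
  degree-2 vertices is coloured by a nonbacktracking walk in O_4 with prescribed first and last arc,
  so one has to know which arcs are joined by walks of a given length. It turns out that seven
  consecutive degree-2 vertices are reducible, as are a 7-cycle through six of them and a degree-3
  vertex whose three threads contain at least 12 vertices of degree 2 altogether. Hence, counting
  each degree-2 vertex from both ends of its thread, 2 n_2 <= 11 n_3 + 24 n_4, which contradicts
  13 |E| < 14 |V|.

  For planar graphs of girth at least 28 the inequality 13 |E| < 14 |V| comes from
  26 |E| + 28 <= 28 |V|. For a graph drawn in the closed disc of a cycle C of it one shows
  26 |E| + 28 + |C| <= 28 |V| by cutting the disc along a path (theta-curve theorem); the part outside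
  of C is moved inside by an inversion.
*)
theory Submission
  imports Defs
begin

section \<open>Nonbacktracking walks in the odd graph on 7 points\<close>

text \<open>Encoding colours by triples makes the constraints local: what can be prescribed at the
  two ends of a thread depends only on its end arcs. O_4 is 4-regular with girth 6 and odd girth 7,
  so short walks cannot realise every pair of ends; the exceptions for lengths 4 and 5 below come
  from this, and from length 6 on three of the four first steps are always available. The density
  28/13 is the balance point of the reductions: 13 d - 28 is -2, 11, 24 for d = 2, 3, 4, and 11 = 12
  - 1 and 24 = 4 * 6 bound the number of degree-2 vertices on the threads at a vertex of degree 3 or
  4. The bound for a disc is Euler's formula with faces eliminated: if the outer face has length |C|
  and every other face has length at least 28, then |V| - |E| + |F| = 2 becomes 26 |E| + 28 + |C| <=
  28 |V|. In this form it adds up correctly when the disc is cut along a path, so that no face is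
  ever counted. Without |C| it still holds, with equality, for a single vertex; this is what allows
  pieces attached at one vertex to be split off.\<close>

lemma card_Compl7: "card (- y) = 7 - card (y :: 7 set)"
  by (simp add: Compl_eq_Diff_UNIV card_Diff_subset)

text \<open>There is a nonbacktracking walk in the odd graph that starts with \<open>y, z\<close>, arrives at \<open>p\<close> after
  \<open>a\<close> steps and then continues to \<open>q\<close>. That \<open>p, q\<close> is an arc is not part of the definition.\<close>

fun reach :: "nat \<Rightarrow> 7 set \<Rightarrow> 7 set \<Rightarrow> 7 set \<Rightarrow> 7 set \<Rightarrow> bool" where
  "reach 0 p q y z \<longleftrightarrow> y = p \<and> z = q"
| "reach (Suc a) p q y z \<longleftrightarrow> card y = 3 \<and> card z = 3 \<and> y \<inter> z = {} \<and> (\<exists>x. x \<noteq> y \<and> reach a p q z x)"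

text \<open>The neighbours of \<open>y\<close> in the odd graph are the triples \<open>- y - {s}\<close> with \<open>s \<notin> y\<close>; the first step
  of a walk is recorded by \<open>s\<close>.\<close>

definition spokes :: "nat \<Rightarrow> 7 set \<Rightarrow> 7 set \<Rightarrow> 7 set \<Rightarrow> 7 set" where
  "spokes a p q y = {s. s \<notin> y \<and> reach a p q y (- y - {s})}"

definition odd_arc :: "7 set \<Rightarrow> 7 set \<Rightarrow> bool" where
  "odd_arc p q \<longleftrightarrow> card p = 3 \<and> card q = 3 \<and> p \<inter> q = {}"

lemma odd_arcD:
  assumes "odd_arc p q"
  shows "card p = 3" "card q = 3" "p \<inter> q = {}"
  using assms by (auto simp: odd_arc_def)

lemma odd_arc_missing:
  assumes "odd_arc y z"
  obtains s where "s \<notin> y" "z = - y - {s}"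
proof -
  have "card (- y - z) = 1"
  proof -
    have "- y - z = - (y \<union> z)" by auto
    moreover have "card (y \<union> z) = 6"
      using assms by (simp add: odd_arc_def card_Un_disjoint)
    ultimately show ?thesis by (simp only: card_Compl7)
  qed
  then obtain s where s: "- y - z = {s}" by (auto simp: card_1_singleton_iff)
  moreover have "z = - y - {s}"
    using s odd_arcD(3)[OF assms] by blast
  ultimately show ?thesis using that by blast
qed

lemma odd_arc_Diff: "card y = 3 \<Longrightarrow> s \<notin> y \<Longrightarrow> odd_arc y (- y - {s})"
  by (auto simp: odd_arc_def card_Compl7 card_Diff_singleton)

lemma reach_Suc_Diff:
  assumes "card y = 3" "s \<notin> y" "reach a p q (- y - {s}) x" "x \<noteq> y"
  shows "s \<in> spokes (Suc a) p q y"
  using assms odd_arc_Diff[OF assms(1,2)] by (auto simp: spokes_def odd_arc_def)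

lemma card_ge_2_obtain:
  assumes "card (A :: 'b::finite set) \<ge> 2" obtains s where "s \<in> A" "s \<noteq> x"
proof -
  have "\<not> A \<subseteq> {x}"
    using card_mono[of "{x}" A] assms by auto
  then show ?thesis using that by blast
qed

text \<open>From \<open>- y - {s}\<close> the only forbidden continuation is the one back to
  \<open>y\<close>, and it has the label \<open>s\<close> again. Two available labels there
  therefore leave an allowed one.\<close>

lemma spokes_Suc:
  assumes "card y = 3" "s \<notin> y" "card (spokes a p q (- y - {s})) \<ge> 2"
  shows "s \<in> spokes (Suc a) p q y"
proof -
  obtain t where t: "t \<in> spokes a p q (- y - {s})" "t \<noteq> s"
    using assms(3) by (rule card_ge_2_obtain)
  have "s \<in> - (- y - {s}) - {t}" using t by auto
  then have "- (- y - {s}) - {t} \<noteq> y" using assms(2) by metis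
  then show ?thesis
    using t(1) by (intro reach_Suc_Diff[OF assms(1,2)]) (auto simp: spokes_def)
qed

text \<open>The walk is \<open>y\<close>, \<open>- y - {s}\<close>, \<open>insert s (y - p)\<close>,
  \<open>p\<close>, \<open>q\<close>. Its third triple is forced, being disjoint from
  \<open>p\<close> and from the second one; the last hypothesis on \<open>s\<close> says that the
  walk does not backtrack at \<open>p\<close>.\<close>

lemma spokes_3:
  assumes pq: "odd_arc p q" and y: "card y = 3" "card (y \<inter> p) = 1"
    and s: "s \<notin> y" "s \<notin> p" "insert s (y - p) \<noteq> q"
  shows "s \<in> spokes 3 p q y"
proof -
  obtain a where a: "y \<inter> p = {a}" using y(2) by (auto simp: card_1_singleton_iff)
  have c: "card (y - p) = 2" using y by (simp add: card_Diff_subset_Int)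
  let ?z = "- y - {s}" and ?w = "insert s (y - p)"
  have "card ?w = 3" using c s by simp
  moreover have "?w \<noteq> y" "?w \<inter> p = {}" "p \<noteq> ?z" "card ?z = 3" "?z \<inter> ?w = {}"
    using s a odd_arc_Diff[OF y(1) s(1)] by (auto simp: odd_arc_def)
  ultimately have "reach 2 p q ?z ?w" "?w \<noteq> y"
    using s(3) pq by (auto simp: eval_nat_numeral odd_arc_def)
  then have "s \<in> spokes (Suc 2) p q y"
    using y s by (intro reach_Suc_Diff)
  then show ?thesis by (simp add: eval_nat_numeral)
qed

text \<open>Two points lie outside \<open>y \<union> p\<close>. Their walks enter \<open>p\<close>
  from different triples, at most one of which is \<open>q\<close>, and neither is \<open>q\<close>
  if \<open>y - p\<close> is not contained in \<open>q\<close>.\<close>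

lemma spokes_3_card:
  assumes pq: "odd_arc p q" and y: "card y = 3" "card (y \<inter> p) = 1"
  shows "card (spokes 3 p q y) \<ge> 1"
    and "\<not> y - p \<subseteq> q \<Longrightarrow> card (spokes 3 p q y) \<ge> 2"
proof -
  have "card (y \<union> p) = 5"
    using y card_Un_Int[of y p] odd_arcD(1)[OF pq] by simp
  then have c: "card (- (y \<union> p)) = 2" by (simp only: card_Compl7)
  then have ne: "- (y \<union> p) \<noteq> {}" by auto
  then obtain s t where st: "s \<in> - (y \<union> p)" "t \<in> - (y \<union> p)" "s \<noteq> t"
    using c by (auto simp: card_2_iff)
  have "insert s (y - p) \<noteq> q \<or> insert t (y - p) \<noteq> q" using st by blast
  then have "spokes 3 p q y \<noteq> {}"
    using spokes_3[OF pq y] st by blast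
  then show "card (spokes 3 p q y) \<ge> 1" by (simp add: Suc_le_eq card_gt_0_iff)
  assume "\<not> y - p \<subseteq> q"
  then have "- (y \<union> p) \<subseteq> spokes 3 p q y"
    by (auto intro!: spokes_3[OF pq y])
  then show "card (spokes 3 p q y) \<ge> 2"
    using card_mono c by (metis finite)
qed

text \<open>For \<open>s \<in> p - y\<close> the neighbour \<open>- y - {s}\<close> meets
  \<open>p\<close> in one point, so \<open>spokes_3\<close> applies to it. Of its two next labels,
  the points of \<open>y - p\<close>, at most one leads through \<open>q\<close>, and neither leads
  back to \<open>y\<close>.\<close>

lemma spokes_4_one:
  assumes pq: "odd_arc p q" and y: "card y = 3" "card (y \<inter> p) = 1"
  shows "p - y \<subseteq> spokes 4 p q y"
proof
  fix s assume s: "s \<in> p - y"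
  let ?z = "- y - {s}"
  have z: "card ?z = 3" using odd_arc_Diff[OF y(1), of s] s by (auto simp: odd_arc_def)
  have "card (p - y) = 2"
    using y odd_arcD(1)[OF pq] by (simp add: card_Diff_subset_Int Int_commute)
  moreover have "?z \<inter> p = (p - y) - {s}" by auto
  ultimately have zp: "card (?z \<inter> p) = 1" using s by simp
  have "card (y - p) = 2" using y by (simp add: card_Diff_subset_Int)
  then obtain t u where tu: "y - p = {t, u}" "t \<noteq> u" by (auto simp: card_2_iff)
  have "t \<notin> ?z - p" "u \<notin> ?z - p" using tu by blast+
  then have "insert t (?z - p) \<noteq> q \<or> insert u (?z - p) \<noteq> q" using tu(2) by blast
  then obtain r where r: "r \<in> y - p" "insert r (?z - p) \<noteq> q" using tu by blast
  then have "r \<in> spokes 3 p q ?z"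
    using spokes_3[OF pq z zp] by auto
  then have "reach 3 p q ?z (- ?z - {r})" by (simp add: spokes_def)
  moreover have "- ?z - {r} \<noteq> y" using r(1) by blast
  ultimately have "s \<in> spokes (Suc 3) p q y"
    using y(1) s by (intro reach_Suc_Diff) auto
  then show "s \<in> spokes 4 p q y" by (simp add: eval_nat_numeral)
qed

text \<open>For \<open>s\<close> outside \<open>y \<union> p\<close> the neighbour
  \<open>- y - {s}\<close> meets \<open>p\<close> once. Its next label has to be the single point
  \<open>f\<close> of \<open>y - p\<close>, because the label \<open>s\<close> returns to
  \<open>y\<close>. The walk then backtracks at \<open>p\<close> for at most one \<open>s\<close>,
  and for none if \<open>f \<notin> q\<close>.\<close>

lemma spokes_4_two:
  assumes pq: "odd_arc p q" and y: "card y = 3" "card (y \<inter> p) = 2"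
  shows "card (spokes 4 p q y) \<ge> 2"
    and "y \<inter> q \<subseteq> p \<Longrightarrow> card (spokes 4 p q y) \<ge> 3"
proof -
  have "card (y \<union> p) = 4"
    using y card_Un_Int[of y p] odd_arcD(1)[OF pq] by simp
  then have c: "card (- (y \<union> p)) = 3" by (simp only: card_Compl7)
  have "card (y - p) = 1" using y by (simp add: card_Diff_subset_Int)
  then obtain f where f: "y - p = {f}" by (auto simp: card_1_singleton_iff)
  have c1: "card (p - y) = 1"
    using y odd_arcD(1)[OF pq] by (simp add: card_Diff_subset_Int Int_commute)
  have *: "s \<in> spokes 4 p q y" if s: "s \<in> - (y \<union> p)" "insert f (- y - {s} - p) \<noteq> q" for s
  proof -
    let ?z = "- y - {s}"
    have z: "card ?z = 3" using odd_arc_Diff[OF y(1), of s] s by (auto simp: odd_arc_def)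
    have "?z \<inter> p = p - y" using s by auto
    then have "card (?z \<inter> p) = 1" using c1 by simp
    then have "f \<in> spokes 3 p q ?z"
      using spokes_3[OF pq z] s f by auto
    then have "reach 3 p q ?z (- ?z - {f})" by (simp add: spokes_def)
    moreover have "- ?z - {f} \<noteq> y" using f by blast
    ultimately have "s \<in> spokes (Suc 3) p q y"
      using y(1) s by (intro reach_Suc_Diff) auto
    then show ?thesis by (simp add: eval_nat_numeral)
  qed
  {
    assume "y \<inter> q \<subseteq> p"
    then have "f \<notin> q" using f odd_arcD(3)[OF pq] by auto
    then have "- (y \<union> p) \<subseteq> spokes 4 p q y" using * by blast
    then show "card (spokes 4 p q y) \<ge> 3"
      using card_mono c by (metis finite)
  }
  let ?B = "{s \<in> - (y \<union> p). insert f (- y - {s} - p) = q}"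
  have "s = t" if "s \<in> ?B" "t \<in> ?B" for s t
  proof (rule ccontr)
    assume "s \<noteq> t"
    then have "t \<in> insert f (- y - {s} - p)" "t \<notin> insert f (- y - {t} - p)"
      using that f by auto
    then show False using that by auto
  qed
  then have "card ?B \<le> 1" by (metis (no_types, lifting) card_le_Suc0_iff_eq finite One_nat_def)
  then have "card (- (y \<union> p) - ?B) \<ge> 2"
    using c diff_card_le_card_Diff[of ?B "- (y \<union> p)"] by simp
  moreover have "- (y \<union> p) - ?B \<subseteq> spokes 4 p q y" using * by blast
  ultimately show "card (spokes 4 p q y) \<ge> 2"
    by (meson card_mono finite le_trans)
qed

text \<open>The excluded triples, \<open>p\<close> and its neighbours, are genuine exceptions: a
  walk from there would give a nonbacktracking closed walk of length 4 or a closed walk of length 5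
  in O_4.\<close>

lemma spokes_4_card:
  assumes pq: "odd_arc p q" and y: "card y = 3" "y \<noteq> p" "y \<inter> p \<noteq> {}"
  shows "card (spokes 4 p q y) \<ge> 2"
proof -
  have "y \<inter> p \<noteq> y" "y \<inter> p \<subseteq> y"
    using y odd_arcD(1)[OF pq] card_subset_eq[of p y] by auto
  then have "card (y \<inter> p) < 3" using psubset_card_mono[of y "y \<inter> p"] y(1) by auto
  moreover have "card (y \<inter> p) > 0" using y(3) by (simp add: card_gt_0_iff)
  ultimately consider "card (y \<inter> p) = 1" | "card (y \<inter> p) = 2" by linarith
  then show ?thesis
  proof cases
    case 1
    then have "card (p - y) = 2"
      using y odd_arcD(1)[OF pq] by (simp add: card_Diff_subset_Int Int_commute)
    then show ?thesis using card_mono[OF _ spokes_4_one[OF pq y(1) 1]] by simp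
  next
    case 2
    then show ?thesis using spokes_4_two(1)[OF pq y(1)] by simp
  qed
qed

text \<open>Four points lie outside \<open>y\<close>; \<open>P\<close> describes the first steps
  that may fail, and at most one does.\<close>

lemma card_Compl_minus_one:
  assumes "card (y :: 7 set) = 3" "\<And>s. s \<in> - y \<Longrightarrow> s \<notin> S \<Longrightarrow> P s"
    "\<And>s t. s \<notin> y \<Longrightarrow> t \<notin> y \<Longrightarrow> P s \<Longrightarrow> P t \<Longrightarrow> s = t"
  shows "card S \<ge> 3"
proof -
  let ?B = "{s \<in> - y. P s}"
  have "card ?B \<le> 1"
    using assms(3) by (metis (mono_tags, lifting) ComplD One_nat_def card_le_Suc0_iff_eq finite mem_Collect_eq)
  then have "card (- y - ?B) \<ge> 3"
    using assms(1) diff_card_le_card_Diff[of ?B "- y"] by (simp add: card_Compl7)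
  moreover have "- y - ?B \<subseteq> S" using assms(2) by blast
  ultimately show ?thesis by (meson card_mono finite le_trans)
qed

text \<open>The first step \<open>s\<close> can fail only if \<open>- y - {s}\<close> is
  \<open>p\<close>, or is disjoint from \<open>p\<close>, which makes \<open>s\<close> the only
  point of \<open>p - y\<close>; the two possibilities exclude each other. The case
  \<open>y = p\<close> has to be left out since O_4 has no closed walk of length 5.\<close>

lemma spokes_5_card:
  assumes pq: "odd_arc p q" and y: "card y = 3" "y \<noteq> p"
  shows "card (spokes 5 p q y) \<ge> 3"
proof (rule card_Compl_minus_one[OF y(1)])
  let ?P = "\<lambda>s. - y - {s} = p \<or> (- y - {s}) \<inter> p = {}"
  show "?P s" if "s \<in> - y" "s \<notin> spokes 5 p q y" for s
  proof (rule ccontr)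
    assume "\<not> ?P s"
    then have "card (spokes 4 p q (- y - {s})) \<ge> 2"
      using odd_arc_Diff[OF y(1), of s] that by (intro spokes_4_card[OF pq]) (auto simp: odd_arc_def)
    then have "s \<in> spokes (Suc 4) p q y" using spokes_Suc[OF y(1)] that by blast
    then show False using that by simp
  qed
  have ps: "p \<subseteq> insert s y" if "(- y - {s}) \<inter> p = {}" for s using that by blast
  have np: "\<not> p \<subseteq> y"
    using y odd_arcD(1)[OF pq] card_subset_eq[of y p] by auto
  show "s = t" if "s \<notin> y" "t \<notin> y" "?P s" "?P t" for s t
  proof -
    have mixed: False if "- y - {s} = p" "(- y - {t}) \<inter> p = {}" for s t
    proof -
      have "p \<subseteq> {t}" using that by blast
      then show False using odd_arcD(1)[OF pq] card_mono[of "{t}" p] by simp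
    qed
    show ?thesis
      using that mixed[of s t] mixed[of t s] np by blast
  qed
qed

text \<open>The only neighbour of \<open>y\<close> from which five further steps may fail is
  \<open>p\<close> itself.\<close>

lemma spokes_6_card:
  assumes pq: "odd_arc p q" and y: "card y = 3"
  shows "card (spokes 6 p q y) \<ge> 3"
proof (rule card_Compl_minus_one[OF y])
  show "- y - {s} = p" if "s \<in> - y" "s \<notin> spokes 6 p q y" for s
  proof (rule ccontr)
    assume "- y - {s} \<noteq> p"
    then have "card (spokes 5 p q (- y - {s})) \<ge> 3"
      using odd_arc_Diff[OF y, of s] that by (intro spokes_5_card[OF pq]) (auto simp: odd_arc_def)
    then have "s \<in> spokes (Suc 5) p q y" using that by (intro spokes_Suc[OF y]) auto
    then show False using that by simp
  qed
qed blast

lemma spokes_0: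
  assumes "odd_arc p q"
  shows "card (spokes 0 p q p) \<ge> 1"
proof -
  obtain s where "s \<notin> p" "q = - p - {s}" using odd_arc_missing[OF assms] .
  then have "s \<in> spokes 0 p q p" by (simp add: spokes_def)
  then show ?thesis by (metis One_nat_def Suc_leI card_gt_0_iff empty_iff finite)
qed

lemma reach_imp_spokes_card:
  assumes "reach a p q y z" "odd_arc y z"
  shows "card (spokes a p q y) \<ge> 1"
proof -
  obtain s where "s \<notin> y" "z = - y - {s}" using odd_arc_missing[OF assms(2)] .
  then have "s \<in> spokes a p q y" using assms by (simp add: spokes_def)
  then show ?thesis by (metis One_nat_def Suc_leI card_gt_0_iff empty_iff finite)
qed

lemma spokes_1:
  assumes "odd_arc p q" "odd_arc y p" "y \<noteq> q"
  shows "card (spokes 1 p q y) \<ge> 1"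
  using assms by (intro reach_imp_spokes_card[of _ _ _ _ p]) (auto simp: odd_arc_def)

text \<open>The middle triple of the walk is \<open>- p - {f}\<close>. Taking \<open>f\<close> from
  \<open>q\<close> makes it different from \<open>q\<close>, so that the walk may go on to
  \<open>q\<close>.\<close>

lemma spokes_2:
  assumes pq: "odd_arc p q" and "x \<in> p" "f \<in> q"
  shows "card (insert f (p - {x})) = 3" "card (spokes 2 p q (insert f (p - {x}))) \<ge> 1"
proof -
  let ?y = "insert f (p - {x})"
  have f: "f \<notin> p" using assms by (auto simp: odd_arc_def)
  show y: "card ?y = 3" using assms f by (simp add: odd_arc_def)
  have "odd_arc p (- p - {f})" using odd_arc_Diff f odd_arcD(1)[OF pq] by blast
  then have "odd_arc ?y (- p - {f})" using y by (auto simp: odd_arc_def)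
  moreover have "reach 2 p q ?y (- p - {f})"
    using \<open>odd_arc p (- p - {f})\<close> y f assms unfolding eval_nat_numeral
    by (auto simp: odd_arc_def)
  ultimately show "card (spokes 2 p q ?y) \<ge> 1" by (rule reach_imp_spokes_card[rotated])
qed


section \<open>Three walks that start at a common triple with distinct first steps\<close>

lemma card_ge_1_obtain:
  assumes "card (A :: 'b::finite set) \<ge> 1" obtains s where "s \<in> A"
  using assms by (metis One_nat_def card.empty ex_in_conv not_one_le_zero)

text \<open>Greedy choice, the smallest set first.\<close>

lemma distinct_representatives_123:
  assumes "card (A :: 'b::finite set) \<ge> 1" "card (B :: 'b set) \<ge> 2" "card (C :: 'b set) \<ge> 3"
  shows "\<exists>a\<in>A. \<exists>b\<in>B. \<exists>c\<in>C. a \<noteq> b \<and> a \<noteq> c \<and> b \<noteq> c"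
proof -
  obtain a where a: "a \<in> A" using assms(1) by (rule card_ge_1_obtain)
  obtain b where b: "b \<in> B" "b \<noteq> a" using assms(2) by (rule card_ge_2_obtain)
  have "\<not> C \<subseteq> {a, b}"
    using card_mono[of "{a, b}" C] assms(3) b by auto
  then obtain c where "c \<in> C" "c \<noteq> a" "c \<noteq> b" by blast
  then show ?thesis using a b by metis
qed

text \<open>Hall's condition: the union of two different 2-sets has at least three elements.\<close>

lemma distinct_representatives_222:
  assumes "card (A :: 'b::finite set) = 2" "card (B :: 'b set) = 2" "A \<noteq> B" "card (C :: 'b set) \<ge> 2"
  shows "\<exists>a\<in>A. \<exists>b\<in>B. \<exists>c\<in>C. a \<noteq> b \<and> a \<noteq> c \<and> b \<noteq> c"
proof -
  obtain a where a: "a \<in> A" "a \<notin> B"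
    using assms card_subset_eq[of B A] by auto
  obtain c where c: "c \<in> C" "c \<noteq> a" using assms(4) by (rule card_ge_2_obtain)
  have "card B \<ge> 2" using assms by simp
  then obtain b where b: "b \<in> B" "b \<noteq> c" by (rule card_ge_2_obtain)
  then show ?thesis using a c by metis
qed

text \<open>Here \<open>y\<close> is the prospective triple of a vertex of degree 3 whose arms end
  in the three given arcs; the three labels being distinct makes the triples of its neighbours
  distinct.\<close>

definition joinable ::
  "nat \<Rightarrow> 7 set \<Rightarrow> 7 set \<Rightarrow> nat \<Rightarrow> 7 set \<Rightarrow> 7 set \<Rightarrow> nat \<Rightarrow> 7 set \<Rightarrow> 7 set \<Rightarrow> bool" where
  "joinable a p q a' p' q' a'' p'' q'' \<longleftrightarrow>
    (\<exists>y. card y = 3 \<and> (\<exists>s\<in>spokes a p q y. \<exists>s'\<in>spokes a' p' q' y. \<exists>s''\<in>spokes a'' p'' q'' y.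
       s \<noteq> s' \<and> s \<noteq> s'' \<and> s' \<noteq> s''))"

lemma joinable_swap:
  assumes "joinable a p q a' p' q' a'' p'' q''"
  shows "joinable a' p' q' a p q a'' p'' q''" "joinable a p q a'' p'' q'' a' p' q'"
proof -
  obtain y s s' s'' where "card y = 3" "s \<in> spokes a p q y" "s' \<in> spokes a' p' q' y"
    "s'' \<in> spokes a'' p'' q'' y" "s \<noteq> s'" "s \<noteq> s''" "s' \<noteq> s''"
    using assms unfolding joinable_def by auto
  then show "joinable a' p' q' a p q a'' p'' q''" "joinable a p q a'' p'' q'' a' p' q'"
    unfolding joinable_def by (intro exI[of _ y] conjI bexI[of _ s] bexI[of _ s'] bexI[of _ s'']; simp)+
qed

lemma joinable_123:
  assumes "card y = 3" "card (spokes a'' p'' q'' y) \<ge> 1" "card (spokes a' p' q' y) \<ge> 2"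
    "card (spokes a p q y) \<ge> 3"
  shows "joinable a p q a' p' q' a'' p'' q''"
proof -
  obtain s s' s'' where "s \<in> spokes a p q y" "s' \<in> spokes a' p' q' y"
    "s'' \<in> spokes a'' p'' q'' y" "s \<noteq> s'" "s \<noteq> s''" "s' \<noteq> s''"
    using distinct_representatives_123[OF assms(2-4)] by auto
  then show ?thesis
    unfolding joinable_def using assms(1)
    by (intro exI[of _ y] conjI bexI[of _ s] bexI[of _ s'] bexI[of _ s'']; simp)
qed

lemma exists_outside:
  assumes "card (A :: 'b::finite set) > card B" obtains x where "x \<in> A" "x \<notin> B"
  using assms card_mono[of B A] by (metis finite leD subsetI)

lemma card_triples_in_4:
  assumes "card (z :: 7 set) = 4"
  shows "card {y. card y = 3 \<and> y \<subseteq> z} = 4"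
proof -
  have "{y. card y = 3 \<and> y \<subseteq> z} = {y. y \<subseteq> z \<and> card y = 3}" by blast
  then show ?thesis using n_subsets[of z 3] assms by (simp add: eval_nat_numeral)
qed

lemma card_odd_neighbours:
  assumes "card (p :: 7 set) = 3"
  shows "card {y. card y = 3 \<and> y \<inter> p = {}} = 4"
proof -
  have "{y. card y = 3 \<and> y \<inter> p = {}} = {y. card y = 3 \<and> y \<subseteq> - p}" by blast
  then show ?thesis using card_triples_in_4[of "- p"] assms by (simp add: card_Compl7)
qed

text \<open>The closed ball of radius 1 about \<open>p\<close> in O_4, that is, the set of triples
  that \<open>spokes_4_card\<close> leaves out.\<close>

definition odd_ball :: "7 set \<Rightarrow> 7 set set" where
  "odd_ball p = insert p {y. card y = 3 \<and> y \<inter> p = {}}"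

lemma card_odd_ball: "card p = 3 \<Longrightarrow> card (odd_ball p) \<le> 5"
  using card_insert_le_m1[of 5 "{y. card y = 3 \<and> y \<inter> p = {}}" p] card_odd_neighbours[of p]
  by (simp add: odd_ball_def)

lemma spokes_4_outside_ball:
  assumes "odd_arc p q" "card y = 3" "y \<notin> odd_ball p"
  shows "card (spokes 4 p q y) \<ge> 2"
  using assms by (intro spokes_4_card) (auto simp: odd_ball_def)

text \<open>These are the starting triples that \<open>spokes_2\<close> provides for an arm of
  length 2.\<close>

lemma card_swap_one:
  assumes "(p :: 7 set) \<inter> q = {}" "card p = 3" "card q = 3"
  shows "card ((\<lambda>(x, f). insert f (p - {x})) ` (p \<times> q)) = 9"
proof -
  have "inj_on (\<lambda>(x, f). insert f (p - {x})) (p \<times> q)"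
  proof (rule inj_onI, clarsimp)
    fix x f x' f' assume *: "x \<in> p" "f \<in> q" "x' \<in> p" "f' \<in> q" "insert f (p - {x}) = insert f' (p - {x'})"
    have nq: "f \<notin> p" "f' \<notin> p" using * assms(1) by auto
    have "f = f'" using nq * by (metis DiffD1 insertE insertI1)
    moreover have "x = x'" using nq * by (metis DiffE DiffI insertE insertI1 insertI2 singletonD singletonI)
    ultimately show "x = x' \<and> f = f'" by simp
  qed
  then show ?thesis using assms by (simp add: card_image card_cartesian_product)
qed

text \<open>One point of \<open>p\<close> and two of the four other points give 3 * 6 triples. They
  are the possible starts in \<open>spokes_3_card\<close>.\<close>

lemma card_meeting_once:
  assumes "card (p :: 7 set) = 3"
  shows "card {y. card y = 3 \<and> card (y \<inter> p) = 1} \<ge> 18"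
proof -
  let ?P = "{P. P \<subseteq> - p \<and> card P = 2}"
  have "card ?P = 6"
    using n_subsets[of "- p" 2] assms by (simp add: card_Compl7 eval_nat_numeral)
  then have "card (p \<times> ?P) = 18" using assms by (simp add: card_cartesian_product)
  moreover have "inj_on (\<lambda>(x, P). insert x P) (p \<times> ?P)"
  proof (rule inj_onI, clarsimp)
    fix x P x' P' assume *: "x \<in> p" "P \<subseteq> - p" "x' \<in> p" "P' \<subseteq> - p" "insert x P = insert x' P'"
    have "x = x'" using * by blast
    moreover have "P = insert x P - {x}" "P' = insert x' P' - {x'}" using * by auto
    ultimately have "P = P'" using *(5) by metis
    then show "x = x' \<and> P = P'" using \<open>x = x'\<close> by simp
  qed
  moreover have "(\<lambda>(x, P). insert x P) ` (p \<times> ?P) \<subseteq> {y. card y = 3 \<and> card (y \<inter> p) = 1}"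
  proof (rule image_subsetI)
    fix z assume "z \<in> p \<times> ?P"
    then obtain x P where z: "z = (x, P)" and *: "x \<in> p" "P \<subseteq> - p" "card P = 2" by auto
    then have x: "x \<notin> P" and e: "insert x P \<inter> p = {x}" by auto
    have "card (insert x P \<inter> p) = 1" unfolding e by simp
    then show "(\<lambda>(x, P). insert x P) z \<in> {y. card y = 3 \<and> card (y \<inter> p) = 1}"
      using * x z by simp
  qed
  ultimately show ?thesis
    using card_mono[of "{y. card y = 3 \<and> card (y \<inter> p) = 1}" "(\<lambda>(x, P). insert x P) ` (p \<times> ?P)"]
    by (simp add: card_image)
qed

text \<open>The bound 6 is what is needed to escape the five triples of an \<open>odd_ball\<close>.
  If \<open>p\<close> and \<open>p'\<close> share i points, taking one point from each difference
  and one outside both gives (3 - i)^2 (1 + i) triples, which is 9 or 8 for i = 0, 1 but only 3 for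
  i = 2. In that case a common point together with two of the three outer points gives 6.\<close>

lemma card_meeting_both_once:
  assumes p: "card (p :: 7 set) = 3" and p': "card p' = 3" "p \<noteq> p'"
  shows "card {y. card y = 3 \<and> card (y \<inter> p) = 1 \<and> card (y \<inter> p') = 1 \<and> p - y \<noteq> p' - y} \<ge> 6"
    (is "card ?Y \<ge> 6")
proof -
  define i where "i = card (p \<inter> p')"
  have "p \<inter> p' \<noteq> p" using p p' card_subset_eq[of p' p] by auto
  then have "i < 3" unfolding i_def using psubset_card_mono[of p "p \<inter> p'"] p by auto
  have d: "card (p - p') = 3 - i" "card (p' - p) = 3 - i" 
    using p p' by (simp_all add: card_Diff_subset_Int i_def Int_commute)
  have "card (p \<union> p') = 6 - i" using card_Un_Int[of p p'] p p' by (simp add: i_def)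
  then have r: "card (- (p \<union> p')) = 1 + i" using \<open>i < 3\<close> card_Compl7[of "p \<union> p'"] by simp
  show ?thesis
  proof (cases "i = 2")
    case False
    let ?D = "(p - p') \<times> (p' - p) \<times> - (p \<union> p')"
    have "inj_on (\<lambda>(a, b, c). {a, b, c}) ?D"
    proof (rule inj_onI, clarsimp)
      fix a b c a' b' c'
      assume *: "a \<in> p" "a \<notin> p'" "b \<in> p'" "b \<notin> p" "c \<notin> p" "c \<notin> p'"
        "a' \<in> p" "a' \<notin> p'" "b' \<in> p'" "b' \<notin> p" "c' \<notin> p" "c' \<notin> p'" "{a, b, c} = {a', b', c'}"
      have "a \<in> {a', b', c'}" "b \<in> {a', b', c'}" "c \<in> {a', b', c'}" using *(13) by auto
      then have "a = a'" "b = b'" "c = c'" using * by auto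
      then show "a = a' \<and> b = b' \<and> c = c'" by simp
    qed
    then have c: "card ((\<lambda>(a, b, c). {a, b, c}) ` ?D) = (3 - i) * ((3 - i) * (1 + i))"
      using d r by (simp add: card_image card_cartesian_product)
    have "(\<lambda>(a, b, c). {a, b, c}) ` ?D \<subseteq> ?Y"
    proof (rule image_subsetI)
      fix z assume "z \<in> ?D"
      then obtain a b c where z: "z = (a, b, c)"
        and *: "a \<in> p" "a \<notin> p'" "b \<in> p'" "b \<notin> p" "c \<notin> p" "c \<notin> p'" by auto
      have e: "{a, b, c} \<inter> p = {a}" "{a, b, c} \<inter> p' = {b}" "a \<noteq> b" "a \<noteq> c" "b \<noteq> c"
        using * by auto
      have "p - {a, b, c} \<noteq> p' - {a, b, c}"
      proof
        assume "p - {a, b, c} = p' - {a, b, c}"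
        then have "p - {a} \<subseteq> p \<inter> p'" using * by blast
        then have "card (p - {a}) \<le> i" unfolding i_def by (simp add: card_mono)
        then show False using p * \<open>i < 3\<close> False by simp
      qed
      then show "(\<lambda>(a, b, c). {a, b, c}) z \<in> ?Y"
        using e z by simp
    qed
    then have "card ((\<lambda>(a, b, c). {a, b, c}) ` ?D) \<le> card ?Y" by (intro card_mono) auto
    then have "(3 - i) * ((3 - i) * (1 + i)) \<le> card ?Y" unfolding c .
    moreover have "i = 0 \<or> i = 1" using \<open>i < 3\<close> False by auto
    ultimately show ?thesis by auto
  next
    case True
    let ?r = "- (p \<union> p')"
    let ?D = "(p \<inter> p') \<times> ?r"
    have "inj_on (\<lambda>(a, c). insert a (?r - {c})) ?D"
    proof (rule inj_onI)
      fix z z' assume "z \<in> ?D" "z' \<in> ?D"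
        and eq: "(\<lambda>(a, c). insert a (?r - {c})) z = (\<lambda>(a, c). insert a (?r - {c})) z'"
      then obtain a c a' c' where z: "z = (a, c)" "z' = (a', c')"
        and *: "a \<in> p \<inter> p'" "c \<in> ?r" "a' \<in> p \<inter> p'" "c' \<in> ?r" by auto
      have eq: "insert a (?r - {c}) = insert a' (?r - {c'})" using eq z by simp
      have "a \<in> insert a' (?r - {c'})" using eq by auto
      then have "a = a'" using * by auto
      moreover have "c \<notin> insert a' (?r - {c'})" unfolding eq[symmetric] using * by auto
      then have "c = c'" using * by auto
      ultimately show "z = z'" using z by simp
    qed
    then have c: "card ((\<lambda>(a, c). insert a (?r - {c})) ` ?D) = 6"
      using r True by (simp add: card_image card_cartesian_product i_def)
    have "(\<lambda>(a, c). insert a (?r - {c})) ` ?D \<subseteq> ?Y"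
    proof (rule image_subsetI)
      fix z assume "z \<in> ?D"
      then obtain a c where z: "z = (a, c)" and *: "a \<in> p \<inter> p'" "c \<in> ?r" by auto
      let ?y = "insert a (?r - {c})"
      have e: "?y \<inter> p = {a}" "?y \<inter> p' = {a}" using * by auto
      have "card (?r - {c}) = 2" using * r True by (simp add: card_Diff_singleton)
      then have c3: "card ?y = 3" using * by auto
      have "p - ?y \<noteq> p' - ?y"
      proof
        assume "p - ?y = p' - ?y"
        then have "p = p'" using e by blast
        then show False using p' by simp
      qed
      then show "(\<lambda>(a, c). insert a (?r - {c})) z \<in> ?Y" using e c3 z by simp
    qed
    then have "card ((\<lambda>(a, c). insert a (?r - {c})) ` ?D) \<le> card ?Y" by (intro card_mono) auto
    then show ?thesis unfolding c .
  qed
qed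

text \<open>If \<open>p \<noteq> p'\<close>, a triple \<open>y\<close> meeting both once has \<open>p - y\<close> and \<open>p' - y\<close> among its spokes, so it is
  enough that these differ and that \<open>y\<close> avoids the at most five triples that are bad for \<open>p''\<close>. If
  \<open>p = p' = p''\<close>, some \<open>y\<close> has three spokes for one of the arcs.\<close>

lemma joinable_444:
  assumes "odd_arc p q" "odd_arc p' q'" "odd_arc p'' q''"
  shows "joinable 4 p q 4 p' q' 4 p'' q''"
proof -
  have main: "joinable 4 p q 4 p' q' 4 p'' q''"
    if a: "odd_arc p q" "odd_arc p' q'" "odd_arc p'' q''" "p \<noteq> p'" for p q p' q' p'' q''
  proof -
    let ?Y = "{y. card y = 3 \<and> card (y \<inter> p) = 1 \<and> card (y \<inter> p') = 1 \<and> p - y \<noteq> p' - y}"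
    have "card (odd_ball p'') < card ?Y"
      using card_odd_ball[of p''] card_meeting_both_once[of p p'] a odd_arcD(1) by fastforce
    then obtain y where y: "y \<in> ?Y" "y \<notin> odd_ball p''" by (rule exists_outside)
    have "card (p - y) = 2" "card (p' - y) = 2"
      using y a by (simp_all add: card_Diff_subset_Int Int_commute odd_arc_def)
    then have "\<exists>a\<in>p - y. \<exists>b\<in>p' - y. \<exists>c\<in>spokes 4 p'' q'' y. a \<noteq> b \<and> a \<noteq> c \<and> b \<noteq> c"
      using y spokes_4_outside_ball[OF a(3)] by (intro distinct_representatives_222) blast+
    moreover have "p - y \<subseteq> spokes 4 p q y" "p' - y \<subseteq> spokes 4 p' q' y"
      using y a by (simp_all add: spokes_4_one)
    ultimately show ?thesis using y unfolding joinable_def by blast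
  qed
  show ?thesis
  proof (cases "p = p' \<and> p = p''")
    case False
    then show ?thesis
      using main[of p q p' q' p'' q''] main[of p q p'' q'' p' q'] joinable_swap(2) assms by blast
  next
    case True
    have "p \<noteq> {}" using assms(1) by (auto simp: odd_arc_def)
    then obtain x where x: "x \<in> p" by auto
    \<comment> \<open>The point \<open>f\<close> is the one outside both \<open>p\<close> and
      \<open>q\<close>, so that \<open>?y\<close> meets \<open>q\<close> only within
      \<open>p\<close> and the second part of \<open>spokes_4_two\<close> applies.\<close>
    obtain f where f: "f \<notin> p" "q = - p - {f}" using odd_arc_missing[OF assms(1)] .
    let ?y = "insert f (p - {x})"
    have y: "card ?y = 3" "?y \<inter> p = p - {x}" "?y \<inter> q \<subseteq> p" "card (p - {x}) = 2"
      using x f assms(1) by (auto simp: odd_arc_def)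
    have "card (spokes 4 p'' q'' ?y) \<ge> 2" "card (spokes 4 p' q' ?y) \<ge> 2" "card (spokes 4 p q ?y) \<ge> 3"
      using spokes_4_two[of p _ ?y] y True assms by auto
    moreover from this have "card (spokes 4 p'' q'' ?y) \<ge> 1" by linarith
    ultimately show ?thesis using joinable_123[OF y(1)] by blast
  qed
qed

text \<open>Both arms of length 3 restrict the centre, so it is built by hand. With \<open>f\<close>
  outside \<open>p'\<close> and \<open>q'\<close>, a triple {x, f, w} with x in \<open>p'\<close>
  and w in \<open>q'\<close> meets \<open>p'\<close> once and has two first steps for that arm. It
  remains to make it meet \<open>p''\<close> exactly once.\<close>

lemma joinable_633:
  assumes a: "odd_arc p q" "odd_arc p' q'" "odd_arc p'' q''"
  shows "joinable 6 p q 3 p' q' 3 p'' q''"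
proof -
  obtain f where f: "f \<notin> p'" "q' = - p' - {f}" using odd_arc_missing[OF a(2)] .
  note c = odd_arcD[OF a(2)] odd_arcD[OF a(3)]
  have "\<exists>x\<in>p'. \<exists>w\<in>q'. card ({x, f, w} \<inter> p'') = 1"
  proof (cases "f \<in> p''")
    case True
    have "p' \<noteq> p''" "q' \<noteq> p''" using True f by auto
    then obtain x w where "x \<in> p'" "x \<notin> p''" "w \<in> q'" "w \<notin> p''"
      using c card_subset_eq[of p'' p'] card_subset_eq[of p'' q'] by auto
    moreover from this have "{x, f, w} \<inter> p'' = {f}" using True by auto
    ultimately show ?thesis by (metis card_1_singleton_iff One_nat_def)
  next
    case False
    have "p'' \<subseteq> p' \<union> q'" using f False by auto
    \<comment> \<open>Exactly one of \<open>x\<close> and \<open>w\<close> has to lie in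
      \<open>p''\<close>. This is impossible only if \<open>p''\<close> contains all of
      \<open>p' \<union> q'\<close> or misses it, and both are excluded by cardinality.\<close>
    have "\<exists>x\<in>p'. \<exists>w\<in>q'. (x \<in> p'') \<noteq> (w \<in> p'')"
    proof (rule ccontr)
      assume "\<not> ?thesis"
      moreover have "p' \<noteq> {}" "q' \<noteq> {}" using c by auto
      ultimately have "p' \<union> q' \<subseteq> p'' \<or> (p' \<union> q') \<inter> p'' = {}" by blast
      then show False
      proof
        assume "p' \<union> q' \<subseteq> p''"
        then have "card (p' \<union> q') \<le> 3" using c card_mono[of p'' "p' \<union> q'"] by simp
        then show False using c by (simp add: card_Un_disjoint)
      next
        assume "(p' \<union> q') \<inter> p'' = {}"
        then have "p'' = {}" using \<open>p'' \<subseteq> p' \<union> q'\<close> by blast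
        then show False using c by simp
      qed
    qed
    then obtain x w where xw: "x \<in> p'" "w \<in> q'" "(x \<in> p'') \<noteq> (w \<in> p'')" by blast
    then have "{x, f, w} \<inter> p'' = {x} \<or> {x, f, w} \<inter> p'' = {w}" using False by auto
    then have "card ({x, f, w} \<inter> p'') = 1" by (elim disjE) simp_all
    then show ?thesis using xw by blast
  qed
  then obtain x w where xw: "x \<in> p'" "w \<in> q'" "card ({x, f, w} \<inter> p'') = 1" by blast
  let ?y = "{x, f, w}"
  have "x \<noteq> f" "f \<noteq> w" "x \<noteq> w" using xw f by auto
  then have y: "card ?y = 3" by simp
  have "?y \<inter> p' = {x}" "\<not> ?y - p' \<subseteq> q'" using xw f by auto
  then have "card (spokes 3 p' q' ?y) \<ge> 2" using spokes_3_card(2)[OF a(2) y] by simp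
  moreover have "card (spokes 3 p'' q'' ?y) \<ge> 1" using spokes_3_card(1)[OF a(3) y] xw by simp
  ultimately show ?thesis
    using joinable_123[OF y _ _ spokes_6_card[OF a(1) y]] by blast
qed

text \<open>The centre is sought where the shortest arm has a first step, avoiding the exceptions of
  the other arms. For \<open>a''\<close> = 0, 1, 2, 3 there are 1, 4, 9 and at least 18 candidates
  against 0, 2, at most 5 and at most 6 exceptions. The length patterns 6, 3, 3 and 4, 4, 4 are
  treated separately: in the first the general bounds give only one first step on each short arm, in
  the second only two on every arm.\<close>

lemma joinable_sorted:
  assumes a: "odd_arc p q" "odd_arc p' q'" "odd_arc p'' q''"
    and "a'' \<le> a'" "a' \<le> a" "a \<le> 6" "a + a' + a'' = 12"
  shows "joinable a p q a' p' q' a'' p'' q''"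
proof -
  note c = odd_arcD[OF a(1)] odd_arcD[OF a(2)] odd_arcD[OF a(3)]
  let ?N = "{y. card y = 3 \<and> y \<inter> p'' = {}}"
  let ?S = "(\<lambda>(x, f). insert f (p'' - {x})) ` (p'' \<times> q'')"
  let ?M = "{y. card y = 3 \<and> card (y \<inter> p'') = 1}"
  have S: "card ?S = 9" using card_swap_one c by blast
  have S2: "card y = 3" "card (spokes 2 p'' q'' y) \<ge> 1" if "y \<in> ?S" for y
    using that spokes_2[OF a(3)] by auto
  have "a'' \<le> 4" using assms by linarith
  then consider "a'' = 0" | "a'' = 1" | "a'' = 2" | "a'' = 3" | "a'' = 4" by linarith
  then show ?thesis
  proof cases
    case 1
    then have "a = 6" "a' = 6" using assms by auto
    then show ?thesis using joinable_123[OF c(7) spokes_0[OF a(3)]]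
        spokes_6_card[OF a(1) c(7)] spokes_6_card[OF a(2) c(7)] 1 by simp
  next
    case 2
    then have e: "a = 6" "a' = 5" using assms by auto
    \<comment> \<open>Starting at \<open>q''\<close> would mean backtracking at \<open>p''\<close>,
      and \<open>p'\<close> is the exception of \<open>spokes_5_card\<close>.\<close>
    have "card {q'', p'} < card ?N"
      using card_odd_neighbours[OF c(7)] card_insert_le_m1[of 2 "{p'}" q''] by simp
    then obtain y where y: "y \<in> ?N" "y \<notin> {q'', p'}" by (rule exists_outside)
    then have y3: "card y = 3" and "odd_arc y p''" using c by (auto simp: odd_arc_def)
    then have "card (spokes 1 p'' q'' y) \<ge> 1" using spokes_1[OF a(3)] y by blast
    moreover have "card (spokes 5 p' q' y) \<ge> 3" using spokes_5_card[OF a(2) y3] y by simp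
    ultimately show ?thesis using joinable_123[OF y3] spokes_6_card[OF a(1) y3] e 2 by simp
  next
    case 3
    then have "a = 5 \<and> a' = 5 \<or> a = 6 \<and> a' = 4" using assms by auto
    then show ?thesis
    proof
      assume e: "a = 5 \<and> a' = 5"
      have "card {p, p'} < card ?S" using S card_insert_le_m1[of 2 "{p'}" p] by simp
      then obtain y where y: "y \<in> ?S" "y \<notin> {p, p'}" by (rule exists_outside)
      have "card (spokes 5 p q y) \<ge> 3" "card (spokes 5 p' q' y) \<ge> 3"
        using S2(1)[OF y(1)] y(2) spokes_5_card[OF a(1)] spokes_5_card[OF a(2)] by auto
      then show ?thesis using joinable_123[OF S2[OF y(1)]] e 3 by simp
    next
      assume e: "a = 6 \<and> a' = 4"
      have "card (odd_ball p') < card ?S" using S card_odd_ball[OF c(4)] by simp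
      then obtain y where y: "y \<in> ?S" "y \<notin> odd_ball p'" by (rule exists_outside)
      show ?thesis
        using joinable_123[OF S2[OF y(1)] spokes_4_outside_ball[OF a(2) S2(1)[OF y(1)] y(2)]
            spokes_6_card[OF a(1) S2(1)[OF y(1)]]] e 3 by simp
    qed
  next
    case 4
    then have "a = 5 \<and> a' = 4 \<or> a = 6 \<and> a' = 3" using assms by auto
    then show ?thesis
    proof
      assume e: "a = 5 \<and> a' = 4"
      have "card (insert p (odd_ball p')) < card ?M"
        using card_insert_le_m1[of 6 "odd_ball p'" p] card_odd_ball[OF c(4)] card_meeting_once[OF c(7)]
        by simp
      then obtain y where y: "y \<in> ?M" "y \<notin> insert p (odd_ball p')" by (rule exists_outside)
      then have y3: "card y = 3" by simp
      have "card (spokes 3 p'' q'' y) \<ge> 1" using y spokes_3_card(1)[OF a(3) y3] by simp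
      moreover have "card (spokes 4 p' q' y) \<ge> 2" using y spokes_4_outside_ball[OF a(2) y3] by simp
      moreover have "card (spokes 5 p q y) \<ge> 3" using y spokes_5_card[OF a(1) y3] by simp
      ultimately show ?thesis using joinable_123[OF y3] e 4 by simp
    qed (use joinable_633[OF a] 4 in simp)
  next
    case 5
    then have "a = 4" "a' = 4" using assms by auto
    then show ?thesis using joinable_444[OF a] 5 by simp
  qed
qed

lemma joinable_12:
  assumes "odd_arc p q" "odd_arc p' q'" "odd_arc p'' q''"
    and "a \<le> 6" "a' \<le> 6" "a'' \<le> 6" "a + a' + a'' = 12"
  shows "joinable a p q a' p' q' a'' p'' q''"
proof -
  note s = joinable_sorted joinable_swap
  consider "a'' \<le> a'" "a' \<le> a" | "a' \<le> a''" "a'' \<le> a" | "a'' \<le> a" "a \<le> a'"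
    | "a \<le> a''" "a'' \<le> a'" | "a' \<le> a" "a \<le> a''" | "a \<le> a'" "a' \<le> a''" by linarith
  then show ?thesis
  proof cases
    case 1 then show ?thesis using joinable_sorted assms by blast
  next
    case 2 
    have "joinable a p q a'' p'' q'' a' p' q'" using 2 assms by (intro joinable_sorted) auto
    then show ?thesis using joinable_swap by blast
  next
    case 3
    have "joinable a' p' q' a p q a'' p'' q''" using 3 assms by (intro joinable_sorted) auto
    then show ?thesis using joinable_swap by blast
  next
    case 4
    have "joinable a' p' q' a'' p'' q'' a p q" using 4 assms by (intro joinable_sorted) auto
    then show ?thesis using joinable_swap by blast
  next
    case 5
    have "joinable a'' p'' q'' a p q a' p' q'" using 5 assms by (intro joinable_sorted) auto
    then show ?thesis using joinable_swap by blast
  next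
    case 6
    have "joinable a'' p'' q'' a' p' q' a p q" using 6 assms by (intro joinable_sorted) auto
    then show ?thesis using joinable_swap by blast
  qed
qed

lemma reach_obtain_walk:
  assumes "reach a p q y z"
  obtains f where "f 0 = y" "f 1 = z" "f a = p" "f (Suc a) = q"
    "\<And>i. i < a \<Longrightarrow> odd_arc (f i) (f (Suc i)) \<and> f i \<noteq> f (Suc (Suc i))"
  using assms
proof (induction a arbitrary: y z thesis)
  case 0
  then show ?case by (intro 0(1)[of "\<lambda>i. if i = 0 then y else z"]) auto
next
  case (Suc a)
  then obtain x where x: "x \<noteq> y" "reach a p q z x" "odd_arc y z" by (auto simp: odd_arc_def)
  obtain f where f: "f 0 = z" "f 1 = x" "f a = p" "f (Suc a) = q"
    "\<And>i. i < a \<Longrightarrow> odd_arc (f i) (f (Suc i)) \<and> f i \<noteq> f (Suc (Suc i))"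
    using Suc.IH[OF _ x(2)] by blast
  show ?case
  proof (rule Suc.prems(1)[of "case_nat y f"])
    show "odd_arc (case_nat y f i) (case_nat y f (Suc i)) \<and> case_nat y f i \<noteq> case_nat y f (Suc (Suc i))"
      if "i < Suc a" for i
      using that f x by (cases i) auto
  qed (use f in auto)
qed

section \<open>Extending a locally injective homomorphism\<close>

definition nb :: "'a set set \<Rightarrow> 'a \<Rightarrow> 'a set" where
  "nb E v = {w. {v, w} \<in> E}"

definition del :: "'a set \<Rightarrow> 'a set set \<Rightarrow> 'a set set" where
  "del X E = {e \<in> E. e \<inter> X = {}}"

text \<open>The map is total: a vertex without edges still carries a triple, subject to no
  condition. Passing to \<open>del X E\<close> thus keeps the domain, and extending back to
  \<open>E\<close> means changing values on \<open>X\<close>.\<close>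

definition odd_hom :: "'a set set \<Rightarrow> ('a \<Rightarrow> 7 set) \<Rightarrow> bool" where
  "odd_hom E \<phi> \<longleftrightarrow> (\<forall>v. card (\<phi> v) = 3) \<and>
     (\<forall>v. \<forall>w\<in>nb E v. \<phi> v \<inter> \<phi> w = {}) \<and> (\<forall>v. inj_on \<phi> (nb E v))"

lemma nb_sym: "w \<in> nb E v \<longleftrightarrow> v \<in> nb E w"
  by (simp add: nb_def insert_commute)

lemma simple_graph_edge:
  assumes "simple_graph V E" "{v, w} \<in> E"
  shows "v \<in> V" "w \<in> V" "v \<noteq> w"
  using assms by (fastforce simp: simple_graph_def)+

lemma simple_graph_edge_obtain:
  assumes "simple_graph V E" "e \<in> E"
  obtains v w where "e = {v, w}" "v \<noteq> w"
  using assms by (metis simple_graph_def card_2_iff)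

lemma simple_graph_finite:
  assumes "simple_graph V E"
  shows "finite V" "finite E" "finite (nb E v)"
proof -
  show V: "finite V" using assms by (simp add: simple_graph_def)
  have "E \<subseteq> Pow V" using assms by (auto simp: simple_graph_def)
  then show "finite E" using V finite_subset by blast
  have "nb E v \<subseteq> V" using simple_graph_edge[OF assms] by (auto simp: nb_def)
  then show "finite (nb E v)" using V finite_subset by blast
qed

lemma simple_graph_subset:
  assumes "simple_graph V E" "F \<subseteq> E" "\<And>e. e \<in> F \<Longrightarrow> e \<subseteq> W" "W \<subseteq> V"
  shows "simple_graph W F"
  using assms by (auto simp: simple_graph_def intro: finite_subset)

lemma simple_graph_del:
  assumes "simple_graph V E"
  shows "simple_graph (V - X) (del X E)"
  using assms by (auto simp: simple_graph_def del_def)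

lemma card_nb:
  assumes "simple_graph V E"
  shows "card (nb E v) = vertex_degree E v"
proof -
  have "inj_on (\<lambda>w. {v, w}) (nb E v)" by (auto simp: inj_on_def doubleton_eq_iff)
  moreover have "(\<lambda>w. {v, w}) ` nb E v = {e \<in> E. v \<in> e}"
  proof safe
    fix e assume "e \<in> E" "v \<in> e"
    then obtain w where "e = {v, w}"
      using simple_graph_edge_obtain[OF assms] by (metis insert_commute insert_iff singletonD)
    then show "e \<in> (\<lambda>w. {v, w}) ` nb E v" using \<open>e \<in> E\<close> by (auto simp: nb_def)
  qed (auto simp: nb_def)
  ultimately show ?thesis unfolding vertex_degree_def by (metis card_image)
qed

lemma handshake:
  assumes "simple_graph V E"
  shows "(\<Sum>v\<in>V. card (nb E v)) = 2 * card E"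
proof -
  have "(\<Sum>v\<in>V. card {e \<in> E. v \<in> e}) = 2 * card E"
  proof (rule sum_multicount)
    show "\<forall>e\<in>E. card {v \<in> V. v \<in> e} = 2"
    proof
      fix e assume "e \<in> E"
      then have "{v \<in> V. v \<in> e} = e" "card e = 2" using assms by (auto simp: simple_graph_def)
      then show "card {v \<in> V. v \<in> e} = 2" by simp
    qed
  qed (use simple_graph_finite[OF assms] in auto)
  then show ?thesis by (simp add: card_nb[OF assms] vertex_degree_def)
qed

text \<open>A repetition with no repetition strictly inside is a cycle: length 1 is impossible
  without loops, and length 2 would be a backtrack.\<close>

lemma walk_imp_cycle:
  assumes sg: "simple_graph V E" and "i < j" "w i = w j"
    and "\<And>k. i \<le> k \<Longrightarrow> k < j \<Longrightarrow> {w k, w (Suc k)} \<in> E"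
    and "\<And>k. i \<le> k \<Longrightarrow> Suc (Suc k) \<le> j \<Longrightarrow> w k \<noteq> w (Suc (Suc k))"
  shows "\<exists>vs. is_cycle E vs \<and> set vs \<subseteq> w ` {i..j} \<and> length vs \<le> j - i"
  using assms(2-)
proof (induction "j - i" arbitrary: i j rule: less_induct)
  case less
  note edge = less.prems(3) and nbt = less.prems(4)
  show ?case
  proof (cases "\<exists>i' j'. i \<le> i' \<and> i' < j' \<and> j' \<le> j \<and> (i', j') \<noteq> (i, j) \<and> w i' = w j'")
    case True
    then obtain i' j' where *: "i \<le> i'" "i' < j'" "j' \<le> j" "(i', j') \<noteq> (i, j)" "w i' = w j'"
      by blast
    then have "\<exists>vs. is_cycle E vs \<and> set vs \<subseteq> w ` {i'..j'} \<and> length vs \<le> j' - i'"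
      using edge nbt by (intro less.hyps) auto
    moreover have "w ` {i'..j'} \<subseteq> w ` {i..j}" "j' - i' \<le> j - i" using * by auto
    ultimately show ?thesis by (meson dual_order.trans)
  next
    case False
    have "j \<noteq> Suc i" using simple_graph_edge(3)[OF sg edge[of i]] less.prems by auto
    moreover have "j \<noteq> Suc (Suc i)" using nbt[of i] less.prems by auto
    ultimately have len: "j - i \<ge> 3" using less.prems by auto
    let ?vs = "map w [i..<j]"
    have "is_cycle E ?vs"
      unfolding is_cycle_def
    proof (intro conjI allI impI)
      show "distinct ?vs"
        unfolding distinct_map
      proof (intro conjI inj_onI)
        fix x y assume "x \<in> set [i..<j]" "y \<in> set [i..<j]" "w x = w y"
        then show "x = y" using False by (cases x y rule: linorder_cases) (fastforce)+
      qed simp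
      show "{?vs ! k, ?vs ! Suc k} \<in> E" if "Suc k < length ?vs" for k
        using that edge[of "i + k"] by simp
      have "last ?vs = w (j - 1)" "hd ?vs = w j"
        using less.prems by (simp_all add: last_map hd_map)
      then show "{last ?vs, hd ?vs} \<in> E" using edge[of "j - 1"] less.prems by auto
    qed (use len in simp)
    moreover have "set ?vs \<subseteq> w ` {i..j}" by auto
    ultimately show ?thesis by (intro exI[of _ ?vs]) simp
  qed
qed

text \<open>With minimum degree 2 the walk never gets stuck. At a vertex of degree 2 the choice is
  forced, so the same function also follows threads.\<close>

fun nbwalk :: "'a set set \<Rightarrow> 'a \<Rightarrow> 'a \<Rightarrow> nat \<Rightarrow> 'a" where
  "nbwalk E x y 0 = x"
| "nbwalk E x y (Suc 0) = y"
| "nbwalk E x y (Suc (Suc i)) = (SOME z. z \<in> nb E (nbwalk E x y (Suc i)) \<and> z \<noteq> nbwalk E x y i)"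

lemma nbwalk_step:
  assumes sg: "simple_graph V E" and deg: "\<And>v. v \<in> V \<Longrightarrow> card (nb E v) \<ge> 2" and xy: "y \<in> nb E x"
  shows "nbwalk E x y (Suc i) \<in> nb E (nbwalk E x y i)" "nbwalk E x y (Suc (Suc i)) \<noteq> nbwalk E x y i"
proof -
  have "nbwalk E x y (Suc i) \<in> nb E (nbwalk E x y i) \<and> nbwalk E x y (Suc (Suc i)) \<in> nb E (nbwalk E x y (Suc i)) \<and>
    nbwalk E x y (Suc (Suc i)) \<noteq> nbwalk E x y i"
  proof (induction i)
    case 0
    have "y \<in> V" using simple_graph_edge(2)[OF sg] xy by (auto simp: nb_def)
    then obtain z where "z \<in> nb E y" "z \<noteq> x"
      using card_mono[of "{x}" "nb E y"] deg by fastforce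
    then have "(SOME z. z \<in> nb E y \<and> z \<noteq> x) \<in> nb E y \<and> (SOME z. z \<in> nb E y \<and> z \<noteq> x) \<noteq> x"
      by (metis (mono_tags, lifting) someI)
    then show ?case using xy by simp
  next
    case (Suc i)
    let ?a = "nbwalk E x y (Suc i)" and ?b = "nbwalk E x y (Suc (Suc i))"
    have "?b \<in> V" using simple_graph_edge(2)[OF sg] Suc by (auto simp: nb_def)
    then obtain z where "z \<in> nb E ?b" "z \<noteq> ?a"
      using card_mono[of "{?a}" "nb E ?b"] deg by fastforce
    then have "(SOME z. z \<in> nb E ?b \<and> z \<noteq> ?a) \<in> nb E ?b \<and> (SOME z. z \<in> nb E ?b \<and> z \<noteq> ?a) \<noteq> ?a"
      by (metis (mono_tags, lifting) someI)
    then show ?case using Suc by simp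
  qed
  then show "nbwalk E x y (Suc i) \<in> nb E (nbwalk E x y i)" "nbwalk E x y (Suc (Suc i)) \<noteq> nbwalk E x y i" by auto
qed

text \<open>A vertex \<open>u\<close> with arms \<open>v j 0 = u, v j 1, \<dots>\<close>, where the \<open>a j\<close> vertices after \<open>u\<close> have degree 2. The
  homomorphism \<open>\<phi>\<close> is given on the last of them and on the end of the arm, and \<open>f\<close> extends it to the
  rest. An arm with \<open>a j = 0\<close> forces \<open>u\<close> to be kept, with \<open>y = \<phi> u\<close>.\<close>

locale odd_extension =
  fixes E :: "'a set set" and X :: "'a set" and \<phi> :: "'a \<Rightarrow> 7 set" and y :: "7 set"
    and J :: "nat set" and u :: 'a and v :: "nat \<Rightarrow> nat \<Rightarrow> 'a" and a :: "nat \<Rightarrow> nat"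
    and f :: "nat \<Rightarrow> nat \<Rightarrow> 7 set"
  assumes \<phi>: "odd_hom (del X E) \<phi>"
    and y: "card y = 3"
    and X_eq: "X = {v j i | j i. j \<in> J \<and> 1 \<le> i \<and> i < a j} \<union> (if \<forall>j\<in>J. a j > 0 then {u} else {})"
    and v0: "\<And>j. j \<in> J \<Longrightarrow> v j 0 = u"
    and nb_u: "nb E u = (\<lambda>j. v j 1) ` J"
    and nb_v: "\<And>j i. j \<in> J \<Longrightarrow> 1 \<le> i \<Longrightarrow> i \<le> a j \<Longrightarrow> nb E (v j i) = {v j (i - 1), v j (Suc i)}"
    and inj: "\<And>j i j' i'. j \<in> J \<Longrightarrow> j' \<in> J \<Longrightarrow> 1 \<le> i \<Longrightarrow> i < a j \<Longrightarrow> 1 \<le> i' \<Longrightarrow> i' < a j' \<Longrightarrow>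
                 v j i = v j' i' \<Longrightarrow> j = j' \<and> i = i'"
    and u_notin: "\<And>j i. j \<in> J \<Longrightarrow> 1 \<le> i \<Longrightarrow> i < a j \<Longrightarrow> v j i \<noteq> u"
    and kept: "\<And>j. j \<in> J \<Longrightarrow> v j (a j) \<notin> X \<and> v j (Suc (a j)) \<notin> X"
    and f0: "\<And>j. j \<in> J \<Longrightarrow> f j 0 = y"
    and f_end: "\<And>j. j \<in> J \<Longrightarrow> f j (a j) = \<phi> (v j (a j)) \<and> f j (Suc (a j)) = \<phi> (v j (Suc (a j)))"
    and f_walk: "\<And>j i. j \<in> J \<Longrightarrow> i < a j \<Longrightarrow> odd_arc (f j i) (f j (Suc i)) \<and> f j i \<noteq> f j (Suc (Suc i))"
    and f_inj: "\<And>j j'. j \<in> J \<Longrightarrow> j' \<in> J \<Longrightarrow> j \<noteq> j' \<Longrightarrow> f j 1 \<noteq> f j' 1"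
begin

text \<open>By \<open>inj\<close> the pair \<open>(j, i)\<close> belonging to an interior vertex of
  an arm is unique, so the choice is forced.\<close>

definition \<psi> :: "'a \<Rightarrow> 7 set" where
  "\<psi> x = (if x = u then y else if x \<in> X
     then (case SOME (j, i). j \<in> J \<and> 1 \<le> i \<and> i < a j \<and> x = v j i of (j, i) \<Rightarrow> f j i) else \<phi> x)"

lemma psi_outside: "x \<notin> X \<Longrightarrow> \<psi> x = \<phi> x"
proof (cases "x = u")
  case True
  assume "x \<notin> X"
  \<comment> \<open>The centre is kept only if some arm has length 0, and for that arm
    \<open>f_end\<close> says that \<open>y\<close> is the old value at \<open>u\<close>.\<close>
  then obtain j where "j \<in> J" "a j = 0" using True X_eq by (auto split: if_splits)
  then have "\<phi> x = y" using True f0[of j] f_end[of j] v0[of j] by simp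
  then show ?thesis unfolding \<psi>_def using True by simp
qed (simp add: \<psi>_def)

lemma psi_arm:
  assumes j: "j \<in> J" and i: "i \<le> Suc (a j)"
  shows "\<psi> (v j i) = f j i"
proof -
  consider "i = 0" | "1 \<le> i" "i < a j" | "i = a j" | "i = Suc (a j)" using i by linarith
  then show ?thesis
  proof cases
    case 1
    then show ?thesis using v0 f0 j by (simp add: \<psi>_def)
  next
    case 2
    let ?P = "\<lambda>(j', i'). j' \<in> J \<and> 1 \<le> i' \<and> i' < a j' \<and> v j i = v j' i'"
    have "?P (Eps ?P)" by (rule someI[of ?P "(j, i)"]) (use 2 j in simp)
    moreover obtain j' i' where e: "Eps ?P = (j', i')" by (cases "Eps ?P")
    ultimately have "j' \<in> J" "1 \<le> i'" "i' < a j'" "v j i = v j' i'" by auto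
    then have "Eps ?P = (j, i)" using inj[OF j _ 2] e by simp
    moreover have "v j i \<in> X" using 2 j X_eq by auto
    ultimately show ?thesis using u_notin[OF j 2] by (simp add: \<psi>_def)
  qed (use psi_outside kept[OF j] f_end[OF j] in auto)
qed

text \<open>The last arc is beyond the range of \<open>f_walk\<close>; it is an arc because both its
  vertices, hence also the edge, survive the deletion.\<close>

lemma f_arc:
  assumes j: "j \<in> J" and i: "i \<le> a j"
  shows "odd_arc (f j i) (f j (Suc i))"
proof (cases "i = a j")
  case True
  have "v j (Suc (a j)) \<in> nb E (v j (a j))"
    using j nb_u v0 nb_v[OF j, of "a j"] by (cases "a j") auto
  then have "v j (Suc (a j)) \<in> nb (del X E) (v j (a j))"
    using kept[OF j] by (auto simp: nb_def del_def)
  then show ?thesis using \<phi> f_end[OF j] True by (auto simp: odd_hom_def odd_arc_def)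
qed (use f_walk[OF j] i in simp)

lemma odd_hom_psi: "odd_hom E \<psi>"
proof -
  have good: "(\<forall>x\<in>nb E w. \<psi> w \<inter> \<psi> x = {}) \<and> inj_on \<psi> (nb E w)" for w
  proof -
    \<comment> \<open>The kept vertices \<open>v j (a j)\<close> belong to the second case, because
      their inner neighbour may have a new value. In the third case \<open>w\<close> and all its
      neighbours keep their values.\<close>
    consider "w = u" | j i where "j \<in> J" "1 \<le> i" "i \<le> a j" "w = v j i"
      | "w \<noteq> u" "\<nexists>j i. j \<in> J \<and> 1 \<le> i \<and> i \<le> a j \<and> w = v j i" by blast
    then show ?thesis
    proof cases
      case 1
      have *: "\<psi> (v j 1) = f j 1" "\<psi> u = f j 0" if "j \<in> J" for j
        using psi_arm[OF that, of 1] psi_arm[OF that, of 0] v0[OF that] by auto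
      have "inj_on \<psi> (nb E w)"
        unfolding 1 nb_u
      proof (rule inj_onI)
        fix x x' assume "x \<in> (\<lambda>j. v j 1) ` J" "x' \<in> (\<lambda>j. v j 1) ` J" and eq: "\<psi> x = \<psi> x'"
        then obtain j j' where jj: "j \<in> J" "j' \<in> J" "x = v j 1" "x' = v j' 1" by blast
        then have "f j 1 = f j' 1" using eq *(1)[of j] *(1)[of j'] by simp
        then show "x = x'" using f_inj[of j j'] jj by blast
      qed
      moreover have "\<psi> w \<inter> \<psi> x = {}" if x: "x \<in> nb E w" for x
      proof -
        obtain j where j: "j \<in> J" "x = v j 1" using x unfolding 1 nb_u by blast
        show ?thesis using f_arc[OF j(1), of 0] *[OF j(1)] j(2) 1 by (simp add: odd_arc_def)
      qed
      ultimately show ?thesis by blast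
    next
      case (2 j i)
      then obtain k where k: "i = Suc k" by (cases i) auto
      have c: "\<psi> (v j k) = f j k" "\<psi> (v j (Suc k)) = f j (Suc k)" "\<psi> (v j (Suc (Suc k))) = f j (Suc (Suc k))"
        using psi_arm[OF 2(1)] 2 k by auto
      have nbw: "nb E w = {v j k, v j (Suc (Suc k))}" using nb_v[OF 2(1-3)] 2 k by simp
      have "f j k \<noteq> f j (Suc (Suc k))" "odd_arc (f j k) (f j (Suc k))"
        "odd_arc (f j (Suc k)) (f j (Suc (Suc k)))"
        using f_walk[OF 2(1), of k] f_arc[OF 2(1)] 2 k by auto
      then show ?thesis
        unfolding nbw using c 2(4) k by (auto simp: odd_arc_def)
    next
      case 3
      have w: "w \<notin> X"
      proof
        assume "w \<in> X"
        then obtain j i where "j \<in> J" "1 \<le> i" "i < a j" "w = v j i"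
          using 3(1) X_eq by (auto split: if_splits)
        then show False using 3(2) by (blast intro: less_imp_le)
      qed
      have nX: "x \<notin> X" if x: "x \<in> nb E w" for x
      proof
        assume "x \<in> X"
        have wx: "w \<in> nb E x" using x nb_sym by metis
        from \<open>x \<in> X\<close> consider j i where "j \<in> J" "1 \<le> i" "i < a j" "x = v j i"
          | "x = u" "\<forall>j\<in>J. a j > 0"
          using X_eq by (auto split: if_splits)
        then show False
        proof cases
          case (1 j i)
          then have "w = v j (i - 1) \<or> w = v j (Suc i)" using wx nb_v[of j i] by auto
          moreover have "w \<noteq> v j (Suc i)" using 3(2) 1 by (metis Suc_leI le_SucI)
          moreover have "w \<noteq> v j (i - 1)"
          proof (cases "i = 1")
            case True
            then show ?thesis using 3(1) v0[OF 1(1)] by simp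
          next
            case False
            then have "1 \<le> i - 1" "i - 1 \<le> a j" using 1 by auto
            then show ?thesis using 3(2) 1(1) by blast
          qed
          ultimately show False by blast
        next
          case 2
          then obtain j where "j \<in> J" "w = v j 1" using wx nb_u by auto
          then show False using 3 2 by (metis Suc_leI One_nat_def le_refl)
        qed
      qed
      have "nb (del X E) w = nb E w" using w nX by (auto simp: nb_def del_def)
      then have "(\<forall>x\<in>nb E w. \<phi> w \<inter> \<phi> x = {}) \<and> inj_on \<phi> (nb E w)"
        using \<phi> unfolding odd_hom_def by metis
      moreover have "inj_on \<psi> (nb E w) = inj_on \<phi> (nb E w)"
        by (rule inj_on_cong) (simp add: psi_outside nX)
      ultimately show ?thesis using psi_outside w nX by auto
    qed
  qed
  have "card (\<psi> x) = 3" for x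
  proof (cases "x \<in> X \<and> x \<noteq> u")
    case True
    then obtain j i where "j \<in> J" "1 \<le> i" "i < a j" "x = v j i" using X_eq by (auto split: if_splits)
    then show ?thesis using psi_arm[of j i] f_arc[of j i] by (auto simp: odd_arc_def)
  next
    case False
    then show ?thesis using psi_outside[of x] \<phi> y by (auto simp: odd_hom_def \<psi>_def)
  qed
  then show ?thesis using good by (simp add: odd_hom_def)
qed

end

section \<open>Reducible configurations and discharging\<close>

lemma less_3_cases: "j < (3::nat) \<longleftrightarrow> j = 0 \<or> j = 1 \<or> j = 2"
  by auto

lemma lessThan_3: "{..<3::nat} = {0, 1, 2}"
  by auto

locale minimal_counterexample =
  fixes V :: "'a set" and E :: "'a set set"
  assumes sg: "simple_graph V E"
    and deg_le: "card (nb E v) \<le> 4"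
    and girth: "is_cycle E vs \<Longrightarrow> length vs \<ge> 7"
    and sparse: "V \<noteq> {} \<Longrightarrow> 13 * card E < 14 * card V"
    and no_hom: "\<not> odd_hom E \<phi>"
    and minimal: "X \<noteq> {} \<Longrightarrow> X \<subseteq> V \<Longrightarrow> \<exists>\<phi>. odd_hom (del X E) \<phi>"
begin

lemma finV: "finite V" and fin_nb: "finite (nb E v)"
  using simple_graph_finite[OF sg] by auto

lemma nb_V: "nb E v \<subseteq> V"
  using simple_graph_edge[OF sg] by (auto simp: nb_def)

lemma nb_irrefl: "v \<notin> nb E v"
  using simple_graph_edge(3)[OF sg, of v v] by (auto simp: nb_def)

lemma V_nonempty: "V \<noteq> {}"
proof
  assume "V = {}"
  then have "E = {}" using sg by (auto simp: simple_graph_def)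
  then have "odd_hom E (\<lambda>_. {0, 1, 2})" by (simp add: odd_hom_def nb_def)
  then show False using no_hom by blast
qed

text \<open>A vertex whose only neighbour is u can be coloured last: four triples are disjoint from
  that of u, and the other neighbours of u use at most three of them.\<close>

lemma deg_ge_2:
  assumes "v \<in> V" shows "card (nb E v) \<ge> 2"
proof (rule ccontr)
  assume "\<not> ?thesis"
  then have "card (nb E v) \<le> Suc 0" by simp
  \<comment> \<open>For an isolated \<open>v\<close> the vertex \<open>u\<close> is arbitrary, hence
    the later distinction whether \<open>v\<close> is adjacent to \<open>u\<close>.\<close>
  then obtain u where u: "nb E v \<subseteq> {u}"
    using card_le_Suc0_iff_eq[OF fin_nb] by blast
  obtain \<phi> where \<phi>: "odd_hom (del {v} E) \<phi>" using minimal[of "{v}"] assms by auto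
  let ?C = "{y. card y = 3 \<and> y \<inter> \<phi> u = {}}"
  have 3: "card (\<phi> x) = 3" for x using \<phi> by (simp add: odd_hom_def)
  obtain y where y: "card y = 3" "y \<inter> \<phi> u = {}" "v \<in> nb E u \<Longrightarrow> y \<notin> \<phi> ` (nb E u - {v})"
  proof (cases "v \<in> nb E u")
    case True
    have "card (nb E u - {v}) \<le> 3" using True deg_le[of u] fin_nb by simp
    then have "card (\<phi> ` (nb E u - {v})) < card ?C"
      using card_image_le[of "nb E u - {v}" \<phi>] fin_nb card_odd_neighbours[OF 3] by simp
    then obtain y where "y \<in> ?C" "y \<notin> \<phi> ` (nb E u - {v})" by (rule exists_outside)
    then show ?thesis using that by blast
  next
    case False
    have "?C \<noteq> {}" using card_odd_neighbours[OF 3, of u] by (metis card.empty zero_neq_numeral)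
    then show ?thesis using that False by blast
  qed
  let ?\<psi> = "\<phi>(v := y)"
  have "odd_hom E ?\<psi>"
    unfolding odd_hom_def
  proof (intro conjI allI ballI)
    show "card (?\<psi> x) = 3" for x using 3 y by simp
    show "?\<psi> x \<inter> ?\<psi> w = {}" if "w \<in> nb E x" for x w
    proof -
      have "x \<noteq> w" using that nb_irrefl by auto
      moreover have "w = u" if "x = v" using \<open>w \<in> nb E x\<close> u that by auto
      moreover have "x = u" if "w = v" using \<open>w \<in> nb E x\<close> u that nb_sym by fastforce
      moreover have "w \<in> nb (del {v} E) x" if "x \<noteq> v" "w \<noteq> v"
        using that \<open>w \<in> nb E x\<close> by (auto simp: nb_def del_def)
      ultimately show ?thesis using y(2) \<phi> by (auto simp: odd_hom_def)
    qed
    show "inj_on ?\<psi> (nb E x)" for x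
    proof (cases "x = v")
      case True
      then show ?thesis using u by (auto simp: inj_on_def)
    next
      case False
      have "nb E x - {v} = nb (del {v} E) x" using False by (auto simp: nb_def del_def)
      then have inj: "inj_on \<phi> (nb E x - {v})" using \<phi> by (simp add: odd_hom_def)
      show ?thesis
      proof (cases "v \<in> nb E x")
        case True
        then have "x = u" using u nb_sym by fastforce
        then have "y \<notin> \<phi> ` (nb E x - {v})" using y(3) True by simp
        then have "inj_on ?\<psi> (insert v (nb E x - {v}))"
          using inj by (auto simp: inj_on_def)
        then show ?thesis using True by (simp add: insert_absorb)
      next
        case False
        then show ?thesis using inj by (auto simp: inj_on_def)
      qed
    qed
  qed
  then show False using no_hom by blast
qed

lemma deg_2_nb:
  assumes "card (nb E v) = 2" "x \<in> nb E v" "y \<in> nb E v" "x \<noteq> y"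
  shows "nb E v = {x, y}"
  using card_subset_eq[OF fin_nb, of "{x, y}" v] assms by simp

lemma walk_distinct:
  assumes "\<And>k. i \<le> k \<Longrightarrow> k < j \<Longrightarrow> w (Suc k) \<in> nb E (w k)"
    and "\<And>k. i \<le> k \<Longrightarrow> Suc (Suc k) \<le> j \<Longrightarrow> w k \<noteq> w (Suc (Suc k))"
    and "i < j" "j < i + 7"
  shows "w i \<noteq> w j"
proof
  assume "w i = w j"
  then have "\<exists>vs. is_cycle E vs \<and> set vs \<subseteq> w ` {i..j} \<and> length vs \<le> j - i"
    using assms by (intro walk_imp_cycle[OF sg]) (auto simp: nb_def)
  then obtain vs where "is_cycle E vs" "length vs \<le> j - i" by blast
  then show False using girth[of vs] assms(4) by linarith
qed

lemma closed_walk_length: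
  assumes "\<And>k. k < m \<Longrightarrow> w (Suc k) \<in> nb E (w k)"
    and "\<And>k. Suc (Suc k) \<le> m \<Longrightarrow> w k \<noteq> w (Suc (Suc k))"
    and "0 < m" "w 0 = w m"
  shows "m \<ge> 7"
proof (rule ccontr)
  assume "\<not> ?thesis"
  then have "m < 0 + 7" by simp
  have "w 0 \<noteq> w m"
    by (rule walk_distinct[OF _ _ assms(3) \<open>m < 0 + 7\<close>]) (use assms in auto)
  then show False using assms by simp
qed

text \<open>The configuration has its centre at \<open>w 1\<close>, with an arm of length \<open>0\<close> to \<open>w 0\<close> and one of
  length \<open>a\<close> to \<open>w (a + 2)\<close>. The two ends may coincide.\<close>

lemma thread_reducible:
  assumes a: "1 \<le> a" "a \<le> 6"
    and w: "\<And>k. k \<le> Suc a \<Longrightarrow> w (Suc k) \<in> nb E (w k)"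
    and nbt: "\<And>k. k \<le> a \<Longrightarrow> w k \<noteq> w (Suc (Suc k))"
    and deg: "\<And>k. 1 \<le> k \<Longrightarrow> k \<le> Suc a \<Longrightarrow> card (nb E (w k)) = 2"
    and X: "X = {w i | i. 2 \<le> i \<and> i \<le> a}" "X \<noteq> {}"
    and sp: "\<And>\<phi>. odd_hom (del X E) \<phi> \<Longrightarrow>
      card (spokes a (\<phi> (w (Suc a))) (\<phi> (w (Suc (Suc a)))) (\<phi> (w 1))) \<ge> 2"
  shows False
proof -
  have dist: "w i \<noteq> w j" if "i < j" "j < i + 7" "j \<le> Suc (Suc a)" for i j
    by (rule walk_distinct) (use that w nbt in auto)
  have nbw: "nb E (w (Suc k)) = {w k, w (Suc (Suc k))}" if "k \<le> a" for k
    using that w[of k] w[of "Suc k"] nbt[of k] deg[of "Suc k"] nb_sym[of _ E] 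
    by (intro deg_2_nb) auto
  have "w i \<in> V" if "2 \<le> i" "i \<le> a" for i
    using w[of "i - 1"] nb_V[of "w (i - 1)"] that by (auto simp: subset_iff)
  then have "X \<subseteq> V" unfolding X by blast
  then obtain \<phi> where \<phi>: "odd_hom (del X E) \<phi>" using minimal[OF X(2)] by blast
  define p q where "p = \<phi> (w (Suc a))" and "q = \<phi> (w (Suc (Suc a)))"
  have 3: "card (\<phi> x) = 3" for x using \<phi> by (simp add: odd_hom_def)
  have notX: "w 0 \<notin> X" "w 1 \<notin> X" "w (Suc a) \<notin> X" "w (Suc (Suc a)) \<notin> X"
  proof -
    have "w 0 \<noteq> w i" "w 1 \<noteq> w i" "w i \<noteq> w (Suc a)" "w i \<noteq> w (Suc (Suc a))" if "2 \<le> i" "i \<le> a" for i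
      using that a by (intro dist; simp)+
    then show "w 0 \<notin> X" "w 1 \<notin> X" "w (Suc a) \<notin> X" "w (Suc (Suc a)) \<notin> X"
      unfolding X by (auto simp: eq_commute)
  qed
  have "w 0 \<in> nb (del X E) (w 1)"
    using notX w[of 0] by (auto simp: nb_def del_def insert_commute)
  then have "odd_arc (\<phi> (w 1)) (\<phi> (w 0))" using \<phi> by (auto simp: odd_hom_def odd_arc_def)
  then obtain s0 where s0: "s0 \<notin> \<phi> (w 1)" "\<phi> (w 0) = - \<phi> (w 1) - {s0}" by (rule odd_arc_missing)
  \<comment> \<open>The surviving edge from \<open>w 1\<close> to \<open>w 0\<close> occupies one of
    the first steps; this is why two spokes are required.\<close>
  obtain s where s: "s \<in> spokes a p q (\<phi> (w 1))" "s \<noteq> s0"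
    using card_ge_2_obtain[OF sp[OF \<phi>]] unfolding p_def q_def by blast
  let ?z = "- \<phi> (w 1) - {s}"
  have sz: "s \<notin> \<phi> (w 1)" "reach a p q (\<phi> (w 1)) ?z" using s by (auto simp: spokes_def)
  have ne: "?z \<noteq> \<phi> (w 0)" using s s0 sz by blast
  obtain g where g: "g 0 = \<phi> (w 1)" "g 1 = ?z" "g a = p" "g (Suc a) = q"
    "\<And>i. i < a \<Longrightarrow> odd_arc (g i) (g (Suc i)) \<and> g i \<noteq> g (Suc (Suc i))"
    using reach_obtain_walk[OF sz(2)] by blast
  let ?v = "\<lambda>(j::nat) i. if j = 0 then (if i = 0 then w 1 else w 0) else w (Suc i)"
  let ?a = "\<lambda>j::nat. if j = 0 then 0 else a"
  let ?f = "\<lambda>(j::nat) i. if j = 0 then (if i = 0 then \<phi> (w 1) else \<phi> (w 0)) else g i"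
  interpret odd_extension E X \<phi> "\<phi> (w 1)" "{0, 1}" "w 1" ?v ?a ?f
  proof
    show "X = {?v j i |j i. j \<in> {0, 1} \<and> 1 \<le> i \<and> i < ?a j} \<union> (if \<forall>j\<in>{0, 1}. 0 < ?a j then {w 1} else {})"
    proof -
      have "{?v j i |j i. j \<in> {0, 1} \<and> 1 \<le> i \<and> i < ?a j} = {w (Suc i) |i. 1 \<le> i \<and> i < a}"
        by (auto split: if_splits)
      also have "\<dots> = X"
      proof -
        have "\<exists>i. w k = w (Suc i) \<and> 1 \<le> i \<and> i < a" if "2 \<le> k" "k \<le> a" for k
          using that by (intro exI[of _ "k - 1"]) auto
        moreover have "\<exists>k. w (Suc i) = w k \<and> 2 \<le> k \<and> k \<le> a" if "1 \<le> i" "i < a" for i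
          using that by (intro exI[of _ "Suc i"]) auto
        ultimately show ?thesis unfolding X by blast
      qed
      finally show ?thesis by simp
    qed
    show "nb E (w 1) = (\<lambda>j. ?v j 1) ` {0, 1}" using nbw[of 0] by auto
    show "nb E (?v j i) = {?v j (i - 1), ?v j (Suc i)}" if "j \<in> {0, 1}" "1 \<le> i" "i \<le> ?a j" for j i
      using that nbw[of i] by (auto split: if_splits)
    show "j = j' \<and> i = i'"
      if "j \<in> {0, 1}" "j' \<in> {0, 1}" "1 \<le> i" "i < ?a j" "1 \<le> i'" "i' < ?a j'" "?v j i = ?v j' i'" for j i j' i'
    proof -
      have 1: "j = 1" "j' = 1" "i < a" "i' < a" using that by (auto split: if_splits)
      then have "w (Suc i) = w (Suc i')" using that by simp
      then have "i = i'"
        using dist[of "Suc i" "Suc i'"] dist[of "Suc i'" "Suc i"] 1 a that(3,5)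
        by (cases i i' rule: linorder_cases) auto
      then show ?thesis using 1 by simp
    qed
    show "?v j i \<noteq> w 1" if "j \<in> {0, 1}" "1 \<le> i" "i < ?a j" for j i
      using that dist[of 1 "Suc i"] a by (auto split: if_splits)
    show "?f j 1 \<noteq> ?f j' 1" if "j \<in> {0, 1}" "j' \<in> {0, 1}" "j \<noteq> j'" for j j'
      using that ne g(2) by auto
  qed (use \<phi> 3 notX g odd_arc_Diff[OF 3 sz(1)] p_def q_def in \<open>auto split: if_splits\<close>)
  show False using odd_hom_psi no_hom by blast
qed

text \<open>If the walk closes to a 7-cycle, five steps are free. The exception of
  \<open>spokes_5_card\<close> does not occur, because \<open>w 1\<close> and \<open>w 6\<close> are
  kept neighbours of \<open>w 0\<close> and local injectivity gives them different triples. In the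
  other alternative six steps are free, and there \<open>spokes_6_card\<close> has no
  exception.\<close>

lemma no_thread:
  assumes w: "\<And>k. k \<le> 6 \<Longrightarrow> w (Suc k) \<in> nb E (w k)"
    and nbt: "\<And>k. k \<le> 5 \<Longrightarrow> w k \<noteq> w (Suc (Suc k))"
    and deg: "\<And>k. 1 \<le> k \<Longrightarrow> k \<le> 6 \<Longrightarrow> card (nb E (w k)) = 2"
    and last: "w 7 = w 0 \<or> card (nb E (w 7)) = 2 \<and> w 8 \<in> nb E (w 7) \<and> w 6 \<noteq> w 8"
  shows False
proof (cases "w 7 = w 0")
  case True
  let ?X = "{w i | i. 2 \<le> i \<and> i \<le> 5}"
  show False
  proof (rule thread_reducible[of 5 w ?X])
    fix \<phi> assume \<phi>: "odd_hom (del ?X E) \<phi>"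
    have dist: "w i \<noteq> w j" if "i < j" "j < i + 7" "j \<le> 7" for i j
      by (rule walk_distinct) (use that w nbt in auto)
    have n: "w 0 \<notin> ?X" "w 1 \<notin> ?X" "w 6 \<notin> ?X"
    proof -
      have "w 0 \<noteq> w i" "w 1 \<noteq> w i" "w i \<noteq> w 6" if "2 \<le> i" "i \<le> 5" for i
        using that by (intro dist; simp)+
      then show "w 0 \<notin> ?X" "w 1 \<notin> ?X" "w 6 \<notin> ?X"
        by (auto simp: eq_commute)
    qed
    have "w 1 \<in> nb E (w 0)" using w[of 0] by simp
    moreover have "w 7 \<in> nb E (w 6)" using w[of 6] by simp
    ultimately have "w 1 \<in> nb (del ?X E) (w 0)" "w 6 \<in> nb (del ?X E) (w 0)" "w 1 \<noteq> w 6"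
      "w 7 \<in> nb (del ?X E) (w 6)"
      using n dist[of 1 6] True by (auto simp: nb_def del_def insert_commute)
    then have "\<phi> (w 1) \<noteq> \<phi> (w 6)" "odd_arc (\<phi> (w 6)) (\<phi> (w 7))"
      using \<phi> by (auto simp: odd_hom_def odd_arc_def inj_on_def)
    then have "card (spokes 5 (\<phi> (w 6)) (\<phi> (w 7)) (\<phi> (w 1))) \<ge> 3"
      using \<phi> by (intro spokes_5_card) (auto simp: odd_hom_def)
    then show "card (spokes 5 (\<phi> (w (Suc 5))) (\<phi> (w (Suc (Suc 5)))) (\<phi> (w 1))) \<ge> 2"
      by (simp add: eval_nat_numeral)
  qed (use w nbt deg in auto)
next
  case False
  let ?X = "{w i | i. 2 \<le> i \<and> i \<le> 6}"
  have w': "w (Suc k) \<in> nb E (w k)" if "k \<le> 7" for k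
    using that w[of k] last False by (cases "k = 7") (auto simp: eval_nat_numeral)
  have nbt': "w k \<noteq> w (Suc (Suc k))" if "k \<le> 6" for k
    using that nbt[of k] last False by (cases "k = 6") (auto simp: eval_nat_numeral)
  show False
  proof (rule thread_reducible[of 6 w ?X])
    show "card (nb E (w k)) = 2" if "1 \<le> k" "k \<le> Suc 6" for k
      using that deg[of k] last False by (cases "k = 7") auto
    fix \<phi> assume \<phi>: "odd_hom (del ?X E) \<phi>"
    have "w 7 \<noteq> w i" "w i \<noteq> w 8" if "2 \<le> i" "i \<le> 6" for i
      using that walk_distinct[of i 7 w] walk_distinct[of i 8 w] w' nbt' by force+
    moreover have "w 8 \<in> nb E (w 7)" using last False by simp
    ultimately have "w 8 \<in> nb E (w 7)" "w 7 \<notin> ?X" "w 8 \<notin> ?X" by fastforce+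
    then have "w 8 \<in> nb (del ?X E) (w 7)" unfolding nb_def del_def by blast
    then have "odd_arc (\<phi> (w 7)) (\<phi> (w 8))" using \<phi> by (auto simp: odd_hom_def odd_arc_def)
    then have "card (spokes 6 (\<phi> (w 7)) (\<phi> (w 8)) (\<phi> (w 1))) \<ge> 3"
      using \<phi> by (intro spokes_6_card) (auto simp: odd_hom_def)
    then show "card (spokes 6 (\<phi> (w (Suc 6))) (\<phi> (w (Suc (Suc 6)))) (\<phi> (w 1))) \<ge> 2"
      by (simp add: eval_nat_numeral)
  qed (use w' nbt' in auto)
qed

abbreviation wlk :: "'a \<Rightarrow> 'a \<Rightarrow> nat \<Rightarrow> 'a" where
  "wlk \<equiv> nbwalk E"

lemma wlk_step:
  assumes "y \<in> nb E x"
  shows "wlk x y (Suc i) \<in> nb E (wlk x y i)" "wlk x y (Suc (Suc i)) \<noteq> wlk x y i"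
  using nbwalk_step[OF sg _ assms] deg_ge_2 by auto

lemma wlk_1: "wlk x y 1 = y"
  by simp

lemma wlk_nbt: "y \<in> nb E x \<Longrightarrow> wlk x y i \<noteq> wlk x y (Suc (Suc i))"
  using wlk_step(2) by metis

lemma wlk_nb_2:
  assumes "y \<in> nb E x" "card (nb E (wlk x y (Suc i))) = 2"
  shows "nb E (wlk x y (Suc i)) = {wlk x y i, wlk x y (Suc (Suc i))}"
  using wlk_step[OF assms(1), of i] wlk_step(1)[OF assms(1), of "Suc i"] nb_sym[of _ E]
  by (intro deg_2_nb assms) auto

lemma wlk_no_thread:
  assumes "y \<in> nb E x" "\<And>k. 1 \<le> k \<Longrightarrow> k \<le> 6 \<Longrightarrow> card (nb E (wlk x y k)) = 2"
  shows "wlk x y 7 \<noteq> x" "card (nb E (wlk x y 7)) \<noteq> 2"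
proof -
  have 8: "wlk x y 8 \<in> nb E (wlk x y 7)" "wlk x y 8 \<noteq> wlk x y 6"
    using wlk_step(1)[OF assms(1), of 7] wlk_step(2)[OF assms(1), of 6] by (simp_all add: eval_nat_numeral)
  have nt: "\<not> (wlk x y 7 = wlk x y 0 \<or> card (nb E (wlk x y 7)) = 2 \<and>
      wlk x y 8 \<in> nb E (wlk x y 7) \<and> wlk x y 6 \<noteq> wlk x y 8)"
  proof
    assume *: "wlk x y 7 = wlk x y 0 \<or> card (nb E (wlk x y 7)) = 2 \<and>
      wlk x y 8 \<in> nb E (wlk x y 7) \<and> wlk x y 6 \<noteq> wlk x y 8"
    show False
      by (rule no_thread[OF _ _ _ *]) (use wlk_step(1)[OF assms(1)] wlk_nbt[OF assms(1)] assms(2) in auto)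
  qed
  then show "wlk x y 7 \<noteq> x" by auto
  show "card (nb E (wlk x y 7)) \<noteq> 2" using nt 8 by auto
qed

text \<open>Two arms that meet close up to a nonbacktracking walk from \<open>u\<close> to \<open>u\<close> through vertices of degree 2,
  which by the girth condition contains one of the configurations of \<open>no_thread\<close>.\<close>

lemma arms_disjoint:
  assumes u: "card (nb E u) \<noteq> 2" and x: "x \<in> nb E u" "x' \<in> nb E u" "x \<noteq> x'"
  shows "1 \<le> i \<Longrightarrow> 1 \<le> i' \<Longrightarrow> (\<And>k. 1 \<le> k \<Longrightarrow> k \<le> i \<Longrightarrow> card (nb E (wlk u x k)) = 2) \<Longrightarrow>
    (\<And>k. 1 \<le> k \<Longrightarrow> k \<le> i' \<Longrightarrow> card (nb E (wlk u x' k)) = 2) \<Longrightarrow> wlk u x i \<noteq> wlk u x' i'"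
proof (induction i arbitrary: i')
  case (Suc i)
  let ?w = "wlk u x" and ?w' = "wlk u x'"
  note d = Suc.prems(3) and d' = Suc.prems(4)
  show ?case
  proof
    assume eq: "?w (Suc i) = ?w' i'"
    obtain m where m: "i' = Suc m" using Suc.prems by (cases i') auto
    show False
    proof (cases "?w i = ?w' m")
      case True
      show False
      proof (cases "i = 0 \<or> m = 0")
        case True
        have "i = 0 \<and> m = 0"
        proof (rule ccontr)
          assume "\<not> ?thesis"
          then consider "i = 0" "1 \<le> m" | "m = 0" "1 \<le> i" using True by linarith
          then show False
          proof cases
            case 1
            then have "card (nb E (?w' m)) = 2" using d'[of m] m by simp
            then show False using u \<open>?w i = ?w' m\<close> 1 by simp
          next
            case 2
            then have "card (nb E (?w i)) = 2" using d[of i] by simp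
            then show False using u \<open>?w i = ?w' m\<close> 2 by simp
          qed
        qed
        then show False using eq m x by simp
      next
        case False
        then show False using Suc.IH[of m] d d' m \<open>?w i = ?w' m\<close> by auto
      qed
    next
      case False
      \<comment> \<open>Out along one arm and back along the other. At the meeting vertex the walk
        does not backtrack, since the predecessors on the two arms differ in this case.\<close>
      define N where "N = Suc i + i'"
      define W where "W k = (if k \<le> Suc i then ?w k else ?w' (N - k))" for k
      have W': "W k = ?w' (N - k)" if "Suc i \<le> k" "k \<le> N" for k
        using that eq by (cases "k = Suc i") (auto simp: W_def N_def)
      have W: "W k = ?w k" if "k \<le> Suc i" for k
        using that by (simp add: W_def)
      have step: "W (Suc k) \<in> nb E (W k)" if "k < N" for k
      proof (cases "k < Suc i")
        case True
        then show ?thesis using W wlk_step(1)[OF x(1)] by simp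
      next
        case False
        have "?w' (Suc (N - Suc k)) \<in> nb E (?w' (N - Suc k))" using wlk_step(1)[OF x(2)] by simp
        then have "?w' (N - Suc k) \<in> nb E (?w' (N - k))"
          using nb_sym[of "?w' (N - Suc k)" E] that by (simp add: Suc_diff_Suc)
        then show ?thesis using W'[of k] W'[of "Suc k"] False that by simp
      qed
      have nbt: "W k \<noteq> W (Suc (Suc k))" if "Suc (Suc k) \<le> N" for k
      proof -
        consider "Suc (Suc k) \<le> Suc i" | "k = i" | "Suc i \<le> k" by linarith
        then show ?thesis
        proof cases
          case 1
          then show ?thesis using W wlk_step(2)[OF x(1), of k] by simp
        next
          case 2
          then show ?thesis using W[of i] W'[of "Suc (Suc i)"] False that m by (simp add: N_def)
        next
          case 3
          have "?w' (Suc (Suc (N - Suc (Suc k)))) \<noteq> ?w' (N - Suc (Suc k))"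
            using wlk_step(2)[OF x(2)] by simp
          then show ?thesis using W'[of k] W'[of "Suc (Suc k)"] 3 that by (simp add: Suc_diff_Suc)
        qed
      qed
      have deg: "card (nb E (W k)) = 2" if "1 \<le> k" "k < N" for k
        using that d[of k] d'[of "N - k"] by (auto simp: W_def N_def)
      have ends: "W 0 = u" "W N = u" using W'[of N] by (simp_all add: W_def N_def)
      have N7: "N \<ge> 7" using closed_walk_length[of N W] step nbt ends by (simp add: N_def)
      show False
      proof (rule no_thread[of W])
        show "W 7 = W 0 \<or> card (nb E (W 7)) = 2 \<and> W 8 \<in> nb E (W 7) \<and> W 6 \<noteq> W 8"
        proof (cases "N = 7")
          case True
          then show ?thesis using ends by simp
        next
          case False
          then have "7 < N" "Suc (Suc 6) \<le> N" using N7 by auto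
          then show ?thesis using deg[of 7] step[of 7] nbt[of 6] by simp
        qed
      qed (use step nbt deg N7 in auto)
    qed
  qed
qed simp

text \<open>Arms need not be whole threads, so fixing their total length at 12 loses nothing. The
  triple of \<open>u\<close> is supplied by \<open>joinable_12\<close>.\<close>

lemma no_spider:
  assumes u: "card (nb E u) = 3" and nbu: "nb E u = {x 0, x 1, x (2::nat)}"
    and a: "\<And>j. j < 3 \<Longrightarrow> a j \<le> 6" "a 0 + a 1 + a 2 = 12"
    and deg: "\<And>j k. j < 3 \<Longrightarrow> 1 \<le> k \<Longrightarrow> k \<le> a j \<Longrightarrow> card (nb E (wlk u (x j) k)) = 2"
  shows False
proof -
  let ?J = "{..<3::nat}"
  let ?v = "\<lambda>j. wlk u (x j)"
  have x: "x j \<in> nb E u" if "j < 3" for j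
    using that nbu by (auto simp: less_3_cases)
  have nbx: "nb E u = x ` {..<3}" unfolding nbu lessThan_3 by simp
  then have "inj_on x {..<3}" using u by (intro eq_card_imp_inj_on) auto
  then have x_inj: "x j \<noteq> x j'" if "j < 3" "j' < 3" "j \<noteq> j'" for j j'
    using that by (auto simp: inj_on_def)
  have u2: "card (nb E u) \<noteq> 2" using u by simp
  have self: "?v j i \<noteq> ?v j i'" if "j < 3" "i < i'" "i' < i + 7" for j i i'
    by (rule walk_distinct) (use wlk_step(1)[OF x[OF that(1)]] wlk_nbt[OF x[OF that(1)]] that in auto)
  \<comment> \<open>An arm of length 0 has \<open>u\<close> as the first vertex of its end arc, so
    \<open>u\<close> must then be kept.\<close>
  define X where "X = {?v j i | j i. j \<in> ?J \<and> 1 \<le> i \<and> i < a j} \<union> (if \<forall>j\<in>?J. a j > 0 then {u} else {})"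
  have int_u: "?v j i \<noteq> u" if "j < 3" "1 \<le> i" "i \<le> a j" for j i
    using deg[OF that] u by auto
  \<comment> \<open>The bounds on \<open>i\<close> and \<open>i'\<close> are asymmetric because the
    end vertices of two arms may coincide. An end vertex equal to an inner vertex of another arm has
    degree 2, so \<open>arms_disjoint\<close> covers it too.\<close>
  have meet: "j = j' \<and> i = i'"
    if "j < 3" "j' < 3" "1 \<le> i" "i \<le> Suc (a j)" "1 \<le> i'" "i' \<le> a j'" "?v j i = ?v j' i'" for j i j' i'
  proof (cases "j = j'")
    case True
    then show ?thesis
      using that self[of j i i'] self[of j i' i] a(1)[of j] by (cases i i' rule: linorder_cases) auto
  next
    case False
    have "card (nb E (?v j k)) = 2" if "1 \<le> k" "k \<le> i" for k
    proof (cases "k \<le> a j")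
      case True then show ?thesis using deg \<open>j < 3\<close> that by simp
    next
      case False
      then have "k = i" using that \<open>i \<le> Suc (a j)\<close> by simp
      then show ?thesis using deg[of j' i'] \<open>j' < 3\<close> \<open>1 \<le> i'\<close> \<open>i' \<le> a j'\<close> \<open>?v j i = ?v j' i'\<close> by simp
    qed
    then have "?v j i \<noteq> ?v j' i'"
      using that deg[of j'] by (intro arms_disjoint[OF u2 x x x_inj] False) auto
    then show ?thesis using that by simp
  qed
  \<comment> \<open>Six vertices of degree 2 returning to \<open>u\<close> would form the 7-cycle
    excluded by \<open>no_thread\<close>; a shorter return contradicts the girth.\<close>
  have end_u: "?v j (Suc (a j)) \<noteq> u" if "j < 3" for j
  proof (cases "a j = 6")
    case True
    then show ?thesis using wlk_no_thread(1)[OF x[OF that]] deg[OF that] by (simp add: eval_nat_numeral)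
  next
    case False
    then show ?thesis using self[of j 0 "Suc (a j)"] a(1)[OF that] that by simp
  qed
  have kept: "?v j (a j) \<notin> X" "?v j (Suc (a j)) \<notin> X" if j: "j < 3" for j
  proof -
    have "?v j (a j) \<noteq> ?v j' i" if "j' < 3" "1 \<le> i" "i < a j'" for j' i
    proof (cases "a j = 0")
      case True
      then show ?thesis using int_u[of j' i] that by auto
    next
      case False
      then show ?thesis using meet[of j j' "a j" i] j that by auto
    qed
    moreover have "?v j (a j) \<noteq> u" if "0 < a j" using int_u[of j "a j"] j that by simp
    ultimately show "?v j (a j) \<notin> X" using j unfolding X_def by (auto split: if_splits)
    have "?v j (Suc (a j)) \<noteq> ?v j' i" if "j' < 3" "1 \<le> i" "i < a j'" for j' i
      using meet[of j j' "Suc (a j)" i] j that by auto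
    then show "?v j (Suc (a j)) \<notin> X" using j end_u[OF j] unfolding X_def by (auto split: if_splits)
  qed
  have uV: "u \<in> V" using x[of 0] nb_sym nb_V by fastforce
  have "?v j i \<in> V" if "j < 3" for j i
    using wlk_step(1)[OF x[OF that]] nb_V uV by (cases i) (auto simp: subset_iff)
  then have XV: "X \<subseteq> V" using uV unfolding X_def by (auto split: if_splits)
  have "X \<noteq> {}"
  proof -
    have "\<exists>j<3. a j > 1"
    proof (rule ccontr)
      assume *: "\<not> ?thesis"
      have "a j \<le> 1" if "j < 3" for j using * that by (meson not_le)
      from this[of 0] this[of 1] this[of 2] show False using a(2) by simp
    qed
    then obtain j where "j < 3" "a j > 1" by blast
    then have "?v j 1 \<in> X" unfolding X_def by blast
    then show ?thesis by blast
  qed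
  then obtain \<phi> where \<phi>: "odd_hom (del X E) \<phi>" using minimal XV by blast
  have 3: "card (\<phi> z) = 3" for z using \<phi> by (simp add: odd_hom_def)
  define p q where "p j = \<phi> (?v j (a j))" and "q j = \<phi> (?v j (Suc (a j)))" for j
  have "odd_arc (p j) (q j)" if "j < 3" for j
  proof -
    have "?v j (Suc (a j)) \<in> nb (del X E) (?v j (a j))"
      using wlk_step(1)[OF x[OF that], of "a j"] kept[OF that] unfolding nb_def del_def by blast
    then show ?thesis using \<phi> by (simp add: p_def q_def odd_arc_def odd_hom_def)
  qed
  then have "joinable (a 0) (p 0) (q 0) (a 1) (p 1) (q 1) (a 2) (p 2) (q 2)"
    using a by (intro joinable_12) auto
  then obtain y s0 s1 s2 where y: "card y = 3" and s: "s0 \<in> spokes (a 0) (p 0) (q 0) y"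
    "s1 \<in> spokes (a 1) (p 1) (q 1) y" "s2 \<in> spokes (a 2) (p 2) (q 2) y" "s0 \<noteq> s1" "s0 \<noteq> s2" "s1 \<noteq> s2"
    unfolding joinable_def by auto
  define s where "s = (\<lambda>j::nat. if j = 0 then s0 else if j = 1 then s1 else s2)"
  have s_sp: "s j \<in> spokes (a j) (p j) (q j) y" if "j < 3" for j
    using that s by (auto simp: s_def less_3_cases)
  have s_inj: "s j \<noteq> s j'" if "j < 3" "j' < 3" "j \<noteq> j'" for j j'
    using that s by (auto simp: s_def less_3_cases)
  define P where "P j g \<longleftrightarrow> g 0 = y \<and> g 1 = - y - {s j} \<and> g (a j) = p j \<and> g (Suc (a j)) = q j \<and>
    (\<forall>i<a j. odd_arc (g i) (g (Suc i)) \<and> g i \<noteq> g (Suc (Suc i)))" for j g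
  have "\<exists>g. P j g" if "j < 3" for j
  proof -
    have "reach (a j) (p j) (q j) y (- y - {s j})" using s_sp[OF that] by (simp add: spokes_def)
    then show ?thesis unfolding P_def by (rule reach_obtain_walk) blast
  qed
  then obtain f where "\<And>j. j < 3 \<Longrightarrow> P j (f j)" by metis
  then have f: "\<And>j. j < 3 \<Longrightarrow> f j 0 = y" "\<And>j. j < 3 \<Longrightarrow> f j 1 = - y - {s j}"
    "\<And>j. j < 3 \<Longrightarrow> f j (a j) = p j" "\<And>j. j < 3 \<Longrightarrow> f j (Suc (a j)) = q j"
    "\<And>j i. j < 3 \<Longrightarrow> i < a j \<Longrightarrow> odd_arc (f j i) (f j (Suc i)) \<and> f j i \<noteq> f j (Suc (Suc i))"
    unfolding P_def by blast+
  interpret odd_extension E X \<phi> y ?J u ?v a f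
  proof
    show "nb E u = (\<lambda>j. ?v j 1) ` ?J"
      unfolding nbu lessThan_3 image_insert image_empty wlk_1 by (rule refl)
    show "nb E (?v j i) = {?v j (i - 1), ?v j (Suc i)}" if "j \<in> ?J" "1 \<le> i" "i \<le> a j" for j i
      using wlk_nb_2[OF x, of j "i - 1"] deg[of j i] that by simp
    show "j = j' \<and> i = i'" if "j \<in> ?J" "j' \<in> ?J" "1 \<le> i" "i < a j" "1 \<le> i'" "i' < a j'" "?v j i = ?v j' i'"
      for j i j' i'
      using meet[of j j' i i'] that by simp
    show "f j 1 \<noteq> f j' 1" if "j \<in> ?J" "j' \<in> ?J" "j \<noteq> j'" for j j'
    proof -
      have "s j \<notin> y" "s j' \<notin> y" "s j \<noteq> s j'" using s_sp s_inj that by (auto simp: spokes_def)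
      then have "- y - {s j} \<noteq> - y - {s j'}" by blast
      then show ?thesis using f(2) that by simp
    qed
  qed (use \<phi> y X_def int_u kept f p_def q_def in auto)
  show False using odd_hom_psi no_hom by blast
qed

section \<open>Thread lengths and discharging\<close>

definition thread_len :: "'a \<Rightarrow> 'a \<Rightarrow> nat" where
  "thread_len x y = (LEAST i. card (nb E (wlk x y (Suc i))) \<noteq> 2)"

text \<open>Because \<open>wlk_no_thread\<close> excludes seven consecutive vertices of degree 2,
  the \<open>LEAST\<close> is attained and is at most 6.\<close>

lemma thread_len:
  assumes "y \<in> nb E x"
  shows "thread_len x y \<le> 6" "card (nb E (wlk x y (Suc (thread_len x y)))) \<noteq> 2"
    "\<And>k. 1 \<le> k \<Longrightarrow> k \<le> thread_len x y \<Longrightarrow> card (nb E (wlk x y k)) = 2"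
proof -
  have "\<exists>i\<le>6. card (nb E (wlk x y (Suc i))) \<noteq> 2"
  proof (rule ccontr)
    assume *: "\<not> ?thesis"
    have **: "card (nb E (wlk x y k)) = 2" if "1 \<le> k" "k \<le> 7" for k
      using * that by (cases k) auto
    then show False using wlk_no_thread(2)[OF assms] by simp
  qed
  then obtain i where i: "i \<le> 6" "card (nb E (wlk x y (Suc i))) \<noteq> 2" by blast
  show "thread_len x y \<le> 6" using Least_le[of "\<lambda>i. card (nb E (wlk x y (Suc i))) \<noteq> 2", OF i(2)] i(1)
    by (simp add: thread_len_def)
  show "card (nb E (wlk x y (Suc (thread_len x y)))) \<noteq> 2"
    unfolding thread_len_def by (rule LeastI[of "\<lambda>i. card (nb E (wlk x y (Suc i))) \<noteq> 2", OF i(2)])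
  show "card (nb E (wlk x y k)) = 2" if "1 \<le> k" "k \<le> thread_len x y" for k
    using that not_less_Least[of "k - 1" "\<lambda>i. card (nb E (wlk x y (Suc i))) \<noteq> 2"]
    by (simp add: thread_len_def)
qed

lemma sum_thread_len_3:
  assumes u: "card (nb E u) = 3"
  shows "(\<Sum>x\<in>nb E u. thread_len u x) \<le> 11"
proof (rule ccontr)
  assume *: "\<not> ?thesis"
  obtain x0 x1 x2 where x: "nb E u = {x0, x1, x2}" "x0 \<noteq> x1" "x0 \<noteq> x2" "x1 \<noteq> x2"
    using u by (auto simp: card_3_iff)
  let ?t = "thread_len u"
  have t6: "?t x0 \<le> 6" "?t x1 \<le> 6" "?t x2 \<le> 6" using thread_len(1) x by auto
  have "?t x0 + ?t x1 + ?t x2 \<ge> 12" using * x by simp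
  \<comment> \<open>Only the third arm is shortened, to make the total exactly 12; the first two
    together have length at most 12.\<close>
  then obtain a0 a1 a2 where a: "a0 \<le> ?t x0" "a1 \<le> ?t x1" "a2 \<le> ?t x2" "a0 + a1 + a2 = 12"
    using t6 that[of "?t x0" "?t x1" "12 - ?t x0 - ?t x1"] by linarith
  let ?x = "\<lambda>j::nat. if j = 0 then x0 else if j = 1 then x1 else x2"
  let ?a = "\<lambda>j::nat. if j = 0 then a0 else if j = 1 then a1 else a2"
  have a_le: "?a j \<le> ?t (?x j)" "?x j \<in> nb E u" for j :: nat using a x by auto
  show False
  proof (rule no_spider[OF u, of ?x ?a])
    show "nb E u = {?x 0, ?x 1, ?x 2}" using x by simp
    show "?a j \<le> 6" for j using a_le[of j] thread_len(1)[OF a_le(2)[of j]] by linarith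
    show "?a 0 + ?a 1 + ?a 2 = 12" using a by simp
    show "card (nb E (wlk u (?x j) k)) = 2" if "1 \<le> k" "k \<le> ?a j" for j k
      using thread_len(3)[OF a_le(2)[of j] that(1)] that(2) a_le(1)[of j] by linarith
  qed
qed

lemma sum_thread_len_4:
  assumes "card (nb E u) = 4"
  shows "(\<Sum>x\<in>nb E u. thread_len u x) \<le> 24"
  using sum_bounded_above[of "nb E u" "thread_len u" 6] thread_len(1) assms by simp

text \<open>Follow the thread backwards from the arc \<open>w, z\<close> and reverse it.\<close>

lemma thread_origin:
  assumes z: "card (nb E z) = 2" "w \<in> nb E z"
  shows "\<exists>x y j. y \<in> nb E x \<and> card (nb E x) \<noteq> 2 \<and> 1 \<le> j \<and> j \<le> thread_len x y \<and>
    wlk x y j = z \<and> wlk x y (Suc j) = w"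
proof -
  have zw: "z \<in> nb E w" using z nb_sym by metis
  define r where "r = wlk w z"
  define m where "m = Suc (thread_len w z)"
  have m: "card (nb E (r m)) \<noteq> 2" "\<And>k. 1 \<le> k \<Longrightarrow> k < m \<Longrightarrow> card (nb E (r k)) = 2"
    using thread_len[OF zw] by (simp_all add: r_def m_def)
  have "m \<noteq> 1" using m(1) z by (auto simp: r_def)
  then have m2: "m \<ge> 2" by (simp add: m_def)
  have rs: "r (Suc k) \<in> nb E (r k)" "r (Suc (Suc k)) \<noteq> r k" for k
    using wlk_step[OF zw] by (simp_all add: r_def)
  let ?x = "r m" and ?y = "r (m - 1)"
  have xy: "?y \<in> nb E ?x" using rs(1)[of "m - 1"] nb_sym m2 by fastforce
  \<comment> \<open>Inner vertices of the thread offer a single way on, so the walk started from the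
    far end undoes \<open>r\<close>.\<close>
  have retrace: "wlk ?x ?y k = r (m - k) \<and> wlk ?x ?y (Suc k) = r (m - Suc k)" if "Suc k \<le> m" for k
    using that
  proof (induction k)
    case (Suc k)
    obtain l where l: "m = Suc (Suc (k + l))" using Suc.prems by (metis add_Suc less_eqE)
    then have IH: "wlk ?x ?y k = r (Suc (Suc l))" "wlk ?x ?y (Suc k) = r (Suc l)" using Suc by auto
    have d: "card (nb E (r (Suc l))) = 2" using m(2) l by simp
    have "nb E (r (Suc l)) = {r (Suc (Suc l)), wlk ?x ?y (Suc (Suc k))}"
      using wlk_nb_2[OF xy, of k] IH d by simp
    moreover have "r l \<in> nb E (r (Suc l))" "r l \<noteq> r (Suc (Suc l))"
      using rs[of l] nb_sym by (metis, metis)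
    ultimately have "wlk ?x ?y (Suc (Suc k)) = r l" by auto
    then show ?case using IH l by simp
  qed simp
  have retrace': "wlk ?x ?y k = r (m - k)" if "k \<le> m" for k
    using retrace[of k] retrace[of "m - 1"] that m2 by (cases "k = m") auto
  let ?j = "m - 1"
  have "m - 1 \<le> thread_len ?x ?y"
  proof (rule ccontr)
    assume *: "\<not> ?thesis"
    let ?t = "thread_len ?x ?y"
    have "wlk ?x ?y (Suc ?t) = r (m - Suc ?t)" using * by (intro retrace') simp
    moreover have "card (nb E (r (m - Suc ?t))) = 2" using * by (intro m(2)) auto
    ultimately show False using thread_len(2)[OF xy] by simp
  qed
  moreover have "wlk ?x ?y (m - 1) = z" "wlk ?x ?y (Suc (m - 1)) = w"
    using retrace'[of "m - 1"] retrace'[of m] m2 by (simp_all add: r_def)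
  ultimately show ?thesis using xy m(1) m2 by (intro exI[of _ ?x] exI[of _ ?y] exI[of _ "m - 1"]) auto
qed

text \<open>The arcs \<open>(z, w)\<close> with \<open>z\<close> of degree 2 are counted in two
  ways: two for each \<open>z\<close>, and at most one for each position on a thread that is
  traversed away from a vertex of degree 3 or 4.\<close>

lemma no_minimal_counterexample: False
proof -
  define N where "N d = {v \<in> V. card (nb E v) = d}" for d
  have fN: "finite (N d)" for d using finV by (simp add: N_def)
  have "V = N 2 \<union> (N 3 \<union> N 4)"
  proof
    show "V \<subseteq> N 2 \<union> (N 3 \<union> N 4)"
    proof
      fix v assume "v \<in> V"
      then have "card (nb E v) \<in> {2, 3, 4}" using deg_ge_2[of v] deg_le[of v] by auto
      then show "v \<in> N 2 \<union> (N 3 \<union> N 4)" using \<open>v \<in> V\<close> by (auto simp: N_def)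
    qed
  qed (auto simp: N_def)
  moreover have disj: "N 2 \<inter> (N 3 \<union> N 4) = {}" "N 3 \<inter> N 4 = {}" by (auto simp: N_def)
  ultimately have sumV: "sum h V = sum h (N 2) + (sum h (N 3) + sum h (N 4))" for h :: "'a \<Rightarrow> nat"
    using fN by (simp add: sum.union_disjoint)
  have deg: "(\<Sum>v\<in>N d. card (nb E v)) = d * card (N d)" for d
  proof -
    have "(\<Sum>v\<in>N d. card (nb E v)) = (\<Sum>v\<in>N d. d)" by (rule sum.cong) (auto simp: N_def)
    then show ?thesis by simp
  qed
  have "2 * card E = 2 * card (N 2) + (3 * card (N 3) + 4 * card (N 4))"
    using handshake[OF sg] sumV[of "\<lambda>v. card (nb E v)"] deg by simp
  moreover have "card V = card (N 2) + (card (N 3) + card (N 4))" using sumV[of "\<lambda>_. 1"] by simp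
  \<comment> \<open>This is 26 e < 28 v with each vertex of degree d contributing 13 d - 28.\<close>
  moreover have "11 * c + 24 * d < 2 * b" if "2 * e = 2 * b + (3 * c + 4 * d)" "v = b + (c + d)" "13 * e < 14 * v"
    for b c d e v :: nat using that by linarith
  ultimately have lt: "11 * card (N 3) + 24 * card (N 4) < 2 * card (N 2)"
    using sparse[OF V_nonempty] by blast
  let ?D = "SIGMA z:N 2. nb E z"
  let ?T = "SIGMA x:N 3 \<union> N 4. SIGMA y:nb E x. {1..thread_len x y}"
  let ?g = "\<lambda>(x, y, j). (wlk x y j, wlk x y (Suc j))"
  have "card ?D = 2 * card (N 2)" using deg[of 2] fN fin_nb by (simp add: card_SigmaI)
  moreover have "?D \<subseteq> ?g ` ?T"
  proof
    fix zw assume "zw \<in> ?D"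
    then obtain z w where zw: "zw = (z, w)" "card (nb E z) = 2" "w \<in> nb E z" by (auto simp: N_def)
    then obtain x y j where *: "y \<in> nb E x" "card (nb E x) \<noteq> 2" "1 \<le> j" "j \<le> thread_len x y"
      "wlk x y j = z" "wlk x y (Suc j) = w" using thread_origin by metis
    have "x \<in> V" using *(1) nb_sym nb_V by (metis subsetD)
    then have "x \<in> N 3 \<union> N 4" using *(2) deg_ge_2[of x] deg_le[of x] by (auto simp: N_def)
    then show "zw \<in> ?g ` ?T" using * zw by (intro image_eqI[of _ _ "(x, y, j)"]) auto
  qed
  moreover have fT: "finite ?T" using fN fin_nb by (intro finite_SigmaI) auto
  ultimately have "2 * card (N 2) \<le> card ?T"
    using card_mono[of "?g ` ?T" ?D] card_image_le[OF fT, of ?g] by simp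
  also have "card ?T = (\<Sum>x\<in>N 3 \<union> N 4. \<Sum>y\<in>nb E x. thread_len x y)"
    using fN fin_nb by (simp add: card_SigmaI)
  also have "\<dots> = (\<Sum>x\<in>N 3. \<Sum>y\<in>nb E x. thread_len x y) + (\<Sum>x\<in>N 4. \<Sum>y\<in>nb E x. thread_len x y)"
    using fN disj by (simp add: sum.union_disjoint)
  also have "\<dots> \<le> (\<Sum>x\<in>N 3. 11) + (\<Sum>x\<in>N 4. 24)"
    by (intro add_mono sum_mono sum_thread_len_3 sum_thread_len_4) (auto simp: N_def)
  finally show False using lt by simp
qed

end

section \<open>From the minimal counterexample to the edge-colouring\<close>

lemma is_cycle_mono: "is_cycle F vs \<Longrightarrow> F \<subseteq> E \<Longrightarrow> is_cycle E vs"
  unfolding is_cycle_def by blast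

text \<open>Density is assumed for all subgraphs so that it passes to \<open>del X E\<close> in the
  induction on the number of vertices.\<close>

theorem odd_hom_exists:
  assumes "simple_graph V E" "\<And>v. card (nb E v) \<le> 4" "\<And>vs. is_cycle E vs \<Longrightarrow> length vs \<ge> 7"
    and "\<And>W F. subgraph W F V E \<Longrightarrow> W \<noteq> {} \<Longrightarrow> 13 * card F < 14 * card W"
  shows "\<exists>\<phi>. odd_hom E \<phi>"
  using assms
proof (induction "card V" arbitrary: V E rule: less_induct)
  case less
  show ?case
  proof (rule ccontr)
    assume no: "\<not> ?thesis"
    interpret minimal_counterexample V E
    proof
      show "13 * card E < 14 * card V" if "V \<noteq> {}"
        using less.prems(1) that by (intro less.prems(4)) (auto simp: subgraph_def)
      show "\<exists>\<phi>. odd_hom (del X E) \<phi>" if X: "X \<noteq> {}" "X \<subseteq> V" for X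
      proof (rule less.hyps)
        have sub: "del X E \<subseteq> E" by (auto simp: del_def)
        show "card (V - X) < card V"
          using X simple_graph_finite(1)[OF less.prems(1)] by (intro psubset_card_mono) auto
        show "simple_graph (V - X) (del X E)" using less.prems(1) by (rule simple_graph_del)
        show "card (nb (del X E) v) \<le> 4" for v
        proof -
          have "nb (del X E) v \<subseteq> nb E v" using sub by (auto simp: nb_def)
          then show ?thesis
            using card_mono simple_graph_finite(3)[OF less.prems(1)] less.prems(2) le_trans by metis
        qed
        show "7 \<le> length vs" if "is_cycle (del X E) vs" for vs
          using less.prems(3) is_cycle_mono[OF that sub] .
        show "13 * card F < 14 * card W" if "subgraph W F (V - X) (del X E)" "W \<noteq> {}" for W F
          using that sub by (intro less.prems(4)) (auto simp: subgraph_def)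
      qed
    qed (use less.prems no in auto)
    show False by (rule no_minimal_counterexample)
  qed
qed

text \<open>At each vertex v the colour of an edge determines the triple of its other end, so local
  injectivity separates adjacent edges. For edges joined by uv, a common colour avoids the triples
  of both u and v, hence is the colour of uv itself, and adjacent edges have already been
  separated.\<close>

lemma strong_chromatic_index_le_7:
  assumes sg: "simple_graph V E" and \<phi>: "odd_hom E \<phi>"
  shows "strong_chromatic_index E \<le> 7"
proof -
  define \<kappa> where "\<kappa> e = (SOME s :: 7. s \<notin> \<Union> (\<phi> ` e))" for e
  have arc: "odd_arc (\<phi> v) (\<phi> w)" if "{v, w} \<in> E" for v w
    using \<phi> that by (auto simp: odd_hom_def odd_arc_def nb_def)
  have \<kappa>_eq: "\<phi> w = - \<phi> v - {\<kappa> {v, w}}" "\<kappa> {v, w} \<notin> \<phi> v" if e: "{v, w} \<in> E" for v w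
  proof -
    obtain s where s: "s \<notin> \<phi> v" "\<phi> w = - \<phi> v - {s}" using odd_arc_missing[OF arc[OF e]] .
    \<comment> \<open>Two disjoint triples miss exactly one point, so the choice in
      \<open>\<kappa>\<close> is forced on edges.\<close>
    have "(t \<notin> \<Union> (\<phi> ` {v, w})) = (t = s)" for t using s by auto
    then have "\<kappa> {v, w} = s" unfolding \<kappa>_def by simp
    then show "\<phi> w = - \<phi> v - {\<kappa> {v, w}}" "\<kappa> {v, w} \<notin> \<phi> v" using s by auto
  qed
  have adj: "\<kappa> {v, w} \<noteq> \<kappa> {v, x}" if "{v, w} \<in> E" "{v, x} \<in> E" "w \<noteq> x" for v w x
  proof
    assume "\<kappa> {v, w} = \<kappa> {v, x}"
    then have "\<phi> w = \<phi> x" using \<kappa>_eq(1)[OF that(1)] \<kappa>_eq(1)[OF that(2)] by simp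
    then show False using \<phi> that by (auto simp: odd_hom_def inj_on_def nb_def)
  qed
  have far: "\<kappa> {u, w} \<noteq> \<kappa> {v, x}" if "{u, v} \<in> E" "{u, w} \<in> E" "{v, x} \<in> E" "{u, w} \<noteq> {v, x}" for u v w x
  proof
    assume eq: "\<kappa> {u, w} = \<kappa> {v, x}"
    have "\<kappa> {u, w} \<notin> \<phi> u" "\<kappa> {v, x} \<notin> \<phi> v" using \<kappa>_eq(2) that by auto
    then have "\<kappa> {u, w} = \<kappa> {u, v}" "\<kappa> {v, x} = \<kappa> {u, v}"
      using eq \<kappa>_eq(1)[OF that(1)] by auto
    then have "w = v" "x = u"
      using adj[of u w v] adj[of v x u] that by (auto simp: insert_commute)
    then show False using that by (auto simp: insert_commute)
  qed
  obtain h :: "7 \<Rightarrow> nat" where h: "bij_betw h UNIV {..<7}"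
    using finite_same_card_bij[of "UNIV :: 7 set" "{..<7::nat}"] by auto
  define c where "c e = h (\<kappa> e)" for e
  have "strong_edge_coloring E c"
    unfolding strong_edge_coloring_def
  proof (intro ballI impI)
    fix e f assume e: "e \<in> E" and f: "f \<in> E" and ef: "e \<noteq> f \<and> (e \<inter> f \<noteq> {} \<or> (\<exists>u\<in>e. \<exists>v\<in>f. {u, v} \<in> E))"
    have rep: "\<exists>x. g = {v, x}" if "g \<in> E" "v \<in> g" for g v
      using simple_graph_edge_obtain[OF sg that(1)] that(2) by (metis insert_commute insert_iff singletonD)
    have "\<kappa> e \<noteq> \<kappa> f"
    proof (cases "e \<inter> f = {}")
      case False
      then obtain v where "v \<in> e" "v \<in> f" by blast
      then obtain w x where "e = {v, w}" "f = {v, x}" using rep e f by meson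
      then show ?thesis using adj[of v w x] e f ef by auto
    next
      case True
      then obtain u v where uv: "u \<in> e" "v \<in> f" "{u, v} \<in> E" using ef by blast
      then obtain w x where "e = {u, w}" "f = {v, x}" using rep e f by meson
      then show ?thesis using far[OF uv(3), of w x] e f ef by simp
    qed
    then show "c e \<noteq> c f" using h by (auto simp: c_def bij_betw_def inj_on_def)
  qed
  moreover have "c ` E \<subseteq> {..<7}" using h by (auto simp: c_def bij_betw_def)
  ultimately show ?thesis unfolding strong_chromatic_index_def by (intro Least_le) blast
qed

section \<open>Sparsity of planar graphs\<close>

fun path_edges :: "'a list \<Rightarrow> 'a set set" where
  "path_edges (x # y # zs) = insert {x, y} (path_edges (y # zs))"
| "path_edges _ = {}"

definition cycle_edges :: "'a list \<Rightarrow> 'a set set" where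
  "cycle_edges vs = path_edges (vs @ [hd vs])"

lemma path_edges_nth: "path_edges xs = {{xs ! i, xs ! Suc i} | i. Suc i < length xs}"
proof (induction xs rule: path_edges.induct)
  case (1 x y zs)
  have "{{(x # y # zs) ! i, (x # y # zs) ! Suc i} | i. Suc i < length (x # y # zs)} =
    insert {x, y} {{(y # zs) ! i, (y # zs) ! Suc i} | i. Suc i < length (y # zs)}" (is "?A = insert _ ?B")
  proof
    show "?A \<subseteq> insert {x, y} ?B"
    proof
      fix e assume "e \<in> ?A"
      then obtain i where "e = {(x # y # zs) ! i, (x # y # zs) ! Suc i}" "Suc i < length (x # y # zs)"
        by blast
      then show "e \<in> insert {x, y} ?B" by (cases i) auto
    qed
    show "insert {x, y} ?B \<subseteq> ?A"
    proof
      fix e assume "e \<in> insert {x, y} ?B"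
      then show "e \<in> ?A"
      proof
        assume "e = {x, y}"
        then show ?thesis by (intro CollectI exI[of _ 0]) simp
      next
        assume "e \<in> ?B"
        then obtain i where "e = {(y # zs) ! i, (y # zs) ! Suc i}" "Suc i < length (y # zs)"
          by blast
        then show ?thesis by (intro CollectI exI[of _ "Suc i"]) simp
      qed
    qed
  qed
  then show ?case using 1 by simp
qed auto

lemma path_edges_Cons: "xs \<noteq> [] \<Longrightarrow> path_edges (x # xs) = insert {x, hd xs} (path_edges xs)"
  by (cases xs) auto

lemma path_edges_append: "path_edges (xs @ y # ys) = path_edges (xs @ [y]) \<union> path_edges (y # ys)"
proof (induction xs)
  case (Cons x xs)
  have "hd (xs @ y # ys) = hd (xs @ [y])" by (cases xs) auto
  then show ?case using Cons by (simp add: path_edges_Cons)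
qed simp

lemma path_edges_rev: "path_edges (rev xs) = path_edges xs"
proof (induction xs rule: path_edges.induct)
  case (1 x y zs)
  then show ?case
    using path_edges_append[of "rev zs" y "[x]"] by (auto simp: insert_commute)
qed auto

lemma path_edges_subset: "e \<in> path_edges xs \<Longrightarrow> e \<subseteq> set xs"
  by (induction xs rule: path_edges.induct) auto

lemma finite_path_edges: "finite (path_edges xs)"
  by (induction xs rule: path_edges.induct) auto

lemma card_path_edges: "distinct xs \<Longrightarrow> card (path_edges xs) = length xs - 1"
proof (induction xs rule: path_edges.induct)
  case (1 x y zs)
  then have "{x, y} \<notin> path_edges (y # zs)" using path_edges_subset[of "{x, y}" "y # zs"] by auto
  then show ?case using 1 by (simp add: finite_path_edges)
qed auto

lemma path_edges_ends:
  assumes "distinct (a # ys @ [b])" "{a, b} \<in> path_edges (a # ys @ [b])"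
  shows "ys = []"
proof (cases ys)
  case (Cons y zs)
  then have "{a, b} = {a, y} \<or> {a, b} \<in> path_edges (y # zs @ [b])" using assms by simp
  moreover have "{a, b} \<noteq> {a, y}" using assms Cons by (auto simp: doubleton_eq_iff)
  moreover have "{a, b} \<notin> path_edges (y # zs @ [b])"
    using assms Cons path_edges_subset[of "{a, b}" "y # zs @ [b]"] by auto
  ultimately show ?thesis by blast
qed simp

lemma path_edges_Union: "2 \<le> length xs \<Longrightarrow> \<Union> (path_edges xs) = set xs"
proof (induction xs rule: path_edges.induct)
  case (1 x y zs)
  then show ?case by (cases zs) auto
qed auto

lemma is_cycle_iff: "is_cycle E vs \<longleftrightarrow> 3 \<le> length vs \<and> distinct vs \<and> cycle_edges vs \<subseteq> E"
proof (cases "vs = []")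
  case False
  have "cycle_edges vs = path_edges vs \<union> {{last vs, hd vs}}"
    using path_edges_append[of "butlast vs" "last vs" "[hd vs]"] append_butlast_last_id[OF False]
    by (metis Un_insert_right append.assoc append_Cons append_Nil cycle_edges_def path_edges.simps(1,3) sup_bot_right)
  then have "cycle_edges vs \<subseteq> E \<longleftrightarrow> (\<forall>i. Suc i < length vs \<longrightarrow> {vs ! i, vs ! Suc i} \<in> E) \<and> {last vs, hd vs} \<in> E"
    by (auto simp: path_edges_nth)
  then show ?thesis by (auto simp: is_cycle_def)
qed (simp add: is_cycle_def)

lemma cycle_edges_rotate: "cycle_edges (us @ a # ws) = cycle_edges (a # ws @ us)"
proof (cases us)
  case (Cons h us')
  have "cycle_edges (us @ a # ws) = path_edges (h # us' @ [a]) \<union> path_edges (a # ws @ [h])"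
    using path_edges_append[of "h # us'" a "ws @ [h]"] by (simp add: Cons cycle_edges_def)
  moreover have "cycle_edges (a # ws @ us) = path_edges (a # ws @ [h]) \<union> path_edges (h # us' @ [a])"
    using path_edges_append[of "a # ws" h "us' @ [a]"] by (simp add: Cons cycle_edges_def)
  ultimately show ?thesis by blast
qed simp

lemma cycle_edges_two_paths:
  "cycle_edges (a # xs @ b # rev ys) = path_edges (a # xs @ [b]) \<union> path_edges (a # ys @ [b])"
  using path_edges_append[of "a # xs" b "rev ys @ [a]"] path_edges_rev[of "a # ys @ [b]"]
  by (simp add: cycle_edges_def)

text \<open>The list is rotated to start at \<open>a\<close> and cut at \<open>b\<close>; the second
  piece is reversed so that both paths run from \<open>a\<close> to \<open>b\<close>.\<close>

lemma cycle_split: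
  assumes "distinct vs" "a \<in> set vs" "b \<in> set vs" "a \<noteq> b"
  obtains xs ys where "distinct (a # b # xs @ ys)" "set vs = insert a (insert b (set xs \<union> set ys))"
    "length vs = length xs + length ys + 2"
    "cycle_edges vs = path_edges (a # xs @ [b]) \<union> path_edges (a # ys @ [b])"
proof -
  obtain us ws where vs: "vs = us @ a # ws" using assms(2) by (meson split_list)
  then have "b \<in> set (ws @ us)" using assms by auto
  then obtain xs zs where b: "ws @ us = xs @ b # zs" by (meson split_list)
  have "cycle_edges vs = cycle_edges (a # xs @ b # rev (rev zs))"
    using cycle_edges_rotate[of us a ws] b by (simp add: vs)
  then have "cycle_edges vs = path_edges (a # xs @ [b]) \<union> path_edges (a # rev zs @ [b])"
    by (simp only: cycle_edges_two_paths)
  moreover have "distinct (a # ws @ us)" "set vs = insert a (set (ws @ us))"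
    "length vs = Suc (length (ws @ us))"
    using assms vs by auto
  then have "distinct (a # b # xs @ rev zs)" "set vs = insert a (insert b (set xs \<union> set (rev zs)))"
    "length vs = length xs + length (rev zs) + 2"
    unfolding b by auto
  ultimately show ?thesis using that by blast
qed

text \<open>A common edge would have both ends in \<open>{a, b}\<close>, and a path from
  \<open>a\<close> to \<open>b\<close> that contains this edge has no inner vertex.\<close>

lemma path_edges_disjoint:
  assumes "distinct (a # b # xs @ ys)" "xs \<noteq> [] \<or> ys \<noteq> []"
  shows "path_edges (a # xs @ [b]) \<inter> path_edges (a # ys @ [b]) = {}"
proof -
  have card2: "card e = 2" if "e \<in> path_edges zs" "distinct zs" for e :: "'a set" and zs
    using that by (induction zs rule: path_edges.induct) auto
  have False if e: "e \<in> path_edges (a # xs @ [b])" "e \<in> path_edges (a # ys @ [b])" for e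
  proof -
    have "e \<subseteq> set (a # xs @ [b])" "e \<subseteq> set (a # ys @ [b])" using e path_edges_subset by blast+
    then have "e \<subseteq> {a, b}" using assms(1) by auto
    moreover have "card e = 2" using card2[OF e(1)] assms by auto
    moreover have "card {a, b} = 2" using assms by auto
    ultimately have "e = {a, b}" using card_subset_eq[of "{a, b}" e] by simp
    then have "xs = []" "ys = []"
      using path_edges_ends[of a xs b] path_edges_ends[of a ys b] e assms by auto
    then show False using assms by simp
  qed
  then show ?thesis by blast
qed

lemma card_cycle_edges:
  assumes "distinct vs" "3 \<le> length vs"
  shows "card (cycle_edges vs) = length vs"
proof -
  obtain a b zs where vs: "vs = a # b # zs" using assms by (cases vs; cases "tl vs") auto
  have pre: "distinct vs" "a \<in> set vs" "b \<in> set vs" "a \<noteq> b" using assms vs by auto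
  obtain xs ys where *: "distinct (a # b # xs @ ys)" "set vs = insert a (insert b (set xs \<union> set ys))"
    "length vs = length xs + length ys + 2"
    "cycle_edges vs = path_edges (a # xs @ [b]) \<union> path_edges (a # ys @ [b])"
    by (rule cycle_split[OF pre])
  then have "xs \<noteq> [] \<or> ys \<noteq> []" using assms by auto
  then show ?thesis
    using * card_path_edges[of "a # xs @ [b]"] card_path_edges[of "a # ys @ [b]"]
    by (simp add: card_Un_disjoint path_edges_disjoint finite_path_edges)
qed

lemma cycle_edges_Union: "3 \<le> length vs \<Longrightarrow> \<Union> (cycle_edges vs) = set vs"
  unfolding cycle_edges_def by (subst path_edges_Union) (cases vs; auto)+

text \<open>When the next vertex has been visited before, the path is cut back to that visit, which
  keeps it simple.\<close>

lemma rtrancl_path: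
  assumes "(x, y) \<in> r\<^sup>*"
  obtains xs where "distinct xs" "xs \<noteq> []" "hd xs = x" "last xs = y" "set xs \<subseteq> {z. (x, z) \<in> r\<^sup>*}"
    "\<And>e. e \<in> path_edges xs \<Longrightarrow> \<exists>u v. e = {u, v} \<and> (u, v) \<in> r"
proof -
  from assms have "\<exists>xs. distinct xs \<and> xs \<noteq> [] \<and> hd xs = x \<and> last xs = y \<and> set xs \<subseteq> {z. (x, z) \<in> r\<^sup>*} \<and>
    (\<forall>e\<in>path_edges xs. \<exists>u v. e = {u, v} \<and> (u, v) \<in> r)"
  proof (induction rule: rtrancl_induct)
    case base
    show ?case by (intro exI[of _ "[x]"]) auto
  next
    case (step y z)
    then obtain xs where xs: "distinct xs" "xs \<noteq> []" "hd xs = x" "last xs = y" "set xs \<subseteq> {z. (x, z) \<in> r\<^sup>*}"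
      "\<forall>e\<in>path_edges xs. \<exists>u v. e = {u, v} \<and> (u, v) \<in> r" by blast
    show ?case
    proof (cases "z \<in> set xs")
      case True
      then obtain as bs where ab: "xs = as @ z # bs" by (meson split_list)
      have "hd (as @ [z]) = x" using xs ab by (cases as) auto
      moreover have "path_edges (as @ [z]) \<subseteq> path_edges xs" using path_edges_append[of as z bs] ab by auto
      ultimately show ?thesis using xs ab by (intro exI[of _ "as @ [z]"]) auto
    next
      case False
      have "path_edges (xs @ [z]) = path_edges xs \<union> {{y, z}}"
        using path_edges_append[of "butlast xs" y "[z]"] xs by (metis append.assoc append_Cons append_Nil
            append_butlast_last_id path_edges.simps(1,3))
      then show ?thesis using xs False step
        by (intro exI[of _ "xs @ [z]"]) (auto intro: rtrancl_into_rtrancl)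
    qed
  qed
  then show ?thesis using that by blast
qed

section \<open>Curves traced by paths and cycles of a drawing\<close>

definition edge_img :: "('a set \<Rightarrow> real \<Rightarrow> complex) \<Rightarrow> 'a set set \<Rightarrow> complex set" where
  "edge_img \<gamma> F = (\<Union>e\<in>F. path_image (\<gamma> e))"

text \<open>Without its ends the curve of an edge is connected and meets no other edge, so off a
  cycle it lies on one side of that cycle.\<close>

definition open_arc :: "('a \<Rightarrow> complex) \<Rightarrow> ('a set \<Rightarrow> real \<Rightarrow> complex) \<Rightarrow> 'a set \<Rightarrow> complex set" where
  "open_arc p \<gamma> e = path_image (\<gamma> e) - p ` e"

lemma plane_drawing_mono:
  assumes "plane_drawing V E p \<gamma>" "W \<subseteq> V" "F \<subseteq> E"
  shows "plane_drawing W F p \<gamma>"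
proof -
  have "inj_on p W" using assms by (auto simp: plane_drawing_def intro: inj_on_subset)
  moreover have "path_image (\<gamma> e) \<inter> p ` W \<subseteq> path_image (\<gamma> e) \<inter> p ` V" for e using assms by blast
  ultimately show ?thesis using assms unfolding plane_drawing_def by (meson subset_iff)
qed

context
  fixes V :: "'a set" and E :: "'a set set" and p :: "'a \<Rightarrow> complex" and \<gamma> :: "'a set \<Rightarrow> real \<Rightarrow> complex"
  assumes draw: "plane_drawing V E p \<gamma>" and sg: "simple_graph V E"
begin

lemma edge_arc: "e \<in> E \<Longrightarrow> arc (\<gamma> e)" "e \<in> E \<Longrightarrow> {pathstart (\<gamma> e), pathfinish (\<gamma> e)} = p ` e"
  using draw by (auto simp: plane_drawing_def)

lemma vertices_in_img: "e \<in> E \<Longrightarrow> p ` e \<subseteq> path_image (\<gamma> e)"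
  using edge_arc(2)[of e] pathstart_in_path_image[of "\<gamma> e"] pathfinish_in_path_image[of "\<gamma> e"]
  by (metis empty_subsetI insert_subset)

lemma edges_Int: "e \<in> E \<Longrightarrow> f \<in> E \<Longrightarrow> e \<noteq> f \<Longrightarrow> path_image (\<gamma> e) \<inter> path_image (\<gamma> f) \<subseteq> p ` (e \<inter> f)"
  using draw unfolding plane_drawing_def by blast

lemma vertex_on_edge:
  assumes "v \<in> V" "e \<in> E" "p v \<in> path_image (\<gamma> e)"
  shows "v \<in> e"
proof -
  have "p v \<in> p ` e" "inj_on p V" using assms draw unfolding plane_drawing_def by blast+
  moreover have "e \<subseteq> V" using sg assms by (auto simp: simple_graph_def)
  ultimately show ?thesis using assms(1) by (auto simp: inj_on_def)
qed

lemma vertex_on_img: "v \<in> V \<Longrightarrow> F \<subseteq> E \<Longrightarrow> p v \<in> edge_img \<gamma> F \<Longrightarrow> v \<in> \<Union> F"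
  using vertex_on_edge unfolding edge_img_def by blast

lemma img_Int:
  assumes "F \<subseteq> E" "G \<subseteq> E" "F \<inter> G = {}"
  shows "edge_img \<gamma> F \<inter> edge_img \<gamma> G \<subseteq> p ` (\<Union> F \<inter> \<Union> G)"
proof
  fix z assume "z \<in> edge_img \<gamma> F \<inter> edge_img \<gamma> G"
  then obtain e f where ef: "e \<in> F" "f \<in> G" "z \<in> path_image (\<gamma> e) \<inter> path_image (\<gamma> f)"
    by (auto simp: edge_img_def)
  then have "z \<in> p ` (e \<inter> f)" using edges_Int[of e f] assms by blast
  then show "z \<in> p ` (\<Union> F \<inter> \<Union> G)" using ef by blast
qed

lemma open_arc_disjoint:
  assumes "e \<in> E" "F \<subseteq> E" "e \<notin> F"
  shows "open_arc p \<gamma> e \<inter> edge_img \<gamma> F = {}"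
  using img_Int[of "{e}" F] assms by (auto simp: open_arc_def edge_img_def)

lemma open_arc_connected:
  assumes "e \<in> E"
  shows "connected (open_arc p \<gamma> e)" "open_arc p \<gamma> e \<noteq> {}"
  using edge_arc[OF assms] arc_imp_simple_path[of "\<gamma> e"]
    connected_simple_path_endless[of "\<gamma> e"] nonempty_simple_path_endless[of "\<gamma> e"]
  by (simp_all add: open_arc_def)

lemma open_arc_closure:
  assumes "e \<in> E" "open_arc p \<gamma> e \<subseteq> S"
  shows "p ` e \<subseteq> closure S"
proof -
  have *: "path_image (\<gamma> e) - p ` e = \<gamma> e ` {0<..<1}"
    using edge_arc[OF assms(1)] simple_path_endless[of "\<gamma> e"] arc_imp_simple_path by metis
  have "continuous_on (closure {0<..<1::real}) (\<gamma> e)"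
    using edge_arc(1)[OF assms(1)] by (simp add: arc_def path_def)
  then have "\<gamma> e ` closure {0<..<1} \<subseteq> closure (\<gamma> e ` {0<..<1})"
    by (intro image_closure_subset closure_subset) auto
  then have "path_image (\<gamma> e) \<subseteq> closure S"
    using * assms(2) closure_mono[of "\<gamma> e ` {0<..<1}" S] unfolding open_arc_def
    by (auto simp: path_image_def)
  then show ?thesis using vertices_in_img[OF assms(1)] by blast
qed

lemma edge_arc_oriented:
  assumes "{x, y} \<in> E"
  obtains g where "arc g" "pathstart g = p x" "pathfinish g = p y" "path_image g = path_image (\<gamma> {x, y})"
proof -
  let ?g = "\<gamma> {x, y}"
  have "pathstart ?g = p x \<and> pathfinish ?g = p y \<or> pathstart ?g = p y \<and> pathfinish ?g = p x"
    using edge_arc(2)[OF assms] by (auto simp: doubleton_eq_iff)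
  then show ?thesis
    using that[of ?g] that[of "reversepath ?g"] edge_arc(1)[OF assms] by (auto simp: arc_reversepath)
qed

lemma path_arc:
  assumes "distinct xs" "2 \<le> length xs" "path_edges xs \<subseteq> E"
  obtains g where "arc g" "pathstart g = p (hd xs)" "pathfinish g = p (last xs)"
    "path_image g = edge_img \<gamma> (path_edges xs)"
proof -
  from assms have "\<exists>g. arc g \<and> pathstart g = p (hd xs) \<and> pathfinish g = p (last xs) \<and>
    path_image g = edge_img \<gamma> (path_edges xs)"
  proof (induction xs rule: path_edges.induct)
    case (1 x y zs)
    have e: "{x, y} \<in> E" using 1 by simp
    obtain g where g: "arc g" "pathstart g = p x" "pathfinish g = p y"
      "path_image g = path_image (\<gamma> {x, y})" using edge_arc_oriented[OF e] .
    show ?case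
    proof (cases "zs = []")
      case True
      then show ?thesis using g by (intro exI[of _ g]) (simp add: edge_img_def)
    next
      case False
      then obtain h where h: "arc h" "pathstart h = p y" "pathfinish h = p (last (y # zs))"
        "path_image h = edge_img \<gamma> (path_edges (y # zs))"
        using 1 by (cases zs) auto
      have "{x, y} \<notin> path_edges (y # zs)" using 1(2) path_edges_subset[of "{x, y}" "y # zs"] by auto
      then have "edge_img \<gamma> {{x, y}} \<inter> edge_img \<gamma> (path_edges (y # zs)) \<subseteq>
          p ` (\<Union> {{x, y}} \<inter> \<Union> (path_edges (y # zs)))"
        using 1(4) by (intro img_Int) auto
      moreover have "{x, y} \<inter> \<Union> (path_edges (y # zs)) \<subseteq> {y}"
        using 1(2) path_edges_subset[of _ "y # zs"] by fastforce
      ultimately have "path_image g \<inter> path_image h \<subseteq> {p y}"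
        using g(4) h(4) by (auto simp: edge_img_def)
      then have "arc (g +++ h)" using g h by (intro arc_join) auto
      moreover have "path_image (g +++ h) = edge_img \<gamma> (path_edges (x # y # zs))"
        using g h by (simp add: path_image_join edge_img_def)
      ultimately show ?thesis using g h False by (intro exI[of _ "g +++ h"]) auto
    qed
  qed auto
  then show ?thesis using that by blast
qed

lemma two_paths_img:
  assumes d: "distinct (a # b # xs @ ys)" "xs \<noteq> [] \<or> ys \<noteq> []"
    and E: "path_edges (a # xs @ [b]) \<subseteq> E" "path_edges (a # ys @ [b]) \<subseteq> E"
  shows "edge_img \<gamma> (path_edges (a # xs @ [b])) \<inter> edge_img \<gamma> (path_edges (a # ys @ [b])) = {p a, p b}"
proof
  have "\<Union> (path_edges (a # xs @ [b])) \<inter> \<Union> (path_edges (a # ys @ [b])) = {a, b}"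
    using d by (subst (1 2) path_edges_Union) auto
  then show "edge_img \<gamma> (path_edges (a # xs @ [b])) \<inter> edge_img \<gamma> (path_edges (a # ys @ [b])) \<subseteq> {p a, p b}"
    using img_Int[OF E path_edges_disjoint[OF d]] by auto
  have *: "{p a, p b} \<subseteq> edge_img \<gamma> (path_edges (a # zs @ [b]))"
    if "path_edges (a # zs @ [b]) \<subseteq> E" for zs
  proof -
    have "\<Union> (path_edges (a # zs @ [b])) = set (a # zs @ [b])" by (rule path_edges_Union) simp
    then have "a \<in> \<Union> (path_edges (a # zs @ [b]))" "b \<in> \<Union> (path_edges (a # zs @ [b]))" by auto
    then obtain e f where "e \<in> path_edges (a # zs @ [b])" "a \<in> e" "f \<in> path_edges (a # zs @ [b])" "b \<in> f"
      by blast
    then show ?thesis using vertices_in_img[of e] vertices_in_img[of f] that by (auto simp: edge_img_def)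
  qed
  show "{p a, p b} \<subseteq> edge_img \<gamma> (path_edges (a # xs @ [b])) \<inter> edge_img \<gamma> (path_edges (a # ys @ [b]))"
    using *[OF E(1)] *[OF E(2)] by blast
qed

lemma cycle_curve:
  assumes "is_cycle E vs"
  obtains c where "simple_path c" "pathfinish c = pathstart c" "path_image c = edge_img \<gamma> (cycle_edges vs)"
proof -
  have vs: "3 \<le> length vs" "distinct vs" "cycle_edges vs \<subseteq> E" using assms by (auto simp: is_cycle_iff)
  obtain a b zs where abz: "vs = a # b # zs" using vs by (cases vs; cases "tl vs") auto
  have pre: "distinct vs" "a \<in> set vs" "b \<in> set vs" "a \<noteq> b" using vs abz by auto
  obtain xs ys where *: "distinct (a # b # xs @ ys)" "set vs = insert a (insert b (set xs \<union> set ys))"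
    "length vs = length xs + length ys + 2"
    "cycle_edges vs = path_edges (a # xs @ [b]) \<union> path_edges (a # ys @ [b])"
    by (rule cycle_split[OF pre])
  then have ne: "xs \<noteq> [] \<or> ys \<noteq> []" and sub: "path_edges (a # xs @ [b]) \<subseteq> E" "path_edges (a # ys @ [b]) \<subseteq> E"
    using vs by auto
  obtain g where g: "arc g" "pathstart g = p a" "pathfinish g = p b"
    "path_image g = edge_img \<gamma> (path_edges (a # xs @ [b]))"
    using path_arc[of "a # xs @ [b]"] * sub by auto
  obtain h where h: "arc h" "pathstart h = p a" "pathfinish h = p b"
    "path_image h = edge_img \<gamma> (path_edges (a # ys @ [b]))"
    using path_arc[of "a # ys @ [b]"] * sub by auto
  have "path_image g \<inter> path_image h \<subseteq> {p a, p b}"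
    using two_paths_img[OF *(1) ne sub] g h by simp
  then have "simple_path (g +++ reversepath h)"
    using g h by (intro simple_path_join_loop) (auto simp: arc_reversepath)
  moreover have "path_image (g +++ reversepath h) = edge_img \<gamma> (cycle_edges vs)"
    using g h *(4) by (simp add: path_image_join edge_img_def)
  ultimately show ?thesis using that[of "g +++ reversepath h"] g h by simp
qed

definition side_verts :: "'a list \<Rightarrow> complex set \<Rightarrow> 'a set" where
  "side_verts vs S = set vs \<union> {v \<in> V. p v \<in> S}"

text \<open>Edges are tested by their open arcs because an edge on one side may end on the
  cycle.\<close>

definition side_edges :: "'a list \<Rightarrow> complex set \<Rightarrow> 'a set set" where
  "side_edges vs S = cycle_edges vs \<union> {e \<in> E. open_arc p \<gamma> e \<subseteq> S}"

lemma cycle_verts_subset: "is_cycle E vs \<Longrightarrow> set vs \<subseteq> V"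
  using cycle_edges_Union[of vs] sg unfolding is_cycle_iff simple_graph_def by blast

text \<open>The ends of an edge drawn in \<open>S\<close> lie in the closure of \<open>S\<close>,
  hence in \<open>S\<close> or on the cycle, where a vertex can only be one of the cycle.\<close>

lemma side_subgraph:
  assumes vs: "is_cycle E vs" and S: "closure S \<subseteq> edge_img \<gamma> (cycle_edges vs) \<union> S"
  shows "subgraph (side_verts vs S) (side_edges vs S) V E" "is_cycle (side_edges vs S) vs"
proof -
  have c: "3 \<le> length vs" "cycle_edges vs \<subseteq> E" using vs by (auto simp: is_cycle_iff)
  have V: "side_verts vs S \<subseteq> V" using cycle_verts_subset[OF vs] by (auto simp: side_verts_def)
  have E: "side_edges vs S \<subseteq> E" using c by (auto simp: side_edges_def)
  have "e \<subseteq> side_verts vs S" if "e \<in> side_edges vs S" for e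
  proof (cases "e \<in> cycle_edges vs")
    case True
    then show ?thesis using cycle_edges_Union[OF c(1)] by (auto simp: side_verts_def)
  next
    case False
    then have e: "e \<in> E" "open_arc p \<gamma> e \<subseteq> S" using that by (auto simp: side_edges_def)
    show ?thesis
    proof
      fix v assume v: "v \<in> e"
      then have vV: "v \<in> V" using e sg by (auto simp: simple_graph_def)
      have "p v \<in> edge_img \<gamma> (cycle_edges vs) \<union> S" using open_arc_closure[OF e] v S by blast
      then show "v \<in> side_verts vs S"
        using vertex_on_img[OF vV c(2)] cycle_edges_Union[OF c(1)] vV by (auto simp: side_verts_def)
    qed
  qed
  then show "subgraph (side_verts vs S) (side_edges vs S) V E"
    using simple_graph_subset[OF sg E _ V] V E by (simp add: subgraph_def)
  show "is_cycle (side_edges vs S) vs" using vs by (auto simp: is_cycle_iff side_edges_def)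
qed

lemma open_arc_in_component:
  assumes "e \<in> E" "open A" "open B" "A \<inter> B = {}" "open_arc p \<gamma> e \<subseteq> A \<union> B"
  shows "open_arc p \<gamma> e \<subseteq> A \<or> open_arc p \<gamma> e \<subseteq> B"
  using connectedD[OF open_arc_connected(1)[OF assms(1)] assms(2,3)] assms(4,5) by blast

end

section \<open>Inversion at a point inside a cycle\<close>

lemma not_in_if_inside: "x \<in> inside S \<Longrightarrow> x \<notin> S"
  by (simp add: inside_def)

text \<open>The punctured inside is connected and has an unbounded image, so it goes to the outside
  of the image curve. The image of the outside must then meet the inside of that curve, and by
  connectedness it lies there entirely.\<close>

lemma inversion_outside:
  fixes c :: "real \<Rightarrow> complex"
  assumes c: "simple_path c" "pathfinish c = pathstart c" and z0: "z0 \<in> inside (path_image c)"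
  defines "f \<equiv> \<lambda>z. inverse (z - z0)"
  shows "f ` outside (path_image c) \<subseteq> inside (f ` path_image c)"
proof -
  let ?I = "inside (path_image c)" and ?O = "outside (path_image c)" and ?C = "path_image c"
  note J = Jordan_inside_outside[OF c]
  have z0C: "z0 \<notin> ?C" "z0 \<notin> ?O" using z0 J by (auto simp: inside_def)
  have cont: "continuous_on S f" if "z0 \<notin> S" for S
    unfolding f_def using that by (intro continuous_intros) auto
  \<comment> \<open>Since \<open>inverse 0 = 0\<close>, the map is injective on the whole plane;
    only continuity fails, at \<open>z0\<close>.\<close>
  have inj: "inj f" unfolding f_def by (rule injI) simp
  have C': "path_image (f \<circ> c) = f ` ?C" by (simp add: path_image_compose)
  have "simple_path (f \<circ> c)"
    using c(1) z0C inj unfolding simple_path_def loop_free_def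
    by (auto simp: path_continuous_image cont injD path_image_def)
  moreover have "pathfinish (f \<circ> c) = pathstart (f \<circ> c)" using c(2) by (simp add: pathfinish_compose pathstart_compose)
  ultimately have J': "inside (f ` ?C) \<noteq> {}" "open (inside (f ` ?C))" "open (outside (f ` ?C))"
    "bounded (inside (f ` ?C))" "inside (f ` ?C) \<inter> outside (f ` ?C) = {}"
    "inside (f ` ?C) \<union> outside (f ` ?C) = - f ` ?C"
    using Jordan_inside_outside[of "f \<circ> c"] C' by auto
  have split: "f ` S \<subseteq> inside (f ` ?C) \<or> f ` S \<subseteq> outside (f ` ?C)"
    if S: "connected S" "z0 \<notin> S" "S \<inter> ?C = {}" for S
  proof -
    have "connected (f ` S)" using S cont by (intro connected_continuous_image) auto
    moreover have "f ` S \<subseteq> inside (f ` ?C) \<union> outside (f ` ?C)"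
      using J'(6) S(3) inj by (auto simp: inj_def)
    ultimately show ?thesis
      using connectedD[OF _ J'(2,3)] J'(5) by blast
  qed
  have "\<not> bounded (f ` (?I - {z0}))"
  proof
    assume "bounded (f ` (?I - {z0}))"
    then obtain B where B: "B > 0" "\<And>z. z \<in> ?I - {z0} \<Longrightarrow> norm (f z) \<le> B"
      by (auto simp: bounded_pos)
    obtain d where d: "d > 0" "ball z0 d \<subseteq> ?I" using J z0 by (meson openE)
    define r where "r = min (d / 2) (1 / (2 * B))"
    have r: "r > 0" "r < d" "r \<le> 1 / (2 * B)" using d B by (auto simp: r_def min_def)
    have "z0 + of_real r \<in> ?I - {z0}" using r d by (auto simp: dist_norm subset_iff)
    then have "norm (f (z0 + of_real r)) \<le> B" by (rule B)
    then have "inverse r \<le> B" using r by (simp add: f_def norm_inverse)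
    then have "1 \<le> B * r" using r by (simp add: field_simps)
    moreover have "B * r \<le> B * (1 / (2 * B))" using r B by (intro mult_left_mono) auto
    ultimately show False using B by simp
  qed
  moreover have "connected (?I - {z0})" using J by (intro connected_open_delete) auto
  then have "f ` (?I - {z0}) \<subseteq> inside (f ` ?C) \<or> f ` (?I - {z0}) \<subseteq> outside (f ` ?C)"
    by (intro split) (auto dest: not_in_if_inside)
  ultimately have fI: "f ` (?I - {z0}) \<subseteq> outside (f ` ?C)" using J'(4) bounded_subset by blast
  \<comment> \<open>The point 0 stands for infinity: apart from the default value at
    \<open>z0\<close>, nothing is sent to it.\<close>
  have cover: "inside (f ` ?C) - {0} \<subseteq> f ` ?O \<union> f ` (?I - {z0})"
  proof
    fix w assume w: "w \<in> inside (f ` ?C) - {0}"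
    define z where "z = z0 + inverse w"
    have fz: "f z = w" by (simp add: f_def z_def)
    have "z \<notin> ?C" using w fz not_in_if_inside[of w "f ` ?C"] by auto
    moreover have "z \<noteq> z0" using w by (simp add: z_def)
    ultimately show "w \<in> f ` ?O \<union> f ` (?I - {z0})" using fz J by blast
  qed
  have "inside (f ` ?C) - {0} \<noteq> {}"
  proof
    assume "inside (f ` ?C) - {0} = {}"
    then have "inside (f ` ?C) \<subseteq> {0}" by blast
    then have "finite (inside (f ` ?C))" by (rule finite_subset) simp
    then show False using J'(1,2) finite_imp_not_open by blast
  qed
  then obtain w where w: "w \<in> inside (f ` ?C)" "w \<in> f ` ?O \<union> f ` (?I - {z0})" using cover by blast
  then have "w \<notin> f ` (?I - {z0})" using fI J'(5) by blast
  then have "f ` ?O \<inter> inside (f ` ?C) \<noteq> {}" using w by blast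
  moreover have "f ` ?O \<subseteq> inside (f ` ?C) \<or> f ` ?O \<subseteq> outside (f ` ?C)"
    using J z0C by (intro split) (auto simp: outside_def)
  ultimately show ?thesis using J'(5) by blast
qed

lemma plane_drawing_inversion:
  assumes draw: "plane_drawing W F p \<gamma>" and z0: "\<And>v. v \<in> W \<Longrightarrow> z0 \<noteq> p v"
    "\<And>e. e \<in> F \<Longrightarrow> z0 \<notin> path_image (\<gamma> e)"
  defines "f \<equiv> \<lambda>z. inverse (z - z0)"
  shows "plane_drawing W F (f \<circ> p) (\<lambda>e. f \<circ> \<gamma> e)"
proof -
  have inj: "inj f" unfolding f_def by (rule injI) simp
  have img: "path_image (f \<circ> \<gamma> e) = f ` path_image (\<gamma> e)" for e by (simp add: path_image_compose)
  have arc: "arc (f \<circ> \<gamma> e)" if "e \<in> F" for e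
  proof -
    have "arc (\<gamma> e)" using draw that by (simp add: plane_drawing_def)
    moreover have "continuous_on (path_image (\<gamma> e)) f"
      unfolding f_def using z0(2)[OF that] by (intro continuous_intros) auto
    ultimately show ?thesis
      using inj unfolding arc_def by (auto intro!: path_continuous_image comp_inj_on inj_on_subset[OF inj])
  qed
  show ?thesis
    unfolding plane_drawing_def
  proof (intro conjI ballI impI)
    show "inj_on (f \<circ> p) W" using draw inj by (auto simp: plane_drawing_def inj_on_def inj_def)
    show "arc (f \<circ> \<gamma> e)" if "e \<in> F" for e using arc that .
    show "{pathstart (f \<circ> \<gamma> e), pathfinish (f \<circ> \<gamma> e)} = (f \<circ> p) ` e" if "e \<in> F" for e
    proof -
      have "{pathstart (\<gamma> e), pathfinish (\<gamma> e)} = p ` e" using draw that by (simp add: plane_drawing_def)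
      then have "f ` {pathstart (\<gamma> e), pathfinish (\<gamma> e)} = f ` p ` e" by simp
      then show ?thesis by (simp add: pathstart_compose pathfinish_compose image_comp)
    qed
    show "path_image (f \<circ> \<gamma> e) \<inter> (f \<circ> p) ` W \<subseteq> (f \<circ> p) ` e" if "e \<in> F" for e
    proof -
      have "path_image (\<gamma> e) \<inter> p ` W \<subseteq> p ` e" using draw that by (simp add: plane_drawing_def)
      then have "f ` (path_image (\<gamma> e) \<inter> p ` W) \<subseteq> f ` p ` e" by blast
      then show ?thesis unfolding img image_comp[symmetric] image_Int[OF inj, symmetric] .
    qed
    show "path_image (f \<circ> \<gamma> e) \<inter> path_image (f \<circ> \<gamma> g) \<subseteq> (f \<circ> p) ` (e \<inter> g)"
      if "e \<in> F" "g \<in> F" "e \<noteq> g" for e g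
    proof -
      have "path_image (\<gamma> e) \<inter> path_image (\<gamma> g) \<subseteq> p ` (e \<inter> g)" using draw that by (simp add: plane_drawing_def)
      then have "f ` (path_image (\<gamma> e) \<inter> path_image (\<gamma> g)) \<subseteq> f ` p ` (e \<inter> g)" by blast
      then show ?thesis unfolding img image_comp[symmetric] image_Int[OF inj, symmetric] .
    qed
  qed
qed

section \<open>Edge bounds in a disc and in the plane\<close>

lemma subgraph_trans: "subgraph W F V' E' \<Longrightarrow> V' \<subseteq> V \<Longrightarrow> E' \<subseteq> E \<Longrightarrow> subgraph W F V E"
  by (auto simp: subgraph_def)

text \<open>Either some path through the disc joins two vertices of the cycle and cuts the disc in two, or every
  component off the cycle is attached to at most one of its vertices and can be split off.\<close>

lemma disc_bound:
  assumes "plane_drawing V E p \<gamma>" "simple_graph V E"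
    and "\<And>ws. is_cycle E ws \<Longrightarrow> 28 \<le> length ws" "is_cycle E vs"
    and "\<And>e. e \<in> E - cycle_edges vs \<Longrightarrow> open_arc p \<gamma> e \<subseteq> inside (edge_img \<gamma> (cycle_edges vs))"
    and "\<And>v. v \<in> V - set vs \<Longrightarrow> p v \<in> inside (edge_img \<gamma> (cycle_edges vs))"
    and "\<And>W F. subgraph W F V E \<Longrightarrow> W \<noteq> {} \<Longrightarrow> card W < n \<Longrightarrow> 26 * card F + 28 \<le> 28 * card W"
    and "card V \<le> n"
  shows "26 * card E + 28 + length vs \<le> 28 * card V"
  using assms
proof (induction "card V + card E" arbitrary: V E vs rule: less_induct)
  case less
  note draw = less.prems(1) and sg = less.prems(2) and g28 = less.prems(3) and cyc = less.prems(4)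
    and inE = less.prems(5) and inV = less.prems(6) and small = less.prems(7)
  let ?C = "edge_img \<gamma> (cycle_edges vs)"
  have fin: "finite V" "finite E" using simple_graph_finite[OF sg] by auto
  have vs: "3 \<le> length vs" "distinct vs" "cycle_edges vs \<subseteq> E" using cyc by (auto simp: is_cycle_iff)
  have vsV: "set vs \<subseteq> V" using cycle_verts_subset[OF draw sg cyc] .
  have inC: "open_arc p \<gamma> e \<inter> inside ?C = {}" if "e \<in> cycle_edges vs" for e
  proof -
    have "open_arc p \<gamma> e \<subseteq> ?C" using that by (auto simp: open_arc_def edge_img_def)
    then show ?thesis using not_in_if_inside by blast
  qed
  show ?case
  proof (cases "\<exists>a b xs. a \<in> set vs \<and> b \<in> set vs \<and> distinct (a # xs @ [b]) \<and> set xs \<inter> set vs = {} \<and>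
      path_edges (a # xs @ [b]) \<subseteq> E - cycle_edges vs")
    case True
    then obtain a b xs where ear: "a \<in> set vs" "b \<in> set vs" "distinct (a # xs @ [b])" "set xs \<inter> set vs = {}"
      "path_edges (a # xs @ [b]) \<subseteq> E - cycle_edges vs" by blast
    have "a \<noteq> b" using ear by auto
    obtain y1 y2 where ys: "distinct (a # b # y1 @ y2)" "set vs = insert a (insert b (set y1 \<union> set y2))"
      "length vs = length y1 + length y2 + 2"
      "cycle_edges vs = path_edges (a # y1 @ [b]) \<union> path_edges (a # y2 @ [b])"
      by (rule cycle_split[OF vs(2) ear(1,2) \<open>a \<noteq> b\<close>])
    let ?P = "path_edges (a # xs @ [b])" and ?Q1 = "path_edges (a # y1 @ [b])"
      and ?Q2 = "path_edges (a # y2 @ [b])"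
    have sub: "?P \<subseteq> E" "?Q1 \<subseteq> E" "?Q2 \<subseteq> E" using ear(5) ys(4) vs(3) by auto
    have "y1 \<noteq> [] \<or> y2 \<noteq> []" using vs(1) ys(3) by auto
    then have PQ: "?P \<inter> ?Q1 = {}" "?P \<inter> ?Q2 = {}" "?Q1 \<inter> ?Q2 = {}"
      using ear(5) ys(4) path_edges_disjoint[OF ys(1)] by auto
    \<comment> \<open>The three paths from \<open>a\<close> to \<open>b\<close> are edge-disjoint,
      so at most one of them is the single edge \<open>{a, b}\<close>, and any two of them form a
      cycle.\<close>
    have ab_edge: "zs = [] \<Longrightarrow> {a, b} \<in> path_edges (a # zs @ [b])" for zs by simp
    have ne: "xs \<noteq> [] \<or> y1 \<noteq> []" "xs \<noteq> [] \<or> y2 \<noteq> []" "y1 \<noteq> [] \<or> y2 \<noteq> []"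
      using PQ ab_edge by blast+
    have dist: "distinct (a # b # xs @ y1)" "distinct (a # b # xs @ y2)"
      using ear(3,4) ys(1,2) by auto
    obtain c where c: "arc c" "pathstart c = p a" "pathfinish c = p b" "path_image c = edge_img \<gamma> ?P"
      using path_arc[OF draw sg, of "a # xs @ [b]"] ear(3) sub(1) by auto
    obtain c1 where c1: "arc c1" "pathstart c1 = p a" "pathfinish c1 = p b" "path_image c1 = edge_img \<gamma> ?Q1"
      using path_arc[OF draw sg, of "a # y1 @ [b]"] ys(1) sub(2) by auto
    obtain c2 where c2: "arc c2" "pathstart c2 = p a" "pathfinish c2 = p b" "path_image c2 = edge_img \<gamma> ?Q2"
      using path_arc[OF draw sg, of "a # y2 @ [b]"] ys(1) sub(3) by auto
    have C: "?C = path_image c1 \<union> path_image c2" by (simp add: c1 c2 ys(4) edge_img_def)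
    have "{a, hd (xs @ [b])} \<in> ?P" by (simp add: path_edges_Cons)
    then obtain e where e: "e \<in> ?P" by blast
    then have eI: "open_arc p \<gamma> e \<subseteq> inside ?C" using inE ear(5) by blast
    have "path_image c \<inter> inside (path_image c1 \<union> path_image c2) \<noteq> {}"
    proof -
      have "open_arc p \<gamma> e \<noteq> {}" using open_arc_connected(2)[OF draw sg, of e] e sub by auto
      moreover have "open_arc p \<gamma> e \<subseteq> path_image c" using e by (auto simp: c open_arc_def edge_img_def)
      ultimately show ?thesis using eI C by auto
    qed
    moreover have "p a \<noteq> p b" using arc_distinct_ends[OF c(1)] c by simp
    moreover have "path_image c1 \<inter> path_image c2 = {p a, p b}"
      using two_paths_img[OF draw sg ys(1) ne(3) sub(2,3)] c1 c2 by simp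
    moreover have "path_image c1 \<inter> path_image c = {p a, p b}" "path_image c2 \<inter> path_image c = {p a, p b}"
      using two_paths_img[OF draw sg dist(1) ne(1) sub(1,2)] two_paths_img[OF draw sg dist(2) ne(2) sub(1,3)]
        c c1 c2 by auto
    ultimately obtain I1 I2 where I: "I1 = inside (path_image c1 \<union> path_image c)"
      "I2 = inside (path_image c2 \<union> path_image c)" "I1 \<inter> I2 = {}"
      "I1 \<union> I2 \<union> (path_image c - {p a, p b}) = inside ?C"
      using split_inside_simple_closed_curve[of c1 "p a" "p b" c2 c] c c1 c2 C arc_imp_simple_path by metis
    have cl: "closed (path_image c1 \<union> path_image c)" "closed (path_image c2 \<union> path_image c)"
      by (meson closed_Un closed_path_image arc_imp_path c(1) c1(1) c2(1))+
    define v1 v2 where "v1 = a # xs @ b # rev y1" and "v2 = a # xs @ b # rev y2"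
    have ce: "cycle_edges v1 = ?P \<union> ?Q1" "cycle_edges v2 = ?P \<union> ?Q2"
      unfolding v1_def v2_def by (rule cycle_edges_two_paths)+
    have img: "edge_img \<gamma> (cycle_edges v1) = path_image c1 \<union> path_image c"
      "edge_img \<gamma> (cycle_edges v2) = path_image c2 \<union> path_image c"
      by (auto simp: ce c c1 c2 edge_img_def)
    have "3 \<le> length v1" "3 \<le> length v2"
      using ne by (auto simp: v1_def v2_def Suc_le_eq neq_Nil_conv)
    moreover have "distinct v1" "distinct v2" using dist by (auto simp: v1_def v2_def)
    ultimately have cyc12: "is_cycle E v1" "is_cycle E v2"
      unfolding is_cycle_iff ce using sub by simp_all
    \<comment> \<open>One half may contain all vertices, for instance if the other is cut off by a
      single edge of the cycle. The induction measure therefore includes edges, and \<open>f\<close>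
      is an edge missing from the half.\<close>
    have step: "26 * card (side_edges E p \<gamma> vi Ii) + 28 + length vi \<le> 28 * card (side_verts V p vi Ii)"
      if vi: "is_cycle E vi" "Ii = inside (edge_img \<gamma> (cycle_edges vi))"
        "closed (edge_img \<gamma> (cycle_edges vi))" and f: "f \<in> E" "f \<notin> side_edges E p \<gamma> vi Ii" for vi Ii f
    proof -
      note side = side_subgraph[OF draw sg vi(1) closure_inside_subset[OF vi(3)], folded vi(2)]
      have sE: "side_edges E p \<gamma> vi Ii \<subset> E" and sV: "side_verts V p vi Ii \<subseteq> V"
        using side(1) f by (auto simp: subgraph_def)
      show ?thesis
      proof (rule less.hyps)
        show "card (side_verts V p vi Ii) + card (side_edges E p \<gamma> vi Ii) < card V + card E"
          using card_mono[OF fin(1) sV] psubset_card_mono[OF fin(2) sE] by linarith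
        show "plane_drawing (side_verts V p vi Ii) (side_edges E p \<gamma> vi Ii) p \<gamma>"
          using plane_drawing_mono[OF draw sV] sE by blast
        show "simple_graph (side_verts V p vi Ii) (side_edges E p \<gamma> vi Ii)"
          using side(1) by (simp add: subgraph_def)
        show "28 \<le> length ws" if "is_cycle (side_edges E p \<gamma> vi Ii) ws" for ws
          using g28 is_cycle_mono[OF that] sE by blast
        show "is_cycle (side_edges E p \<gamma> vi Ii) vi" by (rule side(2))
        show "open_arc p \<gamma> e \<subseteq> inside (edge_img \<gamma> (cycle_edges vi))"
          if "e \<in> side_edges E p \<gamma> vi Ii - cycle_edges vi" for e
          using that vi(2) by (auto simp: side_edges_def[OF draw sg])
        show "p v \<in> inside (edge_img \<gamma> (cycle_edges vi))" if "v \<in> side_verts V p vi Ii - set vi" for v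
          using that vi(2) by (auto simp: side_verts_def[OF draw sg])
        show "26 * card F + 28 \<le> 28 * card W"
          if "subgraph W F (side_verts V p vi Ii) (side_edges E p \<gamma> vi Ii)" "W \<noteq> {}" "card W < n" for W F
          using small[OF subgraph_trans[OF that(1) sV]] sE that by blast
        show "card (side_verts V p vi Ii) \<le> n" using card_mono[OF fin(1) sV] less.prems(8) by linarith
      qed
    qed
    let ?E1 = "side_edges E p \<gamma> v1 I1" and ?E2 = "side_edges E p \<gamma> v2 I2"
    let ?V1 = "side_verts V p v1 I1" and ?V2 = "side_verts V p v2 I2"
    have Isub: "I1 \<subseteq> inside ?C" "I2 \<subseteq> inside ?C" using I by auto
    have nQ: "f \<notin> side_edges E p \<gamma> v' I'" if "f \<in> cycle_edges vs" "f \<notin> cycle_edges v'" "I' \<subseteq> inside ?C" for f v' I'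
    proof -
      have "open_arc p \<gamma> f \<noteq> {}" using open_arc_connected(2)[OF draw sg, of f] that vs(3) by auto
      then show ?thesis using inC[OF that(1)] that by (auto simp: side_edges_def[OF draw sg])
    qed
    obtain f1 where f1: "f1 \<in> ?Q1" using path_edges_Cons[of "y1 @ [b]" a] by auto
    obtain f2 where f2: "f2 \<in> ?Q2" using path_edges_Cons[of "y2 @ [b]" a] by auto
    have b1: "26 * card ?E1 + 28 + length v1 \<le> 28 * card ?V1"
      using f2 PQ sub ys(4) cl I(1) img ce
      by (intro step[OF cyc12(1) _ _ _ nQ[OF _ _ Isub(1)], of f2]) auto
    have b2: "26 * card ?E2 + 28 + length v2 \<le> 28 * card ?V2"
      using f1 PQ sub ys(4) cl I(2) img ce
      by (intro step[OF cyc12(2) _ _ _ nQ[OF _ _ Isub(2)], of f1]) auto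
    have fin12: "finite ?E1" "finite ?E2" "finite ?V1" "finite ?V2"
      using fin finite_path_edges by (auto simp: side_edges_def[OF draw sg] side_verts_def[OF draw sg] ce)
    have EE: "E \<subseteq> ?E1 \<union> ?E2"
    proof
      fix e assume e: "e \<in> E"
      show "e \<in> ?E1 \<union> ?E2"
      proof (cases "e \<in> ?P \<or> e \<in> cycle_edges vs")
        case True
        then show ?thesis using ce ys(4) by (auto simp: side_edges_def[OF draw sg])
      next
        case False
        then have "open_arc p \<gamma> e \<subseteq> inside ?C" "open_arc p \<gamma> e \<inter> path_image c = {}"
          using inE[of e] e open_arc_disjoint[OF draw sg e sub(1)] c(4) by auto
        then have "open_arc p \<gamma> e \<subseteq> I1 \<union> I2" using I(4) by blast
        moreover have "open I1" "open I2" using I(1,2) cl open_inside by auto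
        ultimately show ?thesis
          using open_arc_in_component[OF draw sg e _ _ I(3)] e by (auto simp: side_edges_def[OF draw sg])
      qed
    qed
    have "card E + card ?P \<le> card (?E1 \<union> ?E2) + card (?E1 \<inter> ?E2)"
      using EE fin12 by (intro add_mono card_mono) (auto simp: side_edges_def[OF draw sg] ce)
    then have cE: "card E + (length xs + 1) \<le> card ?E1 + card ?E2"
      using card_Un_Int[OF fin12(1,2)] card_path_edges[OF ear(3)] by simp
    have VV: "?V1 \<union> ?V2 \<subseteq> V"
      using cycle_verts_subset[OF draw sg cyc12(1)] cycle_verts_subset[OF draw sg cyc12(2)]
      by (auto simp: side_verts_def[OF draw sg])
    have vert_C: "p v \<notin> inside ?C" if "v \<in> set vs" for v
    proof -
      have "v \<in> \<Union> (cycle_edges vs)" using that cycle_edges_Union[OF vs(1)] by simp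
      then have "p v \<in> ?C" using vertices_in_img[OF draw sg] vs(3) by (fastforce simp: edge_img_def)
      then show ?thesis using not_in_if_inside by blast
    qed
    have "?V1 \<inter> ?V2 \<subseteq> set (a # xs @ [b])"
    proof
      fix v assume v: "v \<in> ?V1 \<inter> ?V2"
      have "p v \<notin> I1 \<or> p v \<notin> I2" using I(3) by blast
      then have "v \<in> set v1 \<or> v \<in> set v2" using v by (auto simp: side_verts_def[OF draw sg])
      moreover have "v \<in> set v1 \<or> p v \<in> inside ?C" "v \<in> set v2 \<or> p v \<in> inside ?C"
        using v Isub by (auto simp: side_verts_def[OF draw sg])
      moreover have "set v1 = insert a (insert b (set xs \<union> set y1))"
        "set v2 = insert a (insert b (set xs \<union> set y2))" by (auto simp: v1_def v2_def)
      ultimately show "v \<in> set (a # xs @ [b])" using vert_C[of v] ys(1,2) by auto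
    qed
    then have "card (?V1 \<union> ?V2) + card (?V1 \<inter> ?V2) \<le> card V + card (set (a # xs @ [b]))"
      using VV fin by (intro add_mono card_mono) auto
    then have cV: "card ?V1 + card ?V2 \<le> card V + (length xs + 2)"
      using card_Un_Int[OF fin12(3,4)] distinct_card[OF ear(3)] by simp
    have "length v1 = length xs + length y1 + 2" "length v2 = length xs + length y2 + 2"
      by (auto simp: v1_def v2_def)
    \<comment> \<open>With k inner vertices on the dividing path, adding the two bounds counts k + 1
      edges and at most k + 2 vertices twice, and the lengths of the two cycles add up to |C| + 2 k
      + 2. The surplus 26 (k + 1) + 2 k + 2 equals 28 (k + 1), so exactly the claim remains.\<close>
    then show ?thesis using b1 b2 cE cV ys(3) by linarith
  next
    case no_ear: False
    show ?thesis
    proof (cases "V = set vs")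
      case True
      have "E \<subseteq> cycle_edges vs"
      proof
        fix e assume e: "e \<in> E"
        then obtain a b where ab: "e = {a, b}" "a \<noteq> b" using simple_graph_edge_obtain[OF sg] by metis
        then have "a \<in> set vs" "b \<in> set vs" using sg e True by (auto simp: simple_graph_def)
        then show "e \<in> cycle_edges vs"
          using no_ear[simplified not_ex, rule_format, of a b "[]"] ab e by auto
      qed
      then have "card E \<le> length vs"
        using card_cycle_edges[OF vs(2,1)] card_mono[of "cycle_edges vs" E] vs(3) fin finite_subset by metis
      moreover have "card V = length vs" using True distinct_card[OF vs(2)] by simp
      \<comment> \<open>For a bare cycle the claim reduces to its length being at least 28; this is
        where the girth enters.\<close>
      ultimately show ?thesis using g28[OF cyc] by linarith
    next
      case False
      then obtain x where x: "x \<in> V" "x \<notin> set vs" using vsV by blast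
      \<comment> \<open>\<open>R\<close> is the component of \<open>x\<close> after removal of the
        cycle, and \<open>T\<close> its set of attachments on the cycle. Two attachments would yield
        a path of the kind excluded in this case.\<close>
      define r where "r = {(u, v). {u, v} \<in> E \<and> u \<notin> set vs \<and> v \<notin> set vs}"
      define R where "R = {y. (x, y) \<in> r\<^sup>*}"
      define T where "T = {c \<in> set vs. \<exists>y\<in>R. {y, c} \<in> E}"
      have xR: "x \<in> R" by (simp add: R_def)
      have R: "y \<in> V \<and> y \<notin> set vs" if "y \<in> R" for y
        using that unfolding R_def mem_Collect_eq
        by (induction rule: rtrancl_induct) (use x simple_graph_edge[OF sg] in \<open>auto simp: r_def\<close>)
      have RT: "e \<subseteq> R \<union> T" if e: "e \<in> E" "e \<inter> R \<noteq> {}" for e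
      proof -
        obtain y where y: "y \<in> e" "y \<in> R" using e by blast
        then obtain z where z: "e = {y, z}"
          using simple_graph_edge_obtain[OF sg e(1)] by (metis insert_commute insert_iff singletonD)
        show ?thesis
        proof (cases "z \<in> set vs")
          case True
          then show ?thesis using y z e by (auto simp: T_def)
        next
          case False
          then have "(y, z) \<in> r" using R[OF y(2)] e z by (simp add: r_def)
          then have "z \<in> R" using y(2) unfolding R_def by (auto intro: rtrancl_into_rtrancl)
          then show ?thesis using y z by simp
        qed
      qed
      have T1: "a = b" if ab: "a \<in> T" "b \<in> T" for a b
      proof (rule ccontr)
        assume "a \<noteq> b"
        obtain y1 y2 where y: "y1 \<in> R" "{y1, a} \<in> E" "y2 \<in> R" "{y2, b} \<in> E" using ab by (auto simp: T_def)
        have "sym r" by (auto simp: r_def sym_def insert_commute)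
        then have "(y1, x) \<in> r\<^sup>*" using y(1) unfolding R_def by (simp add: sym_rtrancl symD)
        then have "(y1, y2) \<in> r\<^sup>*" using y(3) unfolding R_def by (auto intro: rtrancl_trans)
        then obtain zs where zs: "distinct zs" "zs \<noteq> []" "hd zs = y1" "last zs = y2"
          "set zs \<subseteq> {z. (y1, z) \<in> r\<^sup>*}" "\<And>e. e \<in> path_edges zs \<Longrightarrow> \<exists>u v. e = {u, v} \<and> (u, v) \<in> r"
          by (rule rtrancl_path) blast
        have "set zs \<subseteq> R" using zs(5) y(1) unfolding R_def by (auto intro: rtrancl_trans)
        then have zvs: "set zs \<inter> set vs = {}" using R by blast
        have abvs: "a \<in> set vs" "b \<in> set vs" using ab by (auto simp: T_def)
        then have d: "distinct (a # zs @ [b])" using zs(1) zvs \<open>a \<noteq> b\<close> by auto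
        have pe: "path_edges (a # zs @ [b]) = insert {a, y1} (insert {y2, b} (path_edges zs))"
        proof -
          obtain zs' where zs': "zs = zs' @ [y2]" using zs(2,4) by (metis append_butlast_last_id)
          have "path_edges (zs @ [b]) = insert {y2, b} (path_edges zs)"
            using path_edges_append[of zs' y2 "[b]"] zs' by simp
          moreover have "hd (zs @ [b]) = y1" using zs(2,3) by simp
          ultimately show ?thesis using path_edges_Cons[of "zs @ [b]" a] by simp
        qed
        have "path_edges (a # zs @ [b]) \<subseteq> E"
          unfolding pe using y zs(6) by (auto simp: r_def insert_commute)
        moreover have "path_edges (a # zs @ [b]) \<inter> cycle_edges vs = {}"
        proof -
          have "y1 \<notin> set vs" "y2 \<notin> set vs" using R y by auto
          moreover have "e \<subseteq> set vs" if "e \<in> cycle_edges vs" for e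
            using that cycle_edges_Union[OF vs(1)] by blast
          ultimately have "{a, y1} \<notin> cycle_edges vs" "{y2, b} \<notin> cycle_edges vs" by blast+
          moreover have "e \<notin> cycle_edges vs" if e: "e \<in> path_edges zs" for e
          proof
            assume "e \<in> cycle_edges vs"
            then have "e \<subseteq> set vs" using cycle_edges_Union[OF vs(1)] by blast
            moreover obtain u v where "e = {u, v}" "(u, v) \<in> r" using zs(6)[OF e] by blast
            ultimately show False by (auto simp: r_def)
          qed
          ultimately show ?thesis unfolding pe by blast
        qed
        ultimately have "a \<in> set vs \<and> b \<in> set vs \<and> distinct (a # zs @ [b]) \<and> set zs \<inter> set vs = {} \<and>
          path_edges (a # zs @ [b]) \<subseteq> E - cycle_edges vs" using abvs d zvs by blast
        then show False using no_ear by blast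
      qed
      have RV: "R \<subseteq> V" using R by blast
      have finR: "finite R" using RV fin(1) by (rule finite_subset)
      have TV: "T \<subseteq> set vs" by (auto simp: T_def)
      have cT: "card T \<le> 1"
        using T1 TV by (metis One_nat_def List.finite_set card_le_Suc0_iff_eq finite_subset)
      let ?F1 = "{e \<in> E. e \<inter> R \<noteq> {}}" and ?F2 = "{e \<in> E. e \<inter> R = {}}"
      have sgF1: "simple_graph (R \<union> T) ?F1"
        using RT RV TV vsV by (intro simple_graph_subset[OF sg]) auto
      \<comment> \<open>The piece need not contain a cycle, so it needs the bound without a cycle
        term, supplied by \<open>small\<close> for fewer than \<open>n\<close> vertices. As
        \<open>T\<close> has at most one element, the piece misses a vertex of the cycle and is
        small enough.\<close>
      have "26 * card ?F1 + 28 \<le> 28 * card (R \<union> T)"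
      proof (rule small)
        show "subgraph (R \<union> T) ?F1 V E" using sgF1 RV TV vsV by (auto simp: subgraph_def)
        show "R \<union> T \<noteq> {}" using xR by blast
        have "card T < card (set vs)" using cT distinct_card[OF vs(2)] vs(1) by simp
        then have "\<not> set vs \<subseteq> T" using card_mono[of T "set vs"] TV finite_subset[OF TV] by auto
        then obtain w where w: "w \<in> set vs" "w \<notin> T" by blast
        then have "w \<notin> R \<union> T" using R by blast
        then have "R \<union> T \<subset> V" using RV TV vsV w by blast
        then have "card (R \<union> T) < card V" using psubset_card_mono[OF fin(1)] by blast
        then show "card (R \<union> T) < n" using less.prems(8) by linarith
      qed
      \<comment> \<open>The additive constant 28 pays exactly for the one attachment vertex.\<close>
      then have b1: "26 * card ?F1 \<le> 28 * card R"
        using cT card_Un_le[of R T] by linarith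
      have F2sub: "?F2 \<subseteq> E" by blast
      have sgF2: "simple_graph (V - R) ?F2" using simple_graph_del[OF sg, of R] by (simp add: del_def)
      have cyc2: "is_cycle ?F2 vs"
      proof -
        have "e \<inter> R = {}" if "e \<in> cycle_edges vs" for e
          using that cycle_edges_Union[OF vs(1)] R by blast
        then show ?thesis using vs by (auto simp: is_cycle_iff)
      qed
      have "26 * card ?F2 + 28 + length vs \<le> 28 * card (V - R)"
      proof (rule less.hyps)
        have "card (V - R) < card V" using x xR fin by (intro psubset_card_mono) auto
        moreover have "card ?F2 \<le> card E" using fin by (intro card_mono) auto
        ultimately show "card (V - R) + card ?F2 < card V + card E" by linarith
        show "plane_drawing (V - R) ?F2 p \<gamma>" using plane_drawing_mono[OF draw Diff_subset F2sub] .
        show "28 \<le> length ws" if "is_cycle ?F2 ws" for ws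
          using g28 is_cycle_mono[OF that F2sub] .
        show "26 * card F + 28 \<le> 28 * card W" if "subgraph W F (V - R) ?F2" "W \<noteq> {}" "card W < n" for W F
          using small[OF subgraph_trans[OF that(1)]] that by blast
        show "card (V - R) \<le> n" using less.prems(8) card_mono[OF fin(1), of "V - R"] by auto
      qed (use sgF2 cyc2 inE inV in auto)
      moreover have "card E = card ?F1 + card ?F2"
      proof -
        have "E = ?F1 \<union> ?F2" by blast
        then show ?thesis using card_Un_disjoint[of ?F1 ?F2] fin by auto
      qed
      moreover have "card V = card R + card (V - R)"
        using card_Diff_subset[OF finR RV] card_mono[OF fin(1) RV] by simp
      ultimately show ?thesis using b1 by linarith
    qed
  qed
qed


text \<open>Without vertices of degree at most 1 there is a cycle, and \<open>disc_bound\<close>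
  applies to both of its sides with \<open>n\<close> the number of vertices of the whole graph. The
  sum of the two bounds is even 26 |E| + 56 <= 28 |V|; the constant 28 is chosen so that a single
  vertex also satisfies the bound.\<close>

theorem planar_girth_28_bound:
  assumes "plane_drawing V E p \<gamma>" "simple_graph V E" "V \<noteq> {}"
    and "\<And>vs. is_cycle E vs \<Longrightarrow> 28 \<le> length vs"
  shows "26 * card E + 28 \<le> 28 * card V"
  using assms
proof (induction "card V" arbitrary: V E rule: less_induct)
  case less
  note draw = less.prems(1) and sg = less.prems(2) and g28 = less.prems(4)
  have fin: "finite V" "finite E" "\<And>v. finite (nb E v)" using simple_graph_finite[OF sg] by auto
  have small: "26 * card F + 28 \<le> 28 * card W"
    if "subgraph W F V E" "W \<noteq> {}" "card W < card V" for W F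
  proof (rule less.hyps[OF that(3) _ _ that(2)])
    show "plane_drawing W F p \<gamma>" "simple_graph W F"
      using that plane_drawing_mono[OF draw] by (auto simp: subgraph_def)
    show "28 \<le> length vs" if "is_cycle F vs" for vs
      using g28 is_cycle_mono[OF that] \<open>subgraph W F V E\<close> by (auto simp: subgraph_def)
  qed
  show ?case
  proof (cases "\<exists>v\<in>V. card (nb E v) \<le> 1")
    case True
    then obtain v where v: "v \<in> V" "card (nb E v) \<le> 1" by blast
    have "card {e \<in> E. v \<in> e} \<le> 1" using v(2) card_nb[OF sg, of v] by (simp add: vertex_degree_def)
    moreover have "E = del {v} E \<union> {e \<in> E. v \<in> e}" by (auto simp: del_def)
    then have "card E \<le> card (del {v} E) + card {e \<in> E. v \<in> e}" by (metis card_Un_le)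
    ultimately have cE: "card E \<le> card (del {v} E) + 1" by linarith
    show ?thesis
    proof (cases "V = {v}")
      case True
      have "e \<notin> E" for e
        using sg True by (auto simp: simple_graph_def dest!: bspec subset_singletonD)
      then have "E = {}" by blast
      then show ?thesis using True by simp
    next
      case False
      have "26 * card (del {v} E) + 28 \<le> 28 * card (V - {v})"
      proof (rule small)
        show "subgraph (V - {v}) (del {v} E) V E"
          using simple_graph_del[OF sg, of "{v}"] by (auto simp: subgraph_def del_def)
        show "V - {v} \<noteq> {}" using False v by blast
        show "card (V - {v}) < card V" using v fin by (intro psubset_card_mono) auto
      qed
      moreover have "card V = card (V - {v}) + 1" using card.remove[OF fin(1) v(1)] by simp
      ultimately show ?thesis using cE by linarith
    qed
  next
    case False
    then have deg: "card (nb E v) \<ge> 2" if "v \<in> V" for v using that by fastforce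
    obtain x where x: "x \<in> V" using less.prems(3) by blast
    then have "nb E x \<noteq> {}" using deg[OF x] by auto
    then obtain y where y: "y \<in> nb E x" by blast
    let ?w = "nbwalk E x y"
    note w = nbwalk_step[OF sg deg y]
    have "?w i \<in> V" for i
      using w(1)[of i] simple_graph_edge(1)[OF sg] by (auto simp: nb_def)
    then have "range ?w \<subseteq> V" by blast
    then have "\<not> inj ?w" using fin(1) finite_subset range_inj_infinite by blast
    then obtain i j where ij: "i < j" "?w i = ?w j"
      unfolding inj_def by (metis linorder_neqE_nat)
    have "\<exists>vs. is_cycle E vs \<and> set vs \<subseteq> ?w ` {i..j} \<and> length vs \<le> j - i"
    proof (rule walk_imp_cycle[OF sg ij])
      show "{?w k, ?w (Suc k)} \<in> E" for k using w(1)[of k] by (simp add: nb_def)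
      show "?w k \<noteq> ?w (Suc (Suc k))" for k using w(2)[of k] by metis
    qed
    then obtain vs where cyc: "is_cycle E vs" by blast
    then have vs: "3 \<le> length vs" "distinct vs" "cycle_edges vs \<subseteq> E" by (auto simp: is_cycle_iff)
    let ?C = "edge_img \<gamma> (cycle_edges vs)"
    obtain c where c: "simple_path c" "pathfinish c = pathstart c" "path_image c = ?C"
      using cycle_curve[OF draw sg cyc] .
    note J = Jordan_inside_outside[OF c(1,2), unfolded c(3)]
    have clC: "closed ?C" using c closed_path_image simple_path_imp_path by metis
    have "closure (inside ?C) \<subseteq> ?C \<union> inside ?C" using clC by (rule closure_inside_subset)
    note side_in = side_subgraph[OF draw sg cyc this]
    have "closure (outside ?C) \<subseteq> ?C \<union> outside ?C" using clC by (rule closure_outside_subset)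
    note side_out = side_subgraph[OF draw sg cyc this]
    let ?E1 = "side_edges E p \<gamma> vs (inside ?C)" and ?E2 = "side_edges E p \<gamma> vs (outside ?C)"
    let ?V1 = "side_verts V p vs (inside ?C)" and ?V2 = "side_verts V p vs (outside ?C)"
    note sd = side_edges_def[OF draw sg] side_verts_def[OF draw sg]
    have sub1: "?V1 \<subseteq> V" "?E1 \<subseteq> E" "simple_graph ?V1 ?E1"
      and sub2: "?V2 \<subseteq> V" "?E2 \<subseteq> E" "simple_graph ?V2 ?E2"
      using side_in(1) side_out(1) by (auto simp: subgraph_def)
    have b1: "26 * card ?E1 + 28 + length vs \<le> 28 * card ?V1"
    proof (rule disc_bound[of _ _ p \<gamma> vs "card V"])
      show "plane_drawing ?V1 ?E1 p \<gamma>" using plane_drawing_mono[OF draw sub1(1,2)] .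
      show "28 \<le> length ws" if "is_cycle ?E1 ws" for ws using g28 is_cycle_mono[OF that sub1(2)] .
      show "26 * card F + 28 \<le> 28 * card W" if "subgraph W F ?V1 ?E1" "W \<noteq> {}" "card W < card V" for W F
        using small[OF subgraph_trans[OF that(1) sub1(1,2)] that(2,3)] .
      show "card ?V1 \<le> card V" using card_mono[OF fin(1) sub1(1)] .
    qed (use sub1 side_in(2) in \<open>auto simp: sd\<close>)
    \<comment> \<open>Being strictly inside, \<open>z0\<close> lies on no vertex or edge of the
      outer part, so the inversion yields a drawing of that part.\<close>
    obtain z0 where z0: "z0 \<in> inside ?C" using J by blast
    define f where "f = (\<lambda>z. inverse (z - z0))"
    have imgf: "edge_img (\<lambda>e. f \<circ> \<gamma> e) (cycle_edges vs) = f ` ?C"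
      by (auto simp: edge_img_def path_image_compose)
    have fout: "f ` outside ?C \<subseteq> inside (f ` ?C)"
      using inversion_outside[OF c(1,2)] z0 c(3) by (simp add: f_def)
    have z0C: "z0 \<notin> ?C" "z0 \<notin> outside ?C" using z0 J not_in_if_inside by blast+
    have vC: "p v \<in> ?C" if "v \<in> set vs" for v
    proof -
      have "v \<in> \<Union> (cycle_edges vs)" using that cycle_edges_Union[OF vs(1)] by simp
      then obtain e where "e \<in> cycle_edges vs" "v \<in> e" by blast
      then show ?thesis using vertices_in_img[OF draw sg, of e] vs(3) by (auto simp: edge_img_def)
    qed
    have b2: "26 * card ?E2 + 28 + length vs \<le> 28 * card ?V2"
    proof (rule disc_bound[of _ _ "f \<circ> p" "\<lambda>e. f \<circ> \<gamma> e" vs "card V"])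
      show "plane_drawing ?V2 ?E2 (f \<circ> p) (\<lambda>e. f \<circ> \<gamma> e)"
        unfolding f_def
      proof (rule plane_drawing_inversion)
        show "plane_drawing ?V2 ?E2 p \<gamma>" using plane_drawing_mono[OF draw sub2(1,2)] .
        show "z0 \<noteq> p v" if "v \<in> ?V2" for v using that z0C vC by (auto simp: sd)
        show "z0 \<notin> path_image (\<gamma> e)" if "e \<in> ?E2" for e
        proof (cases "e \<in> cycle_edges vs")
          case True
          then show ?thesis using z0C by (auto simp: edge_img_def)
        next
          case False
          then have "open_arc p \<gamma> e \<subseteq> outside ?C" using that by (auto simp: sd)
          moreover have "e \<subseteq> ?V2" using sub2(3) that by (auto simp: simple_graph_def)
          then have "p ` e \<subseteq> ?C \<union> outside ?C" using vC by (auto simp: sd)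
          ultimately show ?thesis using z0C by (auto simp: open_arc_def)
        qed
      qed
      show "28 \<le> length ws" if "is_cycle ?E2 ws" for ws using g28 is_cycle_mono[OF that sub2(2)] .
      show "open_arc (f \<circ> p) (\<lambda>e. f \<circ> \<gamma> e) e \<subseteq> inside (edge_img (\<lambda>e. f \<circ> \<gamma> e) (cycle_edges vs))"
        if "e \<in> ?E2 - cycle_edges vs" for e
      proof -
        have "open_arc p \<gamma> e \<subseteq> outside ?C" using that by (auto simp: sd)
        then have "f ` open_arc p \<gamma> e \<subseteq> inside (f ` ?C)" using fout by blast
        moreover have "open_arc (f \<circ> p) (\<lambda>e. f \<circ> \<gamma> e) e \<subseteq> f ` open_arc p \<gamma> e"
          by (auto simp: open_arc_def path_image_compose)
        ultimately show ?thesis unfolding imgf by blast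
      qed
      show "(f \<circ> p) v \<in> inside (edge_img (\<lambda>e. f \<circ> \<gamma> e) (cycle_edges vs))" if "v \<in> ?V2 - set vs" for v
        unfolding imgf using that fout by (auto simp: sd)
      show "26 * card F + 28 \<le> 28 * card W" if "subgraph W F ?V2 ?E2" "W \<noteq> {}" "card W < card V" for W F
        using small[OF subgraph_trans[OF that(1) sub2(1,2)] that(2,3)] .
      show "card ?V2 \<le> card V" using card_mono[OF fin(1) sub2(1)] .
    qed (use sub2 side_out(2) in auto)
    have "E \<subseteq> ?E1 \<union> ?E2"
    proof
      fix e assume e: "e \<in> E"
      show "e \<in> ?E1 \<union> ?E2"
      proof (cases "e \<in> cycle_edges vs")
        case False
        then have "open_arc p \<gamma> e \<subseteq> inside ?C \<union> outside ?C"
          using open_arc_disjoint[OF draw sg e vs(3)] by auto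
        then show ?thesis
          using open_arc_in_component[OF draw sg e, of "inside ?C" "outside ?C"] J e by (auto simp: sd)
      qed (simp add: sd)
    qed
    moreover have "finite ?E1" "finite ?E2" using sub1 sub2 fin(2) finite_subset by blast+
    moreover have "cycle_edges vs \<subseteq> ?E1 \<inter> ?E2" by (auto simp: sd)
    ultimately have "card E + length vs \<le> card ?E1 + card ?E2"
      using card_Un_Int[of ?E1 ?E2] card_cycle_edges[OF vs(2,1)] card_mono[of "?E1 \<union> ?E2" E]
        card_mono[of "?E1 \<inter> ?E2" "cycle_edges vs"] by simp
    moreover have "card ?V1 + card ?V2 \<le> card V + length vs"
    proof -
      have "?V1 \<inter> ?V2 \<subseteq> set vs" by (auto simp: sd inside_def outside_def)
      moreover have "finite ?V1" "finite ?V2" using sub1 sub2 fin(1) finite_subset by blast+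
      ultimately show ?thesis
        using card_Un_Int[of ?V1 ?V2] card_mono[of "set vs" "?V1 \<inter> ?V2"] distinct_card[OF vs(2)]
          card_mono[of V "?V1 \<union> ?V2"] sub1(1) sub2(1) fin(1) by simp
    qed
    ultimately show ?thesis using b1 b2 by linarith
  qed
qed

section \<open>Degree, girth and average degree in the final assembly\<close>

lemma card_nb_le_max_degree:
  assumes sg: "simple_graph V E"
  shows "card (nb E v) \<le> max_degree V E"
proof (cases "v \<in> V")
  case True
  then show ?thesis
    unfolding max_degree_def card_nb[OF sg] using simple_graph_finite[OF sg] by (intro Max_ge) auto
next
  case False
  then have "nb E v = {}" using simple_graph_edge(1)[OF sg] by (auto simp: nb_def)
  then show ?thesis by simp
qed

lemma girth_le_cycle:
  assumes "enat k \<le> girth E" "is_cycle E vs"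
  shows "k \<le> length vs"
proof -
  have "girth E \<le> enat (length vs)" unfolding girth_def using assms(2) by (intro INF_lower) simp
  then show ?thesis using assms(1) by (metis enat_ord_simps(1) order_trans)
qed

text \<open>\<open>Max\<close> bounds its elements only for finite sets; here all values come from
  pairs in \<open>Pow V \<times> Pow E\<close>.\<close>

lemma average_degree_le_mad:
  assumes sg: "simple_graph V E" and sub: "subgraph W F V E" "W \<noteq> {}"
  shows "2 * real (card F) / real (card W) \<le> mad V E"
  unfolding mad_def
proof (rule Max_ge)
  have "{2 * real (card F) / real (card W) | W F. subgraph W F V E \<and> W \<noteq> {}} \<subseteq>
    (\<lambda>(W, F). 2 * real (card F) / real (card W)) ` (Pow V \<times> Pow E)"
    by (auto simp: subgraph_def image_iff)
  then show "finite {2 * real (card F) / real (card W) | W F. subgraph W F V E \<and> W \<noteq> {}}"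
    by (rule finite_subset) (use simple_graph_finite[OF sg] in blast)
qed (use sub in blast)

theorem theorem1p9:
  fixes V :: "'a set" and E :: "'a set set"
  assumes "simple_graph V E" and "max_degree V E \<le> 4"
  shows "(girth E \<ge> 7 \<and> mad V E < 2 + 2 / 13 \<longrightarrow> strong_chromatic_index E \<le> 7) \<and>
         (planar V E \<and> girth E \<ge> 28 \<longrightarrow> strong_chromatic_index E \<le> 7)"
proof -
  have main: "strong_chromatic_index E \<le> 7"
    if g: "\<And>vs. is_cycle E vs \<Longrightarrow> 7 \<le> length vs"
      and s: "\<And>W F. subgraph W F V E \<Longrightarrow> W \<noteq> {} \<Longrightarrow> 13 * card F < 14 * card W"
  proof -
    have "card (nb E v) \<le> 4" for v
      using card_nb_le_max_degree[OF assms(1), of v] assms(2) by linarith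
    then obtain \<phi> where "odd_hom E \<phi>" using odd_hom_exists[OF assms(1) _ g s] by blast
    then show ?thesis using strong_chromatic_index_le_7[OF assms(1)] by blast
  qed
  show ?thesis
  proof (intro conjI impI; elim conjE)
    assume g: "girth E \<ge> 7" and mad: "mad V E < 2 + 2 / 13"
    show "strong_chromatic_index E \<le> 7"
    proof (rule main)
      show "7 \<le> length vs" if "is_cycle E vs" for vs
        using girth_le_cycle[of 7 E vs] g that by (simp add: numeral_eq_enat)
      show "13 * card F < 14 * card W" if sub: "subgraph W F V E" "W \<noteq> {}" for W F
      proof -
        have "finite W" using sub by (auto simp: subgraph_def simple_graph_def)
        then have "real (card W) > 0" using sub by (simp add: card_gt_0_iff)
        moreover have "2 * real (card F) / real (card W) < 28 / 13"
          using average_degree_le_mad[OF assms(1) sub] mad by simp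
        ultimately have "13 * real (card F) < 14 * real (card W)" by (simp add: field_simps)
        then show ?thesis by linarith
      qed
    qed
  next
    assume pl: "planar V E" and g: "girth E \<ge> 28"
    obtain p \<gamma> where draw: "plane_drawing V E p \<gamma>" using pl by (auto simp: planar_def)
    have g28: "28 \<le> length vs" if "is_cycle E vs" for vs
      using girth_le_cycle[of 28 E vs] g that by (simp add: numeral_eq_enat)
    show "strong_chromatic_index E \<le> 7"
    proof (rule main)
      show "7 \<le> length vs" if "is_cycle E vs" for vs using g28[OF that] by linarith
      show "13 * card F < 14 * card W" if sub: "subgraph W F V E" "W \<noteq> {}" for W F
      proof -
        have WF: "W \<subseteq> V" "F \<subseteq> E" "simple_graph W F" using sub by (auto simp: subgraph_def)
        have "26 * card F + 28 \<le> 28 * card W"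
          using g28 is_cycle_mono[OF _ WF(2)]
          by (intro planar_girth_28_bound[OF plane_drawing_mono[OF draw WF(1,2)] WF(3) sub(2)]) blast
        then show ?thesis by linarith
      qed
    qed
  qed
qed

end
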